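(* Let $(\alpha,\beta,\gamma)$ be a K-stable triple of partitions. Then $(\alpha,\beta,\gamma)$ is H-stable.
   Context: For a partition $\lambda$ of $n$ (written $\lambda\vdash n$, $|\lambda|=n$), $V_\lambda$ denotes the associated irreducible complex representation of the symmetric group $S_n$. Partitions are viewed as vectors (padded with trailing zeros), so addition of partitions and multiplication by nonnegative integers are coordinatewise. Kronecker coefficients: for $\lambda,\mu,\nu\vdash n$, $g_{\mu,\nu}^{\lambda}$ is the multiplicity of $V_\lambda$ in $\mathrm{Res}^{S_n\times S_n}_{S_n}(V_\mu\otimes V_\nu)$, where $S_n\hookrightarrow S_n\times S_n$ is the diagonal embedding. A K-triple is a triple $(\alpha,\beta,\gamma)$ of partitions of the same size with $g_{\beta,\gamma}^{\alpha}>0$. A K-triple is K-stable if for every triple of partitions $(\lambda,\mu,\nu)$ with $|\lambda|=|\mu|=|\nu|$ the sequence $\{g_{\mu+n\beta,\nu+n\gamma}^{\lambda+n\alpha}\}_n$ is eventually constant. Heisenberg product: let $V$ be a representation of $S_n$ and $W$ a representation of $S_m$. For an integer $l$ with $\max\{m,n\}\le l\le m+n$, put $p=l-m$, $q=n+m-l$, $r=l-n$. Embed $S_p\times S_q\times S_r$ in $S_n\times S_m=S_{p+q}\times S_{q+r}$ as the composite of $\mathrm{id}\times\Delta_{S_q}\times \mathrm{id}: S_p\times S_q\times S_r\to (S_p\times S_q)\times (S_q\times S_r)$ (with $\Delta_{S_q}$ the diagonal) with the standard Young subgroup inclusions $S_p\times S_q\subset S_{p+q}$, $S_q\times S_r\subset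 S_{q+r}$; also embed $S_p\times S_q\times S_r$ in $S_l=S_{p+q+r}$ as a Young subgroup. Put $(V\#W)_l=\mathrm{Ind}_{S_p\times S_q\times S_r}^{S_l}\mathrm{Res}^{S_n\times S_m}_{S_p\times S_q\times S_r}(V\otimes W)$ and $V\#W=\bigoplus_{l=\max\{n,m\}}^{n+m}(V\#W)_l$. The Heisenberg coefficient $h_{\mu,\nu}^{\lambda}$ is the multiplicity of $V_\lambda$ in $V_\mu\#V_\nu$. An H-triple is a triple $(\alpha,\beta,\gamma)$ of partitions with $\max\{|\beta|,|\gamma|\}\le|\alpha|\le|\beta|+|\gamma|$ and $h_{\beta,\gamma}^{\alpha}>0$. An H-triple is H-stable if for every triple of partitions $(\lambda,\mu,\nu)$ with $\max\{|\mu|,|\nu|\}\le|\lambda|\le|\mu|+|\nu|$ the sequence $\{h_{\mu+n\beta,\nu+n\gamma}^{\lambda+n\alpha}\}_n$ is eventually constant. *)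

theory Defs
  imports Complex_Main "HOL-Library.Function_Algebras" "HOL-Algebra.Sym_Groups"
begin

section \<open>Partitions\<close>

text \<open>A partition is the infinite vector of its parts, padded with zeros and indexed from 0.\<close>

definition is_partition :: "(nat \<Rightarrow> nat) \<Rightarrow> bool" where
  "is_partition lam \<longleftrightarrow> antimono lam \<and> finite {i. lam i \<noteq> 0}"

definition psize :: "(nat \<Rightarrow> nat) \<Rightarrow> nat" where
  "psize lam = (\<Sum>i | lam i \<noteq> 0. lam i)"

definition add_multiple :: "(nat \<Rightarrow> nat) \<Rightarrow> nat \<Rightarrow> (nat \<Rightarrow> nat) \<Rightarrow> (nat \<Rightarrow> nat)" where
  "add_multiple lam n \<alpha> = (\<lambda>i. lam i + n * \<alpha> i)"


section \<open>Complex representations\<close>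

text \<open>
  A representation of a group \<open>G\<close> is carried by a complex subspace of some function space
  \<open>'x \<Rightarrow> complex\<close> (with pointwise operations), on which the elements of the carrier of \<open>G\<close> act.
  The values of \<open>rep_act\<close> outside the subspace or outside the carrier of \<open>G\<close> are irrelevant.
\<close>

record ('g, 'x) rep =
  rep_space :: "('x \<Rightarrow> complex) set"
  rep_act :: "'g \<Rightarrow> ('x \<Rightarrow> complex) \<Rightarrow> ('x \<Rightarrow> complex)"

definition fscale :: "complex \<Rightarrow> ('x \<Rightarrow> complex) \<Rightarrow> ('x \<Rightarrow> complex)" where
  "fscale c f = (\<lambda>x. c * f x)"

interpretation fun_vs: vector_space "fscale :: complex \<Rightarrow> ('x \<Rightarrow> complex) \<Rightarrow> 'x \<Rightarrow> complex"
  by standard (simp_all add: fscale_def fun_eq_iff algebra_simps)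

definition subrep :: "('g, 'm) monoid_scheme \<Rightarrow> ('x \<Rightarrow> complex) set \<Rightarrow> ('g, 'x) rep \<Rightarrow> bool" where
  "subrep G U W \<longleftrightarrow> fun_vs.subspace U \<and> U \<subseteq> rep_space W \<and>
     (\<forall>g\<in>carrier G. \<forall>u\<in>U. rep_act W g u \<in> U)"

definition irreducible_rep :: "('g, 'm) monoid_scheme \<Rightarrow> ('g, 'x) rep \<Rightarrow> bool" where
  "irreducible_rep G W \<longleftrightarrow> rep_space W \<noteq> {0} \<and>
     (\<forall>U. subrep G U W \<longrightarrow> U = {0} \<or> U = rep_space W)"

definition rep_iso :: "('g, 'm) monoid_scheme \<Rightarrow> ('g, 'x) rep \<Rightarrow> ('g, 'y) rep \<Rightarrow> bool" where
  "rep_iso G V W \<longleftrightarrow> (\<exists>T. bij_betw T (rep_space V) (rep_space W) \<and>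
     (\<forall>u\<in>rep_space V. \<forall>v\<in>rep_space V. T (u + v) = T u + T v) \<and>
     (\<forall>c. \<forall>v\<in>rep_space V. T (fscale c v) = fscale c (T v)) \<and>
     (\<forall>g\<in>carrier G. \<forall>v\<in>rep_space V. T (rep_act V g v) = rep_act W g (T v)))"

text \<open>\<open>W\<close> is the internal direct sum of irreducible subrepresentations \<open>U 0, \<dots>, U (k - 1)\<close>.\<close>

definition irreducible_decomposition ::
  "('g, 'm) monoid_scheme \<Rightarrow> ('g, 'x) rep \<Rightarrow> nat \<Rightarrow> (nat \<Rightarrow> ('x \<Rightarrow> complex) set) \<Rightarrow> bool" where
  "irreducible_decomposition G W k U \<longleftrightarrow>
     (\<forall>i<k. subrep G (U i) W \<and> irreducible_rep G (W\<lparr>rep_space := U i\<rparr>)) \<and>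
     bij_betw (\<lambda>u. \<Sum>i<k. u i) (\<Pi>\<^sub>E i\<in>{..<k}. U i) (rep_space W)"

text \<open>
  The multiplicity of the irreducible \<open>V\<close> in the finite-dimensional representation \<open>W\<close> of the
  finite group \<open>G\<close>; the decomposition exists by Maschke and the number is independent of it by
  Krull--Schmidt.
\<close>

definition multiplicity_rep ::
  "('g, 'm) monoid_scheme \<Rightarrow> ('g, 'x) rep \<Rightarrow> ('g, 'y) rep \<Rightarrow> nat" where
  "multiplicity_rep G V W = (THE m. \<exists>k U. irreducible_decomposition G W k U \<and>
     m = card {i. i < k \<and> rep_iso G (W\<lparr>rep_space := U i\<rparr>) V})"

definition zero_rep :: "('g, 'x) rep" where
  "zero_rep = \<lparr>rep_space = {0}, rep_act = (\<lambda>_ v. v)\<rparr>"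

text \<open>Restriction along a homomorphism \<open>\<phi>\<close>.\<close>

definition Res :: "('h \<Rightarrow> 'g) \<Rightarrow> ('g, 'x) rep \<Rightarrow> ('h, 'x) rep" where
  "Res \<phi> V = \<lparr>rep_space = rep_space V, rep_act = (\<lambda>h. rep_act V (\<phi> h))\<rparr>"

text \<open>
  The tensor product \<open>V \<otimes> W\<close> of a representation of \<open>G\<close> and one of \<open>H\<close>, as a representation of
  \<open>G \<times>\<times> H\<close>.  Inside \<open>'x \<times> 'y \<Rightarrow> complex\<close> the pure tensor of \<open>v\<close> and \<open>w\<close> is \<open>(a, b) \<mapsto> v a * w b\<close>;
  the pair \<open>(g, h)\<close> acts by applying \<open>g\<close> in the first variable and then \<open>h\<close> in the second, which
  on pure tensors gives the tensor of \<open>g v\<close> and \<open>h w\<close>.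
\<close>

definition pure_tensor :: "('x \<Rightarrow> complex) \<Rightarrow> ('y \<Rightarrow> complex) \<Rightarrow> ('x \<times> 'y \<Rightarrow> complex)" where
  "pure_tensor v w = (\<lambda>(a, b). v a * w b)"

definition Tensor :: "('g, 'x) rep \<Rightarrow> ('h, 'y) rep \<Rightarrow> ('g \<times> 'h, 'x \<times> 'y) rep" where
  "Tensor V W =
     \<lparr>rep_space = fun_vs.span {pure_tensor v w | v w. v \<in> rep_space V \<and> w \<in> rep_space W},
      rep_act = (\<lambda>(g, h) F (a, b).
        rep_act W h (\<lambda>b'. rep_act V g (\<lambda>a'. F (a', b')) a) b)\<rparr>"

text \<open>
  Induction from \<open>H\<close> to \<open>G\<close> along an embedding \<open>\<phi>\<close> (for finite groups), in its standard function
  model: the functions \<open>f : G \<rightarrow> W\<close> with \<open>f (g \<phi>(h)) = h\<^sup>-\<^sup>1 f(g)\<close>, on which \<open>G\<close> acts by left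
  translation.  Such an \<open>f\<close> is stored uncurried and extended by zero outside the carrier of \<open>G\<close>.
\<close>

definition Ind :: "('h, 'n) monoid_scheme \<Rightarrow> ('g, 'm) monoid_scheme \<Rightarrow> ('h \<Rightarrow> 'g) \<Rightarrow>
    ('h, 'x) rep \<Rightarrow> ('g, 'g \<times> 'x) rep" where
  "Ind H G \<phi> W =
     \<lparr>rep_space = {f.
        (\<forall>g x. g \<notin> carrier G \<longrightarrow> f (g, x) = 0) \<and>
        (\<forall>g\<in>carrier G. (\<lambda>x. f (g, x)) \<in> rep_space W) \<and>
        (\<forall>g\<in>carrier G. \<forall>h\<in>carrier H.
           (\<lambda>x. f (g \<otimes>\<^bsub>G\<^esub> \<phi> h, x)) = rep_act W (inv\<^bsub>H\<^esub> h) (\<lambda>x. f (g, x)))},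
      rep_act = (\<lambda>g f (g', x). if g' \<in> carrier G then f (inv\<^bsub>G\<^esub> g \<otimes>\<^bsub>G\<^esub> g', x) else 0)\<rparr>"


section \<open>Specht modules\<close>

text \<open>The group algebra of \<open>G\<close>: functions vanishing outside the carrier, under convolution.\<close>

definition group_algebra :: "('g, 'm) monoid_scheme \<Rightarrow> ('g \<Rightarrow> complex) set" where
  "group_algebra G = {x. \<forall>g. g \<notin> carrier G \<longrightarrow> x g = 0}"

definition conv :: "('g, 'm) monoid_scheme \<Rightarrow> ('g \<Rightarrow> complex) \<Rightarrow> ('g \<Rightarrow> complex) \<Rightarrow> ('g \<Rightarrow> complex)"
  where
  "conv G x y = (\<lambda>g. if g \<in> carrier G
     then (\<Sum>h\<in>carrier G. x h * y (inv\<^bsub>G\<^esub> h \<otimes>\<^bsub>G\<^esub> g)) else 0)"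

definition left_translation :: "('g, 'm) monoid_scheme \<Rightarrow> 'g \<Rightarrow> ('g \<Rightarrow> complex) \<Rightarrow> ('g \<Rightarrow> complex)"
  where
  "left_translation G g x = (\<lambda>h. if h \<in> carrier G then x (inv\<^bsub>G\<^esub> g \<otimes>\<^bsub>G\<^esub> h) else 0)"

text \<open>
  The canonical tableau of shape \<open>lam\<close> is filled with \<open>1, \<dots>, |lam|\<close> row by row.  The entry \<open>k\<close> lies in
  row \<open>tab_row lam k\<close> (counted from 0) and column \<open>tab_col lam k\<close> (counted from 1).
\<close>

definition tab_row :: "(nat \<Rightarrow> nat) \<Rightarrow> nat \<Rightarrow> nat" where
  "tab_row lam k = (LEAST i. k \<le> (\<Sum>j\<le>i. lam j))"

definition tab_col :: "(nat \<Rightarrow> nat) \<Rightarrow> nat \<Rightarrow> nat" where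
  "tab_col lam k = k - (\<Sum>j<tab_row lam k. lam j)"

definition row_group :: "(nat \<Rightarrow> nat) \<Rightarrow> (nat \<Rightarrow> nat) set" where
  "row_group lam = {p \<in> carrier (sym_group (psize lam)).
     \<forall>k\<in>{1..psize lam}. tab_row lam (p k) = tab_row lam k}"

definition col_group :: "(nat \<Rightarrow> nat) \<Rightarrow> (nat \<Rightarrow> nat) set" where
  "col_group lam = {p \<in> carrier (sym_group (psize lam)).
     \<forall>k\<in>{1..psize lam}. tab_col lam (p k) = tab_col lam k}"

definition row_sum :: "(nat \<Rightarrow> nat) \<Rightarrow> (nat \<Rightarrow> nat) \<Rightarrow> complex" where
  "row_sum lam p = (if p \<in> row_group lam then 1 else 0)"

definition signed_col_sum :: "(nat \<Rightarrow> nat) \<Rightarrow> (nat \<Rightarrow> nat) \<Rightarrow> complex" where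
  "signed_col_sum lam p = (if p \<in> col_group lam then of_int (sign p) else 0)"

definition young_symmetrizer :: "(nat \<Rightarrow> nat) \<Rightarrow> (nat \<Rightarrow> nat) \<Rightarrow> complex" where
  "young_symmetrizer lam = conv (sym_group (psize lam)) (row_sum lam) (signed_col_sum lam)"

text \<open>
  The irreducible representation of shape \<open>lam\<close> is the left ideal of the group algebra generated by
  the Young symmetrizer; thus a single row gives the trivial and a single column the sign
  representation.
\<close>

definition Specht :: "(nat \<Rightarrow> nat) \<Rightarrow> (nat \<Rightarrow> nat, nat \<Rightarrow> nat) rep" where
  "Specht lam =
     \<lparr>rep_space = {conv (sym_group (psize lam)) x (young_symmetrizer lam) | x.
        x \<in> group_algebra (sym_group (psize lam))},
      rep_act = left_translation (sym_group (psize lam))\<rparr>"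


section \<open>Kronecker coefficients\<close>

text \<open>
  In \<open>kronecker lam \<mu> \<nu>\<close> and \<open>heisenberg_coeff lam \<mu> \<nu>\<close> the upper index of the coefficient comes
  first.  The former is meant for \<open>|lam| = |\<mu>| = |\<nu>|\<close> only.
\<close>

definition kronecker :: "(nat \<Rightarrow> nat) \<Rightarrow> (nat \<Rightarrow> nat) \<Rightarrow> (nat \<Rightarrow> nat) \<Rightarrow> nat" where
  "kronecker lam \<mu> \<nu> = multiplicity_rep (sym_group (psize lam)) (Specht lam)
     (Res (\<lambda>\<sigma>. (\<sigma>, \<sigma>)) (Tensor (Specht \<mu>) (Specht \<nu>)))"

definition K_triple :: "(nat \<Rightarrow> nat) \<Rightarrow> (nat \<Rightarrow> nat) \<Rightarrow> (nat \<Rightarrow> nat) \<Rightarrow> bool" where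
  "K_triple \<alpha> \<beta> \<gamma> \<longleftrightarrow> is_partition \<alpha> \<and> is_partition \<beta> \<and> is_partition \<gamma> \<and>
     psize \<alpha> = psize \<beta> \<and> psize \<beta> = psize \<gamma> \<and> kronecker \<alpha> \<beta> \<gamma> > 0"

definition eventually_constant :: "(nat \<Rightarrow> 'a) \<Rightarrow> bool" where
  "eventually_constant f \<longleftrightarrow> (\<exists>c. \<forall>\<^sub>F n in sequentially. f n = c)"

definition K_stable :: "(nat \<Rightarrow> nat) \<Rightarrow> (nat \<Rightarrow> nat) \<Rightarrow> (nat \<Rightarrow> nat) \<Rightarrow> bool" where
  "K_stable \<alpha> \<beta> \<gamma> \<longleftrightarrow> K_triple \<alpha> \<beta> \<gamma> \<and>
     (\<forall>lam \<mu> \<nu>. is_partition lam \<and> is_partition \<mu> \<and> is_partition \<nu> \<and>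
        psize lam = psize \<mu> \<and> psize \<mu> = psize \<nu> \<longrightarrow>
        eventually_constant
          (\<lambda>n. kronecker (add_multiple lam n \<alpha>) (add_multiple \<mu> n \<beta>) (add_multiple \<nu> n \<gamma>)))"


section \<open>Heisenberg coefficients\<close>

text \<open>
  For \<open>\<sigma>\<close> in the symmetric group of degree \<open>p\<close> and \<open>\<tau>\<close> in some other one, the permutation acting as
  \<open>\<sigma>\<close> on the first \<open>p\<close> letters and as the shift of \<open>\<tau>\<close> on the following ones.
\<close>

definition young_embed :: "nat \<Rightarrow> (nat \<Rightarrow> nat) \<Rightarrow> (nat \<Rightarrow> nat) \<Rightarrow> (nat \<Rightarrow> nat)" where
  "young_embed p \<sigma> \<tau> = (\<lambda>i. if i \<le> p then \<sigma> i else \<tau> (i - p) + p)"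

text \<open>
  The Heisenberg product of representations \<open>V\<close> and \<open>W\<close> of the symmetric groups of degrees \<open>n\<close> and
  \<open>m\<close>, as a graded representation: the component of degree \<open>l\<close> is a representation of
  \<open>sym_group l\<close>, and it is zero outside the range \<open>max n m \<le> l \<le> n + m\<close>.
\<close>

definition Heisenberg :: "nat \<Rightarrow> nat \<Rightarrow> (nat \<Rightarrow> nat, 'x) rep \<Rightarrow> (nat \<Rightarrow> nat, 'y) rep \<Rightarrow>
    nat \<Rightarrow> (nat \<Rightarrow> nat, (nat \<Rightarrow> nat) \<times> 'x \<times> 'y) rep" where
  "Heisenberg n m V W l =
     (if max n m \<le> l \<and> l \<le> n + m then
        let p = l - m; q = n + m - l; r = l - n in
        Ind (sym_group p \<times>\<times> sym_group q \<times>\<times> sym_group r) (sym_group l)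
          (\<lambda>(a, b, c). young_embed p a (young_embed q b c))
          (Res (\<lambda>(a, b, c). (young_embed p a b, young_embed q b c)) (Tensor V W))
      else zero_rep)"

definition heisenberg_coeff :: "(nat \<Rightarrow> nat) \<Rightarrow> (nat \<Rightarrow> nat) \<Rightarrow> (nat \<Rightarrow> nat) \<Rightarrow> nat" where
  "heisenberg_coeff lam \<mu> \<nu> = multiplicity_rep (sym_group (psize lam)) (Specht lam)
     (Heisenberg (psize \<mu>) (psize \<nu>) (Specht \<mu>) (Specht \<nu>) (psize lam))"

definition H_triple :: "(nat \<Rightarrow> nat) \<Rightarrow> (nat \<Rightarrow> nat) \<Rightarrow> (nat \<Rightarrow> nat) \<Rightarrow> bool" where
  "H_triple \<alpha> \<beta> \<gamma> \<longleftrightarrow> is_partition \<alpha> \<and> is_partition \<beta> \<and> is_partition \<gamma> \<and>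
     max (psize \<beta>) (psize \<gamma>) \<le> psize \<alpha> \<and> psize \<alpha> \<le> psize \<beta> + psize \<gamma> \<and>
     heisenberg_coeff \<alpha> \<beta> \<gamma> > 0"

definition H_stable :: "(nat \<Rightarrow> nat) \<Rightarrow> (nat \<Rightarrow> nat) \<Rightarrow> (nat \<Rightarrow> nat) \<Rightarrow> bool" where
  "H_stable \<alpha> \<beta> \<gamma> \<longleftrightarrow> H_triple \<alpha> \<beta> \<gamma> \<and>
     (\<forall>lam \<mu> \<nu>. is_partition lam \<and> is_partition \<mu> \<and> is_partition \<nu> \<and>
        max (psize \<mu>) (psize \<nu>) \<le> psize lam \<and> psize lam \<le> psize \<mu> + psize \<nu> \<longrightarrow>
        eventually_constant
          (\<lambda>n. heisenberg_coeff
             (add_multiple lam n \<alpha>) (add_multiple \<mu> n \<beta>) (add_multiple \<nu> n \<gamma>)))"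

end

theory Submission
  imports Defs
begin

text \<open>
  By Frobenius' formula the character of shape \<open>lam\<close> at \<open>\<sigma>\<close> is a signed count of the
  \<open>\<sigma>\<close>-invariant words \<open>f\<close> in \<open>N\<close> letters for which the staircase-shifted vector of \<open>lam\<close> minus
  the content of \<open>f\<close> is a permutation of the staircase.  In this form the formula makes sense for every
  integer vector in place of the partition, is alternating in it, and restricts to a Young subgroup by
  splitting words.  Hence the Heisenberg coefficient at \<open>(lam + n \<alpha>, \<mu> + n \<beta>, \<nu> + n \<gamma>)\<close> is a
  linear combination, with index set and coefficients independent of \<open>n\<close>, of normalised triple products
  of such characters at \<open>(x + n \<alpha>, y + n \<beta>, z + n \<gamma>)\<close>.  For large \<open>n\<close> each of these vectors is
  straightened by one permutation fixing \<open>\<alpha>\<close>, \<open>\<beta>\<close>, \<open>\<gamma>\<close> respectively, so each triple product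
  is eventually zero or, up to a fixed sign, a Kronecker coefficient along a sequence covered by K-stability.

  Frobenius' formula holds because the alternating sum \<open>F\<close> and the character \<open>\<chi>\<close> of the Specht
  module are real class functions with \<open>\<langle>F, F\<rangle> = \<langle>F, \<chi>\<rangle> = \<langle>\<chi>, \<chi>\<rangle> = 1\<close>.
\<close>

section \<open>Convolution in the group algebra\<close>

text \<open>The obstacle is that the usual branching rule for restriction to a product of smaller
  symmetric groups indexes the constituents by partitions inside \<open>lam + n \<alpha>\<close>, a
  set that moves with \<open>n\<close>. Subtracting contents of words keeps the list of pieces
  fixed, at the price of vectors that are neither decreasing nor nonnegative. Since \<alpha>,
  \<beta>, \<gamma> have equal size, \<open>p\<close> and \<open>r\<close> stay fixed while only
  \<open>q\<close> grows; words are placed on the \<open>p\<close> and \<open>r\<close> letters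
  only, so finitely many contents ever occur.

  A multiplicity is defined through decompositions and has to become a trace. If e is an idempotent
  with e A e consisting of scalar multiples of e, then e acts with rank one on each irreducible
  summand isomorphic to A e and as zero on all others, so its trace counts the summands. The same
  rank one argument, applied to the row sum, evaluates the inner product of F with \<chi>, while
  that of F with itself reduces to Kostka numbers.

  One letter beyond the length of \<alpha>, \<beta>, \<gamma> provides a coordinate that does not
  change with \<open>n\<close>; the sign of the smallest entry is read off there.\<close>

locale finite_group = group +
  assumes finite_carrier: "finite (carrier G)"
begin

lemma sum_inv: "(\<Sum>g\<in>carrier G. f (inv g)) = (\<Sum>g\<in>carrier G. f g)"
  by (rule sum.reindex_bij_witness[where i="\<lambda>g. inv g" and j="\<lambda>g. inv g"]) auto

lemma sum_mult_left:
  assumes "h \<in> carrier G"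
  shows "(\<Sum>g\<in>carrier G. f (h \<otimes> g)) = (\<Sum>g\<in>carrier G. f g)"
  using assms
  by (intro sum.reindex_bij_witness[where i="\<lambda>g. inv h \<otimes> g" and j="\<lambda>g. h \<otimes> g"])
     (auto simp: m_assoc[symmetric])

lemma sum_mult_right:
  assumes "h \<in> carrier G"
  shows "(\<Sum>g\<in>carrier G. f (g \<otimes> h)) = (\<Sum>g\<in>carrier G. f g)"
  using assms
  by (intro sum.reindex_bij_witness[where i="\<lambda>g. g \<otimes> inv h" and j="\<lambda>g. g \<otimes> h"])
     (auto simp: m_assoc)

lemma conv_in_group_algebra: "conv G x y \<in> group_algebra G"
  by (simp add: conv_def group_algebra_def)

lemma conv_assoc: "conv G (conv G x y) z = conv G x (conv G y z)"
proof
  fix g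
  show "conv G (conv G x y) z g = conv G x (conv G y z) g"
  proof (cases "g \<in> carrier G")
    case g: True
    have "conv G (conv G x y) z g = 
        (\<Sum>h\<in>carrier G. \<Sum>k\<in>carrier G. x k * (y (inv k \<otimes> h) * z (inv h \<otimes> g)))"
      using g by (simp add: conv_def sum_distrib_right mult.assoc)
    also have "\<dots> = (\<Sum>k\<in>carrier G. x k * (\<Sum>h\<in>carrier G. y (inv k \<otimes> h) * z (inv h \<otimes> g)))"
      by (subst sum.swap) (simp add: sum_distrib_left)
    also have "\<dots> = (\<Sum>k\<in>carrier G. x k * (\<Sum>h\<in>carrier G. y h * z (inv h \<otimes> (inv k \<otimes> g))))"
    proof (rule sum.cong[OF refl])
      fix k assume k: "k \<in> carrier G"
      have "(\<Sum>h\<in>carrier G. y h * z (inv h \<otimes> (inv k \<otimes> g))) =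
          (\<Sum>h\<in>carrier G. y (inv k \<otimes> h) * z (inv (inv k \<otimes> h) \<otimes> (inv k \<otimes> g)))"
        using k by (subst sum_mult_left[of "inv k", symmetric]) auto
      also have "\<dots> = (\<Sum>h\<in>carrier G. y (inv k \<otimes> h) * z (inv h \<otimes> g))"
      proof (intro sum.cong refl)
        fix h assume h: "h \<in> carrier G"
        have "inv (inv k \<otimes> h) \<otimes> (inv k \<otimes> g) = inv h \<otimes> g"
          using g h k by (simp add: inv_mult_group m_assoc) (simp add: m_assoc[symmetric])
        then show "y (inv k \<otimes> h) * z (inv (inv k \<otimes> h) \<otimes> (inv k \<otimes> g)) =
            y (inv k \<otimes> h) * z (inv h \<otimes> g)" by simp
      qed
      finally show "x k * (\<Sum>h\<in>carrier G. y (inv k \<otimes> h) * z (inv h \<otimes> g)) =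
          x k * (\<Sum>h\<in>carrier G. y h * z (inv h \<otimes> (inv k \<otimes> g)))" by simp
    qed
    also have "\<dots> = conv G x (conv G y z) g"
      using g by (simp add: conv_def)
    finally show ?thesis .
  qed (simp add: conv_def)
qed

lemma conv_add_left: "conv G (x + y) z = conv G x z + conv G y z"
  by (auto simp: conv_def fun_eq_iff algebra_simps sum.distrib)

lemma conv_fscale_left: "conv G (fscale c x) z = fscale c (conv G x z)"
  by (auto simp: conv_def fun_eq_iff fscale_def sum_distrib_left mult_ac)

lemma conv_fscale_right: "conv G z (fscale c x) = fscale c (conv G z x)"
  by (auto simp: conv_def fun_eq_iff fscale_def sum_distrib_left mult_ac)

lemma conv_zero_left [simp]: "conv G 0 z = 0"
  by (auto simp: conv_def fun_eq_iff)

lemma conv_zero_right [simp]: "conv G z 0 = 0"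
  by (auto simp: conv_def fun_eq_iff)

lemma conv_left_translation:
  assumes g: "g \<in> carrier G"
  shows "conv G (left_translation G g x) y = left_translation G g (conv G x y)"
proof
  fix h
  show "conv G (left_translation G g x) y h = left_translation G g (conv G x y) h"
  proof (cases "h \<in> carrier G")
    case h: True
    have "conv G (left_translation G g x) y h =
        (\<Sum>k\<in>carrier G. x (inv g \<otimes> k) * y (inv k \<otimes> h))"
      using h by (simp add: conv_def left_translation_def)
    also have "\<dots> = (\<Sum>k\<in>carrier G. x (inv g \<otimes> (g \<otimes> k)) * y (inv (g \<otimes> k) \<otimes> h))"
      by (rule sum_mult_left[OF g, symmetric])
    also have "\<dots> = (\<Sum>k\<in>carrier G. x k * y (inv k \<otimes> (inv g \<otimes> h)))"
    proof (intro sum.cong refl)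
      fix k assume k: "k \<in> carrier G"
      have "inv g \<otimes> (g \<otimes> k) = k" using g k by (simp add: m_assoc[symmetric])
      moreover have "inv (g \<otimes> k) \<otimes> h = inv k \<otimes> (inv g \<otimes> h)"
        using g h k by (simp add: inv_mult_group m_assoc)
      ultimately show "x (inv g \<otimes> (g \<otimes> k)) * y (inv (g \<otimes> k) \<otimes> h) = x k * y (inv k \<otimes> (inv g \<otimes> h))"
        by simp
    qed
    also have "\<dots> = left_translation G g (conv G x y) h"
      using g h by (simp add: conv_def left_translation_def)
    finally show ?thesis .
  qed (simp add: conv_def left_translation_def)
qed

section \<open>The adjoint in the group algebra and positivity\<close>

definition star :: "('a \<Rightarrow> complex) \<Rightarrow> ('a \<Rightarrow> complex)" where
  "star x = (\<lambda>g. if g \<in> carrier G then cnj (x (inv g)) else 0)"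

lemma star_conv: "star (conv G x y) = conv G (star y) (star x)"
proof
  fix g
  show "star (conv G x y) g = conv G (star y) (star x) g"
  proof (cases "g \<in> carrier G")
    case g: True
    have "conv G (star y) (star x) g = (\<Sum>h\<in>carrier G. cnj (y (inv h)) * cnj (x (inv (inv h \<otimes> g))))"
      using g by (auto simp: conv_def star_def intro!: sum.cong)
    also have "\<dots> = (\<Sum>h\<in>carrier G. cnj (y (inv (g \<otimes> h))) * cnj (x (inv (inv (g \<otimes> h) \<otimes> g))))"
      by (rule sum_mult_left[OF g, symmetric])
    also have "\<dots> = (\<Sum>h\<in>carrier G. cnj (y (inv h \<otimes> inv g)) * cnj (x h))"
    proof (intro sum.cong refl)
      fix h assume h: "h \<in> carrier G"
      have "inv (inv (g \<otimes> h) \<otimes> g) = h"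
        using g h by (simp add: inv_mult_group m_assoc[symmetric])
      then show "cnj (y (inv (g \<otimes> h))) * cnj (x (inv (inv (g \<otimes> h) \<otimes> g))) =
          cnj (y (inv h \<otimes> inv g)) * cnj (x h)"
        using g h by (simp add: inv_mult_group)
    qed
    also have "\<dots> = star (conv G x y) g"
      using g by (simp add: star_def conv_def mult.commute)
    finally show ?thesis by simp
  qed (simp add: conv_def star_def)
qed

text \<open>The value of \<open>conv G (star x) x\<close> at the identity is the squared l2 norm of
  \<open>x\<close>. This positivity later shows that \<open>y \<mapsto> eact y u\<close> is
  injective on an ideal and that the Young symmetrizer is not nilpotent.\<close>

lemma star_conv_eq_0:
  assumes x: "x \<in> group_algebra G" and 0: "conv G (star x) x = 0"
  shows "x = 0"
proof -
  have "(\<Sum>h\<in>carrier G. cnj (x (inv h)) * x (inv h)) = conv G (star x) x \<one>"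
    by (auto simp: conv_def star_def intro!: sum.cong)
  then have "(\<Sum>h\<in>carrier G. cnj (x (inv h)) * x (inv h)) = 0" using 0 by simp
  then have "(\<Sum>h\<in>carrier G. cnj (x h) * x h) = 0"
    by (simp add: sum_inv[of "\<lambda>h. cnj (x h) * x h"])
  then have "complex_of_real (\<Sum>h\<in>carrier G. (cmod (x h))\<^sup>2) = 0"
    by (simp add: mult.commute complex_norm_square del: of_real_power)
  then have "(\<Sum>h\<in>carrier G. (cmod (x h))\<^sup>2) = 0"
    using of_real_eq_0_iff by blast
  then have "x h = 0" if "h \<in> carrier G" for h
    using that finite_carrier by (simp add: sum_nonneg_eq_0_iff)
  with x show ?thesis
    by (auto simp: group_algebra_def fun_eq_iff)
qed

lemma star_star: "x \<in> group_algebra G \<Longrightarrow> star (star x) = x"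
  by (auto simp: star_def group_algebra_def fun_eq_iff)

lemma star_in_group_algebra: "star x \<in> group_algebra G"
  by (simp add: star_def group_algebra_def)

lemma conv_star_eq_0:
  assumes x: "x \<in> group_algebra G" and 0: "conv G x (star x) = 0"
  shows "x = 0"
proof -
  have "star x = 0"
    using star_conv_eq_0[of "star x"] x 0 by (simp add: star_star star_in_group_algebra)
  then have "star (star x) = 0" by (simp add: star_def fun_eq_iff)
  then show ?thesis using x by (simp add: star_star)
qed

text \<open>For \<open>y = conv G (star x) x\<close> the hypothesis gives
  \<open>conv G (star y) y = 0\<close>, so positivity applies twice. The cubic form suits elements
  of a left ideal \<open>A e\<close>, where a factor \<open>e\<close> is absorbed between
  \<open>x\<close> and \<open>star x\<close>.\<close>

lemma conv_triple_star_eq_0: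
  assumes x: "x \<in> group_algebra G" and 0: "conv G x (conv G (star x) x) = 0"
  shows "x = 0"
proof -
  have "conv G (star (conv G (star x) x)) (conv G (star x) x) = 0"
    using 0 x by (simp add: star_conv star_star conv_assoc)
  then have "conv G (star x) x = 0"
    by (rule star_conv_eq_0[OF conv_in_group_algebra])
  then show ?thesis by (rule star_conv_eq_0[OF x])
qed

end

section \<open>Multiplicities as traces\<close>

lemma sum_fun_apply: "(\<Sum>i\<in>A. f i) x = (\<Sum>i\<in>A. f i x)"
  by (induction A rule: infinite_finite_induct) auto

lemma fscale_apply [simp]: "fscale c f x = c * f x"
  by (simp add: fscale_def)

text \<open>
  All representations below have the same shape: the group permutes a finite set \<open>X\<close> from the
  right through \<open>\<pi>\<close>, acts on functions on \<open>X\<close> by substitution, and the representation space is the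
  fixed space of an idempotent matrix \<open>M\<close> commuting with this action.
\<close>

locale perm_rep = finite_group +
  fixes X :: "'x set" and \<pi> :: "'a \<Rightarrow> 'x \<Rightarrow> 'x" and M :: "'x \<Rightarrow> 'x \<Rightarrow> complex"
    and W :: "('a, 'x) rep"
  assumes finite_X: "finite X"
    and pi_in: "\<And>g x. g \<in> carrier G \<Longrightarrow> x \<in> X \<Longrightarrow> \<pi> g x \<in> X"
    and pi_mult: "\<And>g h x. g \<in> carrier G \<Longrightarrow> h \<in> carrier G \<Longrightarrow> x \<in> X \<Longrightarrow> \<pi> (g \<otimes> h) x = \<pi> h (\<pi> g x)"
    and pi_one: "\<And>x. x \<in> X \<Longrightarrow> \<pi> \<one> x = x"
    and M_idem: "\<And>a x. a \<in> X \<Longrightarrow> x \<in> X \<Longrightarrow> (\<Sum>y\<in>X. M a y * M y x) = M a x"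
    and M_equiv: "\<And>g a x. g \<in> carrier G \<Longrightarrow> a \<in> X \<Longrightarrow> x \<in> X \<Longrightarrow> M (\<pi> g a) (\<pi> g x) = M a x"
    and rep_space_W: "rep_space W =
      {f. (\<forall>x. x \<notin> X \<longrightarrow> f x = 0) \<and> (\<forall>a\<in>X. f a = (\<Sum>x\<in>X. M a x * f x))}"
    and rep_act_W: "\<And>g f. g \<in> carrier G \<Longrightarrow> rep_act W g f = (\<lambda>x. if x \<in> X then f (\<pi> g x) else 0)"
begin

text \<open>\<open>M\<close> projects onto the representation space, so the trace of
  \<open>g\<close> there is the trace, on all functions on \<open>X\<close>, of \<open>M\<close>
  followed by the substitution. No basis of the space has to be chosen.\<close>

definition char :: "'a \<Rightarrow> complex" where
  "char g = (\<Sum>x\<in>X. M (\<pi> g x) x)"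

lemma rep_act_add: "g \<in> carrier G \<Longrightarrow> rep_act W g (f1 + f2) = rep_act W g f1 + rep_act W g f2"
  by (auto simp: rep_act_W fun_eq_iff)

lemma rep_act_fscale: "g \<in> carrier G \<Longrightarrow> rep_act W g (fscale c f) = fscale c (rep_act W g f)"
  by (auto simp: rep_act_W fun_eq_iff)

lemma rep_act_sum: "g \<in> carrier G \<Longrightarrow> rep_act W g (\<Sum>i\<in>I. f i) = (\<Sum>i\<in>I. rep_act W g (f i))"
  by (auto simp: rep_act_W fun_eq_iff sum_fun_apply)

lemma rep_act_mult:
  assumes "g \<in> carrier G" "h \<in> carrier G"
  shows "rep_act W (g \<otimes> h) f = rep_act W g (rep_act W h f)"
  using assms by (auto simp: rep_act_W fun_eq_iff pi_mult pi_in)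

lemma rep_act_one: "f \<in> rep_space W \<Longrightarrow> rep_act W \<one> f = f"
  by (auto simp: rep_act_W fun_eq_iff pi_one rep_space_W)

lemma subspace_rep_space: "fun_vs.subspace (rep_space W)"
  unfolding fun_vs.subspace_def rep_space_W
  by (auto simp: algebra_simps sum.distrib sum_distrib_left)

lemma pi_inv_left: "g \<in> carrier G \<Longrightarrow> x \<in> X \<Longrightarrow> \<pi> g (\<pi> (inv g) x) = x"
  using pi_mult[of "inv g" g x] by (simp add: pi_one)

lemma pi_inv_right: "g \<in> carrier G \<Longrightarrow> x \<in> X \<Longrightarrow> \<pi> (inv g) (\<pi> g x) = x"
  using pi_mult[of g "inv g" x] by (simp add: pi_one)

lemma sum_pi:
  assumes "g \<in> carrier G"
  shows "(\<Sum>x\<in>X. f (\<pi> g x)) = (\<Sum>x\<in>X. f x)"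
  using assms
  by (intro sum.reindex_bij_witness[where i="\<pi> (inv g)" and j="\<pi> g"])
     (auto simp: pi_in pi_inv_left pi_inv_right)

lemma rep_act_in:
  assumes g: "g \<in> carrier G" and f: "f \<in> rep_space W"
  shows "rep_act W g f \<in> rep_space W"
proof -
  have "f (\<pi> g a) = (\<Sum>x\<in>X. M a x * (if x \<in> X then f (\<pi> g x) else 0))" if a: "a \<in> X" for a
  proof -
    have "f (\<pi> g a) = (\<Sum>x\<in>X. M (\<pi> g a) x * f x)"
      using f g a pi_in by (auto simp: rep_space_W)
    also have "\<dots> = (\<Sum>x\<in>X. M (\<pi> g a) (\<pi> g x) * f (\<pi> g x))"
      by (rule sum_pi[OF g, symmetric])
    finally show ?thesis using g a by (simp add: M_equiv)
  qed
  then show ?thesis using g f by (auto simp: rep_space_W rep_act_W)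
qed

lemma subrep_self: "subrep G (rep_space W) W"
  by (simp add: subrep_def subspace_rep_space rep_act_in)

subsection \<open>Maschke's theorem\<close>

text \<open>Averaging a linear projection onto \<open>U1\<close> over the group. The complement is
  taken inside a subrepresentation \<open>U\<close> because the decomposition below recurses into
  complements.\<close>

lemma subrep_complement:
  assumes U: "subrep G U W" and U1: "subrep G U1 W" and sub: "U1 \<subseteq> U"
  obtains U2 where "subrep G U2 W" "U2 \<subseteq> U" "U1 \<inter> U2 = {0}" "\<And>u. u \<in> U \<Longrightarrow> \<exists>a\<in>U1. u - a \<in> U2"
proof -
  interpret vector_space_pair "fscale :: complex \<Rightarrow> ('x \<Rightarrow> complex) \<Rightarrow> 'x \<Rightarrow> complex"
      "fscale :: complex \<Rightarrow> ('x \<Rightarrow> complex) \<Rightarrow> 'x \<Rightarrow> complex"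
    by unfold_locales
  note U1D = U1[unfolded subrep_def] and UD = U[unfolded subrep_def]
  have act0: "rep_act W g 0 = 0" if "g \<in> carrier G" for g
    using that by (auto simp: rep_act_W fun_eq_iff)
  obtain p where p: "range p \<subseteq> U1" "Vector_Spaces.linear fscale fscale p" "\<And>v. v \<in> U1 \<Longrightarrow> p v = v"
    using linear_exists_left_inverse_on[of id U1] U1D by (auto simp: fun_vs.linear_id)
  interpret p: Vector_Spaces.linear fscale fscale p by (rule p(2))
  define P where "P v = fscale (1 / of_nat (order G))
      (\<Sum>g\<in>carrier G. rep_act W (inv g) (p (rep_act W g v)))" for v
  have order: "of_nat (order G) \<noteq> (0 :: complex)"
    using finite_carrier order_gt_0_iff_finite by simp
  have P_in: "P v \<in> U1" for v
    unfolding P_def using U1D p(1)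
    by (intro fun_vs.subspace_scale fun_vs.subspace_sum) auto
  have P_id: "P v = v" if v: "v \<in> U1" for v
  proof -
    have "rep_act W (inv g) (p (rep_act W g v)) = v" if g: "g \<in> carrier G" for g
    proof -
      have "p (rep_act W g v) = rep_act W g v" using U1D v g p(3) by auto
      moreover have "v \<in> rep_space W" using v U1D by auto
      ultimately show ?thesis
        using g rep_act_mult[of "inv g" g v] by (simp add: rep_act_one)
    qed
    then show ?thesis using order by (simp add: P_def order_def fun_eq_iff sum_fun_apply)
  qed
  have P_add: "P (v + w) = P v + P w" for v w
    by (auto simp: P_def rep_act_add p.add sum.distrib fun_vs.scale_right_distrib)
  have P_fscale: "P (fscale c v) = fscale c (P v)" for c v
    by (auto simp: P_def rep_act_fscale p.scale fun_vs.scale_sum_right mult.commute)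
  have P_act: "P (rep_act W h v) = rep_act W h (P v)" if h: "h \<in> carrier G" for h v
  proof -
    have "P (rep_act W h v) = fscale (1 / of_nat (order G))
        (\<Sum>g\<in>carrier G. rep_act W (inv g) (p (rep_act W (g \<otimes> h) v)))"
      using h by (simp add: P_def rep_act_mult)
    \<comment> \<open>Writing \<open>inv g\<close> as \<open>h \<otimes> inv (g \<otimes> h)\<close>
      makes the summand depend on \<open>g \<otimes> h\<close> alone; translating the index then
      pulls \<open>h\<close> out in front.\<close>
    also have "(\<Sum>g\<in>carrier G. rep_act W (inv g) (p (rep_act W (g \<otimes> h) v))) =
        (\<Sum>g\<in>carrier G. rep_act W (h \<otimes> inv (g \<otimes> h)) (p (rep_act W (g \<otimes> h) v)))"
    proof (intro sum.cong refl)
      fix g assume g: "g \<in> carrier G"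
      have "h \<otimes> inv (g \<otimes> h) = inv g" using g h by (simp add: inv_mult_group m_assoc[symmetric])
      then show "rep_act W (inv g) (p (rep_act W (g \<otimes> h) v)) =
          rep_act W (h \<otimes> inv (g \<otimes> h)) (p (rep_act W (g \<otimes> h) v))" by simp
    qed
    also have "\<dots> = (\<Sum>g\<in>carrier G. rep_act W (h \<otimes> inv g) (p (rep_act W g v)))"
      by (rule sum_mult_right[OF h])
    also have "\<dots> = rep_act W h (\<Sum>g\<in>carrier G. rep_act W (inv g) (p (rep_act W g v)))"
      using h by (simp add: rep_act_mult rep_act_sum)
    finally show ?thesis using h by (simp only: P_def rep_act_fscale)
  qed
  define U2 where "U2 = {v\<in>U. P v = 0}"
  have "subrep G U2 W"
    using UD P_in unfolding subrep_def U2_def fun_vs.subspace_def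
    by (auto simp: P_add P_fscale P_act act0)
       (metis P_id U1D fun_vs.subspace_0)
  moreover have "U2 \<subseteq> U" by (auto simp: U2_def)
  moreover have "U1 \<inter> U2 = {0}"
    using U1D UD P_id fun_vs.subspace_0 by (auto simp: U2_def)
  moreover have "\<exists>a\<in>U1. u - a \<in> U2" if u: "u \<in> U" for u
  proof (intro bexI)
    have "P (u - P u) + P (P u) = P u" by (subst P_add[symmetric]) simp
    then have "P (u - P u) = 0" using P_id[OF P_in, of u] by simp
    moreover have "u - P u \<in> U"
      using u P_in sub UD by (intro fun_vs.subspace_diff) auto
    ultimately show "u - P u \<in> U2" by (simp add: U2_def)
  qed (rule P_in)
  ultimately show thesis by (rule that)
qed

text \<open>Finite dimension, which makes \<open>dim\<close> a strict measure on subrepresentations: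
  it serves for choosing minimal ones and for the recursion.\<close>

lemma rep_space_in_span: "rep_space W \<subseteq> fun_vs.span ((\<lambda>x y. if y = x then 1 else 0) ` X)"
proof
  fix f assume f: "f \<in> rep_space W"
  have "f = (\<Sum>x\<in>X. fscale (f x) (\<lambda>y. if y = x then 1 else 0))"
  proof
    fix y
    show "f y = (\<Sum>x\<in>X. fscale (f x) (\<lambda>y. if y = x then 1 else 0)) y"
      using f finite_X by (cases "y \<in> X") (auto simp: sum_fun_apply rep_space_W if_distrib cong: if_cong)
  qed
  moreover have "(\<Sum>x\<in>X. fscale (f x) (\<lambda>y. if y = x then 1 else 0)) \<in>
      fun_vs.span ((\<lambda>x y. if y = x then 1 else 0) ` X)"
    by (intro fun_vs.span_sum fun_vs.span_scale fun_vs.span_base) auto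
  ultimately show "f \<in> fun_vs.span ((\<lambda>x y. if y = x then 1 else 0) ` X)" by simp
qed

lemma dim_less:
  assumes U: "subrep G U W" and U1: "subrep G U1 W" and sub: "U1 \<subset> U"
  shows "fun_vs.dim U1 < fun_vs.dim U"
proof -
  obtain B where B: "B \<subseteq> U1" "fun_vs.independent B" "U1 \<subseteq> fun_vs.span B" "card B = fun_vs.dim U1"
    by (rule fun_vs.basis_exists)
  obtain C where C: "B \<subseteq> C" "C \<subseteq> U" "fun_vs.independent C" "U \<subseteq> fun_vs.span C"
    using fun_vs.maximal_independent_subset_extend[OF order_trans[OF B(1) psubset_imp_subset[OF sub]] B(2)]
    by metis
  have "C \<subseteq> fun_vs.span ((\<lambda>x y. if y = x then 1 else 0) ` X)"
    using C(2) U rep_space_in_span by (auto simp: subrep_def)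
  then have fin: "finite C"
    using fun_vs.independent_span_bound[OF _ C(3)] finite_X by blast
  have "B \<noteq> C"
  proof
    assume "B = C"
    then have "U \<subseteq> fun_vs.span U1" using C(4) B(1) fun_vs.span_mono by blast
    then show False using U1 sub by (auto simp: subrep_def fun_vs.span_eq_iff[THEN iffD2])
  qed
  then have "card B < card C" using C(1) fin by (intro psubset_card_mono) auto
  moreover have "card C = fun_vs.dim U"
    using fun_vs.basis_card_eq_dim[OF C(2,4,3)] .
  ultimately show ?thesis using B(4) by simp
qed

lemma irreducible_subrep_exists:
  assumes U: "subrep G U W" and "U \<noteq> {0}"
  obtains U1 where "subrep G U1 W" "U1 \<subseteq> U" "irreducible_rep G (W\<lparr>rep_space := U1\<rparr>)"
proof -
  define Q where "Q U' \<longleftrightarrow> subrep G U' W \<and> U' \<subseteq> U \<and> U' \<noteq> {0}" for U'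
  have "Q U" using assms by (simp add: Q_def)
  then obtain U1 where U1: "Q U1" and min: "\<And>U'. Q U' \<Longrightarrow> fun_vs.dim U1 \<le> fun_vs.dim U'"
    using ex_has_least_nat[of Q U fun_vs.dim] by blast
  have "U' = {0} \<or> U' = U1" if "subrep G U' (W\<lparr>rep_space := U1\<rparr>)" for U'
  proof (rule ccontr)
    assume neg: "\<not> (U' = {0} \<or> U' = U1)"
    have U': "subrep G U' W" "U' \<subseteq> U1"
      using that U1 by (auto simp: subrep_def Q_def)
    then have "fun_vs.dim U' < fun_vs.dim U1"
      using neg U1 by (intro dim_less) (auto simp: Q_def)
    moreover have "Q U'" using neg U' U1 by (auto simp: Q_def)
    ultimately show False using min[of U'] by simp
  qed
  then have "irreducible_rep G (W\<lparr>rep_space := U1\<rparr>)"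
    using U1 by (auto simp: irreducible_rep_def Q_def)
  with U1 that show thesis by (auto simp: Q_def)
qed

lemma irreducible_decomposition_exists:
  assumes "subrep G U0 W"
  shows "\<exists>k U. irreducible_decomposition G (W\<lparr>rep_space := U0\<rparr>) k U"
  using assms
proof (induction "fun_vs.dim U0" arbitrary: U0 rule: less_induct)
  case less
  show ?case
  proof (cases "U0 = {0}")
    case True
    then have "irreducible_decomposition G (W\<lparr>rep_space := U0\<rparr>) 0 undefined"
      by (auto simp: irreducible_decomposition_def bij_betw_def)
    then show ?thesis by blast
  next
    case False
    from irreducible_subrep_exists[OF less.prems False]
    obtain U1 where U1: "subrep G U1 W" "U1 \<subseteq> U0" "irreducible_rep G (W\<lparr>rep_space := U1\<rparr>)" .
    from subrep_complement[OF less.prems U1(1,2)] obtain U2 where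
      U2: "subrep G U2 W" "U2 \<subseteq> U0" "U1 \<inter> U2 = {0}" "\<And>u. u \<in> U0 \<Longrightarrow> \<exists>a\<in>U1. u - a \<in> U2" by metis
    have "U1 \<noteq> {0}" using U1(3) by (simp add: irreducible_rep_def)
    then have "U2 \<noteq> U0" using U1(1,2) U2(3) by auto
    then have "fun_vs.dim U2 < fun_vs.dim U0" using U2 less.prems by (intro dim_less) auto
    from less.hyps[OF this U2(1)] obtain k U where
      dec: "irreducible_decomposition G (W\<lparr>rep_space := U2\<rparr>) k U" by blast
    then have bij: "bij_betw (\<lambda>u. \<Sum>i<k. u i) (\<Pi>\<^sub>E i\<in>{..<k}. U i) U2"
      and irr: "\<And>i. i < k \<Longrightarrow> subrep G (U i) (W\<lparr>rep_space := U2\<rparr>) \<and> irreducible_rep G (W\<lparr>rep_space := U i\<rparr>)"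
      by (auto simp: irreducible_decomposition_def)
    \<comment> \<open>The irreducible piece takes the last index \<open>k\<close>, so that families
      over \<open>{..<k}\<close> remain those of the complement. \<open>restrict\<close> cuts a
      longer family down to an extensional one.\<close>
    define U' where "U' = U(k := U1)"
    have U'_less: "U' i = U i" if "i < k" for i using that by (simp add: U'_def)
    have restr: "restrict u {..<k} \<in> (\<Pi>\<^sub>E i\<in>{..<k}. U i)" "u k \<in> U1"
      if "u \<in> (\<Pi>\<^sub>E i\<in>{..<Suc k}. U' i)" for u
    proof -
      from that have "u i \<in> U' i" if "i < Suc k" for i using that by (auto simp: PiE_iff)
      from this[of k] this show "restrict u {..<k} \<in> (\<Pi>\<^sub>E i\<in>{..<k}. U i)" "u k \<in> U1"
        by (auto simp: U'_def less_Suc_eq restrict_PiE_iff) (metis less_irrefl)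
    qed
    have sum_restr: "(\<Sum>i<Suc k. u i) = (\<Sum>i<k. restrict u {..<k} i) + u k" for u :: "nat \<Rightarrow> 'x \<Rightarrow> complex"
      by simp
    have in_U2: "(\<Sum>i<k. u i) \<in> U2" if "u \<in> (\<Pi>\<^sub>E i\<in>{..<k}. U i)" for u
      using bij that by (auto simp: bij_betw_def)
    have sp: "fun_vs.subspace U1" "fun_vs.subspace U2" "fun_vs.subspace U0"
      using U1 U2 less.prems by (auto simp: subrep_def)
    have "bij_betw (\<lambda>u. \<Sum>i<Suc k. u i) (\<Pi>\<^sub>E i\<in>{..<Suc k}. U' i) U0"
      unfolding bij_betw_def
    proof (intro conjI inj_onI equalityI subsetI)
      fix u v assume u: "u \<in> (\<Pi>\<^sub>E i\<in>{..<Suc k}. U' i)" and v: "v \<in> (\<Pi>\<^sub>E i\<in>{..<Suc k}. U' i)"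
        and eq: "(\<Sum>i<Suc k. u i) = (\<Sum>i<Suc k. v i)"
      let ?a = "\<Sum>i<k. restrict u {..<k} i" and ?b = "\<Sum>i<k. restrict v {..<k} i"
      have ab: "?a - ?b = v k - u k"
        using eq by (simp add: algebra_simps)
      moreover have "?a - ?b \<in> U2"
        using restr[OF u] restr[OF v] in_U2 sp by (intro fun_vs.subspace_diff) blast+
      moreover have "v k - u k \<in> U1"
        using restr[OF u] restr[OF v] sp by (intro fun_vs.subspace_diff) auto
      ultimately have "v k - u k \<in> {0}" using U2(3) unfolding ab by blast
      with ab have "?a = ?b" "u k = v k" by auto
      then have "restrict u {..<k} = restrict v {..<k}"
        using inj_onD[OF bij_betw_imp_inj_on[OF bij] _ restr(1)[OF u] restr(1)[OF v]] by blast
      then have "u i = v i" if "i < k" for i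
        using that by (metis lessThan_iff restrict_apply')
      with \<open>u k = v k\<close> have "u i = v i" if "i < Suc k" for i
        using that less_Suc_eq by auto
      then show "u = v" using u v by (intro PiE_ext) auto
    next
      fix w assume "w \<in> (\<lambda>u. \<Sum>i<Suc k. u i) ` (\<Pi>\<^sub>E i\<in>{..<Suc k}. U' i)"
      then obtain u where u: "u \<in> (\<Pi>\<^sub>E i\<in>{..<Suc k}. U' i)" "w = (\<Sum>i<Suc k. u i)" by blast
      have "(\<Sum>i<k. restrict u {..<k} i) \<in> U0" "u k \<in> U0"
        using restr(2)[OF u(1)] in_U2[OF restr(1)[OF u(1)]] U2(2) U1(2) by auto
      then show "w \<in> U0" unfolding u(2) sum_restr using sp(3) by (rule fun_vs.subspace_add[rotated 1])
    next
      fix w assume "w \<in> U0"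
      then obtain a where a: "a \<in> U1" "w - a \<in> U2" using U2(4) by blast
      then obtain u where u: "u \<in> (\<Pi>\<^sub>E i\<in>{..<k}. U i)" "w - a = (\<Sum>i<k. u i)"
        using bij by (auto simp: bij_betw_def)
      have "u(k := a) \<in> (\<Pi>\<^sub>E i\<in>{..<Suc k}. U' i)"
        using u(1) a(1) by (auto simp: PiE_iff U'_def extensional_def)
      moreover have "w = (\<Sum>i<Suc k. (u(k := a)) i)"
        using u(2) by (simp add: algebra_simps)
      ultimately show "w \<in> (\<lambda>u. \<Sum>i<Suc k. u i) ` (\<Pi>\<^sub>E i\<in>{..<Suc k}. U' i)" by blast
    qed
    moreover have "subrep G (U' i) (W\<lparr>rep_space := U0\<rparr>) \<and> irreducible_rep G (W\<lparr>rep_space := U' i\<rparr>)"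
      if "i < Suc k" for i
    proof (cases "i = k")
      case True
      then show ?thesis using U1 by (auto simp: U'_def subrep_def)
    next
      case False
      then show ?thesis using that irr[of i] U2(2) by (auto simp: U'_def subrep_def)
    qed
    ultimately have "irreducible_decomposition G (W\<lparr>rep_space := U0\<rparr>) (Suc k) U'"
      by (simp add: irreducible_decomposition_def)
    then show ?thesis by blast
  qed
qed

end

subsection \<open>Primitive idempotents\<close>

context finite_group
begin

definition ideal_rep :: "('a \<Rightarrow> complex) \<Rightarrow> ('a, 'a) rep" where
  "ideal_rep e = \<lparr>rep_space = {conv G x e | x. x \<in> group_algebra G}, rep_act = left_translation G\<rparr>"

text \<open>By Schur's lemma the last condition is equivalent to irreducibility of
  \<open>A e\<close>. This form is what Young symmetrizers satisfy by direct computation, and it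
  makes \<open>e\<close> act with rank one.\<close>

definition primitive_idempotent :: "('a \<Rightarrow> complex) \<Rightarrow> bool" where
  "primitive_idempotent e \<longleftrightarrow> e \<in> group_algebra G \<and> e \<noteq> 0 \<and> conv G e e = e \<and>
     (\<forall>x\<in>group_algebra G. \<exists>c. conv G e (conv G x e) = fscale c e)"

lemma left_translation_in_group_algebra: "left_translation G g x \<in> group_algebra G"
  by (simp add: left_translation_def group_algebra_def)

lemma conv_eq_sum_left_translation:
  "conv G y x = (\<Sum>g\<in>carrier G. fscale (y g) (left_translation G g x))"
  by (auto simp: conv_def fun_eq_iff sum_fun_apply left_translation_def)

end

context perm_rep
begin

definition eact :: "('a \<Rightarrow> complex) \<Rightarrow> ('x \<Rightarrow> complex) \<Rightarrow> ('x \<Rightarrow> complex)" where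
  "eact y f = (\<Sum>g\<in>carrier G. fscale (y g) (rep_act W g f))"

lemma eact_apply: "eact y f x = (if x \<in> X then \<Sum>g\<in>carrier G. y g * f (\<pi> g x) else 0)"
  by (auto simp: eact_def sum_fun_apply rep_act_W)

lemma eact_conv: "eact (conv G y z) f = eact y (eact z f)"
proof
  fix x
  show "eact (conv G y z) f x = eact y (eact z f) x"
  proof (cases "x \<in> X")
    case x: True
    have "eact y (eact z f) x =
        (\<Sum>g\<in>carrier G. \<Sum>h\<in>carrier G. y g * z h * f (\<pi> (g \<otimes> h) x))"
      using x by (simp add: eact_apply pi_in pi_mult sum_distrib_left mult.assoc)
    also have "\<dots> = (\<Sum>g\<in>carrier G. \<Sum>h\<in>carrier G. y g * z (inv g \<otimes> h) * f (\<pi> h x))"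
    proof (rule sum.cong[OF refl])
      fix g assume g: "g \<in> carrier G"
      have "(\<Sum>h\<in>carrier G. y g * z h * f (\<pi> (g \<otimes> h) x)) =
          (\<Sum>h\<in>carrier G. y g * z (inv g \<otimes> h) * f (\<pi> (g \<otimes> (inv g \<otimes> h)) x))"
        by (rule sum_mult_left[symmetric]) (use g in simp)
      also have "\<dots> = (\<Sum>h\<in>carrier G. y g * z (inv g \<otimes> h) * f (\<pi> h x))"
        using g by (intro sum.cong refl) (simp add: m_assoc[symmetric])
      finally show "(\<Sum>h\<in>carrier G. y g * z h * f (\<pi> (g \<otimes> h) x)) =
          (\<Sum>h\<in>carrier G. y g * z (inv g \<otimes> h) * f (\<pi> h x))" .
    qed
    also have "\<dots> = eact (conv G y z) f x"
      using x by (subst sum.swap) (simp add: eact_apply conv_def sum_distrib_right)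
    finally show ?thesis by simp
  qed (simp add: eact_apply)
qed

lemma eact_add: "eact (y + z) f = eact y f + eact z f"
  by (auto simp: fun_eq_iff eact_apply algebra_simps sum.distrib)

lemma eact_fscale: "eact (fscale c y) f = fscale c (eact y f)"
  by (auto simp: fun_eq_iff eact_apply sum_distrib_left mult_ac)

lemma eact_fscale_right: "eact y (fscale c f) = fscale c (eact y f)"
  by (auto simp: fun_eq_iff eact_apply sum_distrib_left mult_ac)

lemma eact_zero_right [simp]: "eact y 0 = 0"
  by (auto simp: fun_eq_iff eact_apply)

lemma eact_sum_right: "eact y (\<Sum>i\<in>I. f i) = (\<Sum>i\<in>I. eact y (f i))"
proof
  fix x
  show "eact y (\<Sum>i\<in>I. f i) x = (\<Sum>i\<in>I. eact y (f i)) x"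
    by (cases "x \<in> X")
       (simp_all add: eact_apply sum_fun_apply sum_distrib_left sum.swap[of _ I])
qed

lemma eact_left_translation:
  assumes g: "g \<in> carrier G"
  shows "eact (left_translation G g y) f = rep_act W g (eact y f)"
proof
  fix x
  have "(\<Sum>h\<in>carrier G. y (inv g \<otimes> h) * f (\<pi> h x)) = (\<Sum>h\<in>carrier G. y h * f (\<pi> h (\<pi> g x)))"
    if "x \<in> X"
  proof -
    have "(\<Sum>h\<in>carrier G. y (inv g \<otimes> h) * f (\<pi> h x)) =
        (\<Sum>h\<in>carrier G. y (inv g \<otimes> (g \<otimes> h)) * f (\<pi> (g \<otimes> h) x))"
      by (rule sum_mult_left[OF g, symmetric])
    then show ?thesis using g that by (simp add: m_assoc[symmetric] pi_mult)
  qed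
  then show "eact (left_translation G g y) f x = rep_act W g (eact y f) x"
    using g by (auto simp: eact_apply rep_act_W left_translation_def pi_in)
qed

lemma eact_in:
  assumes "subrep G U W" "u \<in> U"
  shows "eact y u \<in> U"
  unfolding eact_def using assms
  by (intro fun_vs.subspace_sum fun_vs.subspace_scale) (auto simp: subrep_def)

text \<open>The isomorphism is the inverse of \<open>y \<mapsto> eact y u\<close> on
  \<open>A e\<close>. The image of this map is a nonzero subrepresentation, hence all of
  \<open>U\<close>; its kernel vanishes by positivity.\<close>

lemma rep_iso_ideal_rep:
  assumes e: "primitive_idempotent e" and U: "subrep G U W" and irr: "irreducible_rep G (W\<lparr>rep_space := U\<rparr>)"
    and u: "u \<in> U" "u \<noteq> 0" "eact e u = u"
  shows "rep_iso G (W\<lparr>rep_space := U\<rparr>) (ideal_rep e)"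
proof -
  define V where "V = rep_space (ideal_rep e)"
  define S where "S = (\<lambda>y. eact y u)"
  have V_def': "V = {conv G x e | x. x \<in> group_algebra G}" by (simp add: V_def ideal_rep_def)
  have ee: "conv G e e = e" and e_in: "e \<in> group_algebra G" using e by (auto simp: primitive_idempotent_def)
  have V_ga: "y \<in> group_algebra G" and V_e: "conv G y e = y" if "y \<in> V" for y
    using that ee by (auto simp: V_def' conv_assoc conv_in_group_algebra)
  have V_sum: "y + z \<in> V" if "y \<in> V" "z \<in> V" for y z
  proof -
    have "y + z = conv G (y + z) e" using that by (simp add: conv_add_left V_e)
    moreover have "y + z \<in> group_algebra G"
      using that[THEN V_ga] by (auto simp: group_algebra_def)
    ultimately show ?thesis by (auto simp: V_def')
  qed
  have V_scale: "fscale c y \<in> V" if "y \<in> V" for c y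
  proof -
    have "fscale c y = conv G (fscale c y) e" using that by (simp add: conv_fscale_left V_e)
    moreover have "fscale c y \<in> group_algebra G"
      using that[THEN V_ga] by (auto simp: group_algebra_def)
    ultimately show ?thesis by (auto simp: V_def')
  qed
  have V_trans: "left_translation G g y \<in> V" if "g \<in> carrier G" "y \<in> V" for g y
  proof -
    have "left_translation G g y = conv G (left_translation G g y) e"
      using that by (simp add: conv_left_translation V_e)
    then show ?thesis using left_translation_in_group_algebra by (auto simp: V_def')
  qed
  have S_add: "S (y + z) = S y + S z" and S_scale: "S (fscale c y) = fscale c (S y)" for c y z
    by (simp_all add: S_def eact_add eact_fscale)
  have S_trans: "S (left_translation G g y) = rep_act W g (S y)" if "g \<in> carrier G" for g y
    using that by (simp add: S_def eact_left_translation)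
  have S0: "y = 0" if y: "y \<in> V" "S y = 0" for y
  proof (rule conv_triple_star_eq_0)
    show "y \<in> group_algebra G" by (rule V_ga[OF y(1)])
    \<comment> \<open>Because \<open>y = y e\<close>, the product \<open>e z y\<close> is a multiple
      of \<open>e\<close>; it kills \<open>u\<close> since \<open>y\<close> does, while
      \<open>e\<close> fixes \<open>u\<close>, so the scalar is 0. For \<open>z = star y\<close>
      this makes \<open>y (star y) y\<close> vanish.\<close>
    have "conv G e (conv G z y) = 0" if z: "z \<in> group_algebra G" for z
    proof -
      have "conv G e (conv G z y) = conv G e (conv G (conv G z y) e)"
        using V_e[OF y(1)] by (simp add: conv_assoc)
      then obtain c where c: "conv G e (conv G z y) = fscale c e"
        using e conv_in_group_algebra[of z y] by (auto simp: primitive_idempotent_def)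
      have "fscale c u = eact (conv G e (conv G z y)) u" using c u(3) by (simp add: eact_fscale)
      also have "\<dots> = 0" using y(2) by (simp add: eact_conv S_def)
      finally have "c = 0" using u(2) by (auto simp: fun_eq_iff)
      then show ?thesis using c by (simp add: fun_eq_iff)
    qed
    from this[of "star y"] have "conv G y (conv G e (conv G (star y) y)) = 0"
      by (simp add: star_in_group_algebra)
    then show "conv G y (conv G (star y) y) = 0"
      using V_e[OF y(1)] by (simp add: conv_assoc[symmetric])
  qed
  have e_V: "e \<in> V" using e_in ee by (auto simp: V_def') metis
  have inj: "inj_on S V"
  proof (rule inj_onI)
    fix y z assume yz: "y \<in> V" "z \<in> V" "S y = S z"
    have eq: "y - z = y + fscale (-1) z" by (auto simp: fun_eq_iff)
    then have "y - z \<in> V" using yz V_sum V_scale by metis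
    moreover have "S (y - z) = 0" using yz(3) unfolding eq S_add S_scale by (simp only: fun_eq_iff) simp
    ultimately show "y = z" using S0 by fastforce
  qed
  have "subrep G (S ` V) (W\<lparr>rep_space := U\<rparr>)"
    unfolding subrep_def fun_vs.subspace_def
  proof (intro conjI ballI allI)
    have "0 \<in> V" using V_scale[OF e_V, of 0] by simp
    moreover have "S 0 = 0" using S_scale[of 0 e] by simp
    ultimately show "0 \<in> S ` V" by (metis imageI)
  next
    fix y z assume "y \<in> S ` V" "z \<in> S ` V" then show "y + z \<in> S ` V"
      using V_sum by (auto simp: S_add[symmetric])
  next
    fix c y assume "y \<in> S ` V" then show "fscale c y \<in> S ` V"
      using V_scale by (auto simp: S_scale[symmetric])
  next
    show "S ` V \<subseteq> rep_space (W\<lparr>rep_space := U\<rparr>)"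
      using U u(1) by (auto simp: S_def eact_in)
  next
    fix g y assume "g \<in> carrier G" "y \<in> S ` V"
    then show "rep_act (W\<lparr>rep_space := U\<rparr>) g y \<in> S ` V"
      using V_trans by (auto simp: S_trans[symmetric])
  qed
  moreover have "S ` V \<noteq> {0}" using e_V u by (force simp: S_def)
  ultimately have "S ` V = U" using irr by (auto simp: irreducible_rep_def)
  with inj have bij: "bij_betw S V U" by (simp add: bij_betw_def)
  have inv_in: "inv_into V S w \<in> V" and S_inv: "S (inv_into V S w) = w" if "w \<in> U" for w
    using that \<open>S ` V = U\<close> by (auto simp: inv_into_into f_inv_into_f)
  have inv_eq: "inv_into V S (S y) = y" if "y \<in> V" for y using inj that by simp
  show ?thesis
    unfolding rep_iso_def
  proof (intro exI[of _ "inv_into V S"] conjI ballI allI)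
    show "bij_betw (inv_into V S) (rep_space (W\<lparr>rep_space := U\<rparr>)) (rep_space (ideal_rep e))"
      using bij by (simp add: bij_betw_inv_into V_def[symmetric])
  next
    fix w w' assume "w \<in> rep_space (W\<lparr>rep_space := U\<rparr>)" "w' \<in> rep_space (W\<lparr>rep_space := U\<rparr>)"
    then have w: "w \<in> U" "w' \<in> U" by auto
    then have "w + w' = S (inv_into V S w + inv_into V S w')" by (simp add: S_add S_inv)
    then show "inv_into V S (w + w') = inv_into V S w + inv_into V S w'"
      using w by (simp add: inv_eq V_sum inv_in)
  next
    fix c w assume "w \<in> rep_space (W\<lparr>rep_space := U\<rparr>)"
    then have w: "w \<in> U" by auto
    then have "fscale c w = S (fscale c (inv_into V S w))" by (simp add: S_scale S_inv)
    then show "inv_into V S (fscale c w) = fscale c (inv_into V S w)"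
      using w by (simp add: inv_eq V_scale inv_in)
  next
    fix g w assume g: "g \<in> carrier G" and "w \<in> rep_space (W\<lparr>rep_space := U\<rparr>)"
    then have w: "w \<in> U" by auto
    then have "rep_act W g w = S (left_translation G g (inv_into V S w))"
      using g by (simp add: S_trans S_inv)
    then show "inv_into V S (rep_act (W\<lparr>rep_space := U\<rparr>) g w) =
        rep_act (ideal_rep e) g (inv_into V S w)"
      using w g by (simp add: inv_eq V_trans inv_in ideal_rep_def)
  qed
qed

text \<open>Let \<open>u\<close> correspond to \<open>e\<close>. A vector corresponding to
  \<open>x e\<close> is sent by \<open>e\<close> to one corresponding to \<open>e x e\<close>, a
  multiple of \<open>e\<close>; so \<open>e\<close> projects \<open>U\<close> onto the line through
  \<open>u\<close>.\<close>

lemma rep_iso_ideal_rep_fixed: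
  assumes e: "primitive_idempotent e" and U: "subrep G U W"
    and iso: "rep_iso G (W\<lparr>rep_space := U\<rparr>) (ideal_rep e)"
  obtains u where "u \<in> U" "u \<noteq> 0" "eact e u = u" "\<forall>w\<in>U. \<exists>c. eact e w = fscale c u"
proof -
  define V where "V = rep_space (ideal_rep e)"
  have V_def': "V = {conv G x e | x. x \<in> group_algebra G}" by (simp add: V_def ideal_rep_def)
  have ee: "conv G e e = e" and e_in: "e \<in> group_algebra G" and "e \<noteq> 0"
    using e by (auto simp: primitive_idempotent_def)
  from iso obtain T where bij: "bij_betw T U V"
    and T_add: "\<And>u v. u \<in> U \<Longrightarrow> v \<in> U \<Longrightarrow> T (u + v) = T u + T v"
    and T_scale: "\<And>c u. u \<in> U \<Longrightarrow> T (fscale c u) = fscale c (T u)"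
    and T_act: "\<And>g u. g \<in> carrier G \<Longrightarrow> u \<in> U \<Longrightarrow> T (rep_act W g u) = left_translation G g (T u)"
    by (auto simp: rep_iso_def V_def[symmetric]) (simp add: ideal_rep_def)
  have sp: "fun_vs.subspace U" using U by (simp add: subrep_def)
  have "T (fscale 0 0) = fscale 0 (T 0)" using sp by (intro T_scale fun_vs.subspace_0)
  then have T0: "T 0 = 0" by (auto simp: fscale_def zero_fun_def)
  have T_sum: "T (\<Sum>i\<in>I. f i) = (\<Sum>i\<in>I. T (f i))" if "finite I" "\<And>i. i \<in> I \<Longrightarrow> f i \<in> U"
    for I :: "'a set" and f
    using that by (induction I) (auto simp: T0 T_add sp fun_vs.subspace_sum)
  have T_eact: "T (eact y w) = conv G y (T w)" if w: "w \<in> U" for y w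
  proof -
    have act: "rep_act W g w \<in> U" if "g \<in> carrier G" for g using U w that by (auto simp: subrep_def)
    then show ?thesis
      unfolding eact_def conv_eq_sum_left_translation using w finite_carrier
      by (subst T_sum) (auto simp: T_scale T_act sp intro!: fun_vs.subspace_scale sum.cong)
  qed
  have e_V: "e \<in> V" using e_in ee by (auto simp: V_def') metis
  then obtain u where u: "u \<in> U" "T u = e" using bij by (auto simp: bij_betw_def)
  have inj: "a = b" if "a \<in> U" "b \<in> U" "T a = T b" for a b
    using that bij by (auto simp: bij_betw_def dest: inj_onD)
  show thesis
  proof
    show "u \<in> U" by fact
    show "u \<noteq> 0" using u T0 \<open>e \<noteq> 0\<close> by auto
    show "eact e u = u" using u ee by (intro inj) (auto simp: T_eact eact_in[OF U])
    show "\<forall>w\<in>U. \<exists>c. eact e w = fscale c u"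
    proof
      fix w assume w: "w \<in> U"
      then obtain x where x: "x \<in> group_algebra G" "T w = conv G x e"
        using bij by (auto simp: bij_betw_def V_def')
      then obtain c where "conv G e (T w) = fscale c e"
        using e by (auto simp: primitive_idempotent_def)
      then have "T (eact e w) = T (fscale c u)" using w u by (simp add: T_eact T_scale)
      then have "eact e w = fscale c u"
        using w u sp by (intro inj) (auto simp: eact_in[OF U] fun_vs.subspace_scale)
      then show "\<exists>c. eact e w = fscale c u" by blast
    qed
  qed
qed

text \<open>On a summand isomorphic to \<open>A e\<close> the idempotent has rank one, on any other
  it is zero by \<open>rep_iso_ideal_rep\<close>; hence the count is the trace of \<open>e\<close>.
  The trace is evaluated on the columns of \<open>M\<close>, which span the space but need not be a
  basis.\<close>

lemma card_isotypic:
  assumes e: "primitive_idempotent e" and dec: "irreducible_decomposition G W k U"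
  shows "of_nat (card {i. i < k \<and> rep_iso G (W\<lparr>rep_space := U i\<rparr>) (ideal_rep e)}) =
    (\<Sum>g\<in>carrier G. e g * char g)"
proof -
  define good where "good = {i. i < k \<and> rep_iso G (W\<lparr>rep_space := U i\<rparr>) (ideal_rep e)}"
  have fin: "finite good" and good_less: "\<And>i. i \<in> good \<Longrightarrow> i < k" by (auto simp: good_def)
  have sub: "subrep G (U i) W" and irr: "irreducible_rep G (W\<lparr>rep_space := U i\<rparr>)" if "i < k" for i
    using dec that by (auto simp: irreducible_decomposition_def)
  have bij: "bij_betw (\<lambda>u. \<Sum>i<k. u i) (\<Pi>\<^sub>E i\<in>{..<k}. U i) (rep_space W)"
    using dec by (simp add: irreducible_decomposition_def)
  have ee: "conv G e e = e" using e by (auto simp: primitive_idempotent_def)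
  define Q where "Q i u \<longleftrightarrow> u \<in> U i \<and> u \<noteq> 0 \<and> eact e u = u \<and> (\<forall>w\<in>U i. \<exists>c. eact e w = fscale c u)"
    for i u
  have "\<exists>u. Q i u" if i: "i \<in> good" for i
  proof -
    have iso: "rep_iso G (W\<lparr>rep_space := U i\<rparr>) (ideal_rep e)" using i by (simp add: good_def)
    obtain u where "u \<in> U i" "u \<noteq> 0" "eact e u = u" "\<forall>w\<in>U i. \<exists>c. eact e w = fscale c u"
      by (rule rep_iso_ideal_rep_fixed[OF e sub[OF good_less[OF i]] iso])
    then show ?thesis unfolding Q_def by blast
  qed
  then obtain b where "\<And>i. i \<in> good \<Longrightarrow> Q i (b i)" by metis
  then have b: "\<And>i. i \<in> good \<Longrightarrow> b i \<in> U i" "\<And>i. i \<in> good \<Longrightarrow> b i \<noteq> 0"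
    "\<And>i. i \<in> good \<Longrightarrow> eact e (b i) = b i"
    "\<And>i w. i \<in> good \<Longrightarrow> w \<in> U i \<Longrightarrow> \<exists>c. eact e w = fscale c (b i)" by (auto simp: Q_def)
  have bad: "eact e w = 0" if "i < k" "i \<notin> good" "w \<in> U i" for i w
  proof (rule ccontr)
    assume "eact e w \<noteq> 0"
    then have "rep_iso G (W\<lparr>rep_space := U i\<rparr>) (ideal_rep e)"
      using that ee eact_in[OF sub[OF that(1)]]
      by (intro rep_iso_ideal_rep[OF e sub irr, of i "eact e w"]) (simp_all add: eact_conv[symmetric])
    then show False using that by (simp add: good_def)
  qed
  define col where "col x = (\<lambda>a. if a \<in> X then M a x else 0)" for x
  have col_in: "col x \<in> rep_space W" if "x \<in> X" for x
    using that by (auto simp: col_def rep_space_W M_idem)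
  have expand: "f = (\<Sum>x\<in>X. fscale (f x) (col x))" if "f \<in> rep_space W" for f
  proof
    fix a
    show "f a = (\<Sum>x\<in>X. fscale (f x) (col x)) a"
    proof (cases "a \<in> X")
      case True
      then have "f a = (\<Sum>x\<in>X. M a x * f x)" using that unfolding rep_space_W by blast
      then show ?thesis using True by (simp add: sum_fun_apply col_def mult.commute)
    qed (use that in \<open>simp add: sum_fun_apply col_def rep_space_W\<close>)
  qed
  have "\<exists>c. eact e (col x) = (\<Sum>i\<in>good. fscale (c i) (b i))" if x: "x \<in> X" for x
  proof -
    obtain u where u: "u \<in> (\<Pi>\<^sub>E i\<in>{..<k}. U i)" "col x = (\<Sum>i<k. u i)"
      using bij col_in[OF x] by (auto simp: bij_betw_def)
    have u_in: "u i \<in> U i" if "i < k" for i using u(1) that by (auto simp: PiE_iff)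
    have "\<exists>c. eact e (u i) = fscale c (b i)" if "i \<in> good" for i
      using b(4)[OF that u_in[OF good_less[OF that]]] .
    then obtain c where c: "\<And>i. i \<in> good \<Longrightarrow> eact e (u i) = fscale (c i) (b i)" by metis
    have "eact e (col x) = (\<Sum>i<k. eact e (u i))" by (simp add: u(2) eact_sum_right)
    also have "\<dots> = (\<Sum>i\<in>good. eact e (u i))"
      using bad u_in good_less by (intro sum.mono_neutral_right) auto
    also have "\<dots> = (\<Sum>i\<in>good. fscale (c i) (b i))" using c by simp
    finally show ?thesis by blast
  qed
  then obtain c where c: "\<And>x. x \<in> X \<Longrightarrow> eact e (col x) = (\<Sum>i\<in>good. fscale (c x i) (b i))" by metis
  \<comment> \<open>Expand \<open>b j\<close> in the columns of \<open>M\<close> and apply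
    \<open>e\<close>, which fixes \<open>b j\<close>. The sum in question is the coefficient of
    \<open>b j\<close> in the result, and it is 1 because the sum of the \<open>U i\<close> is
    direct: \<open>v\<close> and \<open>v'\<close> are two families with the same total.\<close>
  have coef: "(\<Sum>x\<in>X. b j x * c x j) = 1" if j: "j \<in> good" for j
  proof -
    define t where "t i = (\<Sum>x\<in>X. b j x * c x i)" for i
    have bj: "b j \<in> rep_space W" using b(1)[OF j] sub[OF good_less[OF j]] by (auto simp: subrep_def)
    have "b j = eact e (\<Sum>x\<in>X. fscale (b j x) (col x))"
      by (simp only: b(3)[OF j] expand[OF bj, symmetric])
    also have "\<dots> = (\<Sum>x\<in>X. \<Sum>i\<in>good. fscale (b j x * c x i) (b i))"
      by (simp add: eact_sum_right eact_fscale_right c fun_vs.scale_sum_right)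
    also have "\<dots> = (\<Sum>i\<in>good. fscale (t i) (b i))"
      by (subst sum.swap) (simp add: t_def fun_vs.scale_sum_left)
    finally have bj_eq: "b j = (\<Sum>i\<in>good. fscale (t i) (b i))" .
    define v where "v = (\<lambda>i\<in>{..<k}. if i \<in> good then fscale (t i) (b i) else 0)"
    define v' where "v' = (\<lambda>i\<in>{..<k}. if i = j then b j else 0)"
    have zero: "0 \<in> U i" and scale: "w \<in> U i \<Longrightarrow> fscale s w \<in> U i" if "i < k" for i w s
      using sub[OF that] by (auto simp: subrep_def fun_vs.subspace_0 fun_vs.subspace_scale)
    have "v \<in> (\<Pi>\<^sub>E i\<in>{..<k}. U i)" "v' \<in> (\<Pi>\<^sub>E i\<in>{..<k}. U i)"
      using b(1) j by (auto simp: v_def v'_def zero scale)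
    moreover have "(\<Sum>i<k. v i) = (\<Sum>i\<in>good. fscale (t i) (b i))"
      using good_less by (intro sum.mono_neutral_cong_right) (auto simp: v_def)
    moreover have "(\<Sum>i<k. v' i) = b j"
      using good_less[OF j] by (simp add: v'_def)
    ultimately have "v = v'"
      using inj_onD[OF bij_betw_imp_inj_on[OF bij], of v v'] bj_eq[symmetric] by simp
    then have "v j = v' j" by simp
    then have "fscale (t j) (b j) = b j" using j good_less[OF j] by (simp add: v_def v'_def)
    moreover obtain x where "b j x \<noteq> 0" using b(2)[OF j] by (auto simp: fun_eq_iff)
    ultimately have "t j = 1" by (metis fscale_apply mult_cancel_right1)
    then show ?thesis by (simp add: t_def)
  qed
  have "(\<Sum>g\<in>carrier G. e g * char g) = (\<Sum>x\<in>X. \<Sum>g\<in>carrier G. e g * M (\<pi> g x) x)"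
    by (subst sum.swap) (simp add: char_def sum_distrib_left)
  also have "\<dots> = (\<Sum>x\<in>X. eact e (col x) x)"
    by (auto simp: eact_apply col_def pi_in intro!: sum.cong)
  also have "\<dots> = (\<Sum>i\<in>good. \<Sum>x\<in>X. b i x * c x i)"
    by (subst sum.swap) (simp add: c sum_fun_apply mult.commute)
  also have "\<dots> = of_nat (card good)" using coef by simp
  finally show ?thesis by (simp add: good_def)
qed

text \<open>The trace does not see the decomposition, so all decompositions give the same count and
  the description by \<open>THE\<close> denotes it.\<close>

theorem multiplicity_ideal_rep:
  assumes e: "primitive_idempotent e"
  shows "of_nat (multiplicity_rep G (ideal_rep e) W) = (\<Sum>g\<in>carrier G. e g * char g)"
proof -
  have "W\<lparr>rep_space := rep_space W\<rparr> = W" by simp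
  then obtain k U where dec: "irreducible_decomposition G W k U"
    using irreducible_decomposition_exists[OF subrep_self] by auto
  let ?m = "card {i. i < k \<and> rep_iso G (W\<lparr>rep_space := U i\<rparr>) (ideal_rep e)}"
  have "multiplicity_rep G (ideal_rep e) W = ?m"
    unfolding multiplicity_rep_def
  proof (rule the_equality)
    show "\<exists>k U. irreducible_decomposition G W k U \<and>
        ?m = card {i. i < k \<and> rep_iso G (W\<lparr>rep_space := U i\<rparr>) (ideal_rep e)}"
      using dec by blast
  next
    fix m assume "\<exists>k U. irreducible_decomposition G W k U \<and>
        m = card {i. i < k \<and> rep_iso G (W\<lparr>rep_space := U i\<rparr>) (ideal_rep e)}"
    then obtain k' U' where dec': "irreducible_decomposition G W k' U'"
      and m: "m = card {i. i < k' \<and> rep_iso G (W\<lparr>rep_space := U' i\<rparr>) (ideal_rep e)}" by blast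
    have "of_nat m = (of_nat ?m :: complex)"
      unfolding m card_isotypic[OF e dec'] card_isotypic[OF e dec] ..
    then show "m = ?m" by simp
  qed
  then show ?thesis using card_isotypic[OF e dec] by simp
qed

end

subsection \<open>Characters of the constructions\<close>

text \<open>\<open>A e\<close> is the fixed space of right multiplication by \<open>e\<close>, whose
  matrix has the entry \<open>e (inv x \<otimes> a)\<close> in row \<open>a\<close> and column
  \<open>x\<close>. Left translation by \<open>g\<close> substitutes
  \<open>inv g \<otimes> x\<close>, a right action in \<open>g\<close> as the locale
  demands.\<close>

lemma (in finite_group) perm_rep_ideal_rep:
  assumes e: "primitive_idempotent e"
  shows "perm_rep G (carrier G) (\<lambda>g x. inv g \<otimes> x) (\<lambda>a x. e (inv x \<otimes> a)) (ideal_rep e)"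
proof
  show "finite (carrier G)" by (rule finite_carrier)
  fix g h x assume gx: "g \<in> carrier G" "x \<in> carrier G"
  then show "inv g \<otimes> x \<in> carrier G" by simp
  assume h: "h \<in> carrier G"
  then show "inv (g \<otimes> h) \<otimes> x = inv h \<otimes> (inv g \<otimes> x)"
    using gx by (simp add: inv_mult_group m_assoc)
  have "inv (inv g \<otimes> x) \<otimes> (inv g \<otimes> h) = inv x \<otimes> h"
    using gx h by (simp add: inv_mult_group m_assoc) (simp add: m_assoc[symmetric])
  then show "e (inv (inv g \<otimes> x) \<otimes> (inv g \<otimes> h)) = e (inv x \<otimes> h)" by simp
next
  fix x assume "x \<in> carrier G"
  then show "inv \<one> \<otimes> x = x" by simp
next
  have ee: "conv G e e = e" using e by (simp add: primitive_idempotent_def)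
  fix a x assume ax: "a \<in> carrier G" "x \<in> carrier G"
  have "(\<Sum>y\<in>carrier G. e (inv y \<otimes> a) * e (inv x \<otimes> y)) =
      (\<Sum>y\<in>carrier G. e (inv (x \<otimes> y) \<otimes> a) * e (inv x \<otimes> (x \<otimes> y)))"
    by (rule sum_mult_left[OF ax(2), symmetric])
  also have "\<dots> = (\<Sum>y\<in>carrier G. e y * e (inv y \<otimes> (inv x \<otimes> a)))"
    using ax by (intro sum.cong refl) (simp add: inv_mult_group m_assoc, simp add: m_assoc[symmetric])
  also have "\<dots> = conv G e e (inv x \<otimes> a)" using ax by (simp add: conv_def)
  finally show "(\<Sum>y\<in>carrier G. e (inv y \<otimes> a) * e (inv x \<otimes> y)) = e (inv x \<otimes> a)"
    by (simp add: ee)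
next
  have ee: "conv G e e = e" using e by (simp add: primitive_idempotent_def)
  have "conv G f e \<in> {f. (\<forall>x. x \<notin> carrier G \<longrightarrow> f x = 0) \<and>
      (\<forall>a\<in>carrier G. f a = (\<Sum>x\<in>carrier G. e (inv x \<otimes> a) * f x))}" for f
  proof -
    have "conv G f e a = (\<Sum>x\<in>carrier G. e (inv x \<otimes> a) * conv G f e x)" if "a \<in> carrier G" for a
      using that ee conv_assoc[of f e e] by (metis (no_types, lifting) conv_def mult.commute sum.cong)
    then show ?thesis by (auto simp: conv_def)
  qed
  moreover have "\<exists>x. f = conv G x e \<and> x \<in> group_algebra G"
    if f: "\<forall>x. x \<notin> carrier G \<longrightarrow> f x = 0" "\<forall>a\<in>carrier G. f a = (\<Sum>x\<in>carrier G. e (inv x \<otimes> a) * f x)" for f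
  proof (intro exI conjI)
    show "f = conv G f e"
    proof
      fix a show "f a = conv G f e a"
        using f(1)[rule_format, of a] f(2)[rule_format, of a] by (auto simp: conv_def mult.commute)
    qed
    show "f \<in> group_algebra G" using f(1) by (simp add: group_algebra_def)
  qed
  ultimately show "rep_space (ideal_rep e) = {f. (\<forall>x. x \<notin> carrier G \<longrightarrow> f x = 0) \<and>
      (\<forall>a\<in>carrier G. f a = (\<Sum>x\<in>carrier G. e (inv x \<otimes> a) * f x))}"
    unfolding ideal_rep_def by auto
next
  fix g f assume "g \<in> carrier G"
  then show "rep_act (ideal_rep e) g f = (\<lambda>x. if x \<in> carrier G then f (inv g \<otimes> x) else 0)"
    by (simp add: ideal_rep_def left_translation_def)
qed

text \<open>The trace of \<open>g\<close> on \<open>A e\<close>. The argument is inverted because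
  left translation by \<open>g\<close> substitutes \<open>inv g \<otimes> x\<close>.\<close>

definition (in finite_group) ideal_char :: "('a \<Rightarrow> complex) \<Rightarrow> 'a \<Rightarrow> complex" where
  "ideal_char e g = (\<Sum>x\<in>carrier G. e (inv x \<otimes> inv g \<otimes> x))"

text \<open>The fixed space of the product matrix is a subspace containing the pure tensors.
  Conversely a fixed function expands in the tensors of columns of \<open>M\<close> and
  \<open>N\<close>, and these columns lie in the two factors.\<close>

lemma perm_rep_Tensor:
  fixes X :: "'x set" and Y :: "'y set"
  assumes V: "perm_rep G X \<pi> M V" and W: "perm_rep H Y \<rho> N W"
  shows "perm_rep (G \<times>\<times> H) (X \<times> Y) (\<lambda>(g, h) (a, b). (\<pi> g a, \<rho> h b))
    (\<lambda>(a, b) (x, y). M a x * N b y) (Tensor V W)"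
proof -
  interpret V: perm_rep G X \<pi> M V by (rule V)
  interpret W: perm_rep H Y \<rho> N W by (rule W)
  interpret GH: group "G \<times>\<times> H" by (intro DirProd_group V.is_group W.is_group)
  define S where "S = {f. (\<forall>x. x \<notin> X \<times> Y \<longrightarrow> f x = 0) \<and> (\<forall>a\<in>X \<times> Y. f a =
      (\<Sum>x\<in>X \<times> Y. (\<lambda>(a, b) (x, y). M a x * N b y) a x * f x))}"
  have S_iff: "f \<in> S \<longleftrightarrow> (\<forall>x. x \<notin> X \<times> Y \<longrightarrow> f x = 0) \<and> (\<forall>a\<in>X. \<forall>b\<in>Y. f (a, b) =
      (\<Sum>x\<in>X. \<Sum>y\<in>Y. M a x * N b y * f (x, y)))" for f
    by (auto simp: S_def sum.cartesian_product intro!: sum.cong)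
  have "fun_vs.subspace S"
    unfolding fun_vs.subspace_def
    by (auto simp: S_iff algebra_simps sum.distrib sum_distrib_left)
  moreover have "pure_tensor v w \<in> S" if "v \<in> rep_space V" "w \<in> rep_space W" for v w
  proof -
    have "pure_tensor v w (a, b) = (\<Sum>x\<in>X. \<Sum>y\<in>Y. M a x * N b y * pure_tensor v w (x, y))"
      if ab: "a \<in> X" "b \<in> Y" for a b
    proof -
      have "v a = (\<Sum>x\<in>X. M a x * v x)" "w b = (\<Sum>y\<in>Y. N b y * w y)"
        using ab \<open>v \<in> _\<close> \<open>w \<in> _\<close> unfolding V.rep_space_W W.rep_space_W by blast+
      then have "v a * w b = (\<Sum>x\<in>X. M a x * v x) * (\<Sum>y\<in>Y. N b y * w y)" by simp
      then show ?thesis by (simp add: pure_tensor_def sum_product mult_ac)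
    qed
    then show ?thesis
      using that by (auto simp: S_iff pure_tensor_def V.rep_space_W W.rep_space_W)
  qed
  ultimately have "fun_vs.span {pure_tensor v w | v w. v \<in> rep_space V \<and> w \<in> rep_space W} \<subseteq> S"
    by (intro fun_vs.span_minimal) auto
  then have sub1: "rep_space (Tensor V W) \<subseteq> S" by (simp add: Tensor_def)
  have sub2: "S \<subseteq> rep_space (Tensor V W)"
  proof
    fix f assume f: "f \<in> S"
    define cM where "cM x = (\<lambda>a. if a \<in> X then M a x else 0)" for x
    define cN where "cN x = (\<lambda>a. if a \<in> Y then N a x else 0)" for x
    have c_in: "x \<in> X \<Longrightarrow> cM x \<in> rep_space V" "y \<in> Y \<Longrightarrow> cN y \<in> rep_space W" for x y
      by (auto simp: V.rep_space_W W.rep_space_W cM_def cN_def V.M_idem W.M_idem)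
    have "f = (\<Sum>x\<in>X. \<Sum>y\<in>Y. fscale (f (x, y)) (pure_tensor (cM x) (cN y)))"
    proof
      fix p :: "'x \<times> 'y"
      obtain a b where p: "p = (a, b)" by force
      show "f p = (\<Sum>x\<in>X. \<Sum>y\<in>Y. fscale (f (x, y)) (pure_tensor (cM x) (cN y))) p"
      proof (cases "a \<in> X \<and> b \<in> Y")
        case True
        then have "f (a, b) = (\<Sum>x\<in>X. \<Sum>y\<in>Y. M a x * N b y * f (x, y))"
          using f by (auto simp: S_iff)
        then show ?thesis using True
          by (simp add: p sum_fun_apply pure_tensor_def cM_def cN_def mult_ac)
      next
        case False
        then have "f (a, b) = 0" using f by (auto simp: S_iff)
        then show ?thesis using False
          by (auto simp: p sum_fun_apply pure_tensor_def cM_def cN_def)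
      qed
    qed
    moreover have "(\<Sum>x\<in>X. \<Sum>y\<in>Y. fscale (f (x, y)) (pure_tensor (cM x) (cN y))) \<in> rep_space (Tensor V W)"
      unfolding Tensor_def rep.select_convs
      by (intro fun_vs.span_sum fun_vs.span_scale fun_vs.span_base) (use c_in in blast)
    ultimately show "f \<in> rep_space (Tensor V W)" by simp
  qed
  show ?thesis
  proof
    show "finite (carrier (G \<times>\<times> H))" using V.finite_carrier W.finite_carrier by simp
    show "finite (X \<times> Y)" using V.finite_X W.finite_X by simp
    fix p q assume "p \<in> X \<times> Y" "q \<in> X \<times> Y"
    then obtain a b x y where pq: "p = (a, b)" "q = (x, y)" "a \<in> X" "b \<in> Y" "x \<in> X" "y \<in> Y"
      by auto
    have "(\<Sum>r\<in>X \<times> Y. (case p of (a, b) \<Rightarrow> \<lambda>(x, y). M a x * N b y) r *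
          (case r of (a, b) \<Rightarrow> \<lambda>(x, y). M a x * N b y) q) =
        (\<Sum>x'\<in>X. M a x' * M x' x) * (\<Sum>y'\<in>Y. N b y' * N y' y)"
      unfolding sum.cartesian_product' by (simp add: pq sum_product mult_ac)
    then show "(\<Sum>r\<in>X \<times> Y. (case p of (a, b) \<Rightarrow> \<lambda>(x, y). M a x * N b y) r *
          (case r of (a, b) \<Rightarrow> \<lambda>(x, y). M a x * N b y) q) =
        (case p of (a, b) \<Rightarrow> \<lambda>(x, y). M a x * N b y) q"
      using pq by (simp add: V.M_idem W.M_idem)
  next
    show "rep_space (Tensor V W) = {f. (\<forall>x. x \<notin> X \<times> Y \<longrightarrow> f x = 0) \<and> (\<forall>a\<in>X \<times> Y. f a =
        (\<Sum>x\<in>X \<times> Y. (\<lambda>(a, b) (x, y). M a x * N b y) a x * f x))}"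
      using sub1 sub2 unfolding S_def by blast
  next
    fix g f assume "g \<in> carrier (G \<times>\<times> H)"
    then show "rep_act (Tensor V W) g f =
        (\<lambda>x. if x \<in> X \<times> Y then f ((case g of (g, h) \<Rightarrow> \<lambda>(a, b). (\<pi> g a, \<rho> h b)) x) else 0)"
      by (auto simp: Tensor_def V.rep_act_W W.rep_act_W fun_eq_iff)
  qed (auto simp: V.pi_in W.pi_in V.pi_mult W.pi_mult V.pi_one W.pi_one V.M_equiv W.M_equiv)
qed

lemma char_Tensor:
  assumes V: "perm_rep G X \<pi> M V" and W: "perm_rep H Y \<rho> N W"
  shows "perm_rep.char (X \<times> Y) (\<lambda>(g, h) (a, b). (\<pi> g a, \<rho> h b)) (\<lambda>(a, b) (x, y). M a x * N b y) (g, h) =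
    perm_rep.char X \<pi> M g * perm_rep.char Y \<rho> N h"
  unfolding perm_rep.char_def[OF perm_rep_Tensor[OF V W]] perm_rep.char_def[OF V] perm_rep.char_def[OF W]
  by (simp add: sum_product sum.cartesian_product split_def)

lemma perm_rep_Res:
  assumes W: "perm_rep G X \<pi> M W" and H: "finite_group H" and \<phi>: "\<phi> \<in> hom H G"
  shows "perm_rep H X (\<lambda>h. \<pi> (\<phi> h)) M (Res \<phi> W)"
proof -
  interpret W: perm_rep G X \<pi> M W by (rule W)
  interpret H: finite_group H by (rule H)
  interpret group_hom H G \<phi> by unfold_locales (rule \<phi>)
  show ?thesis
  proof
    show "rep_space (Res \<phi> W) = {f. (\<forall>x. x \<notin> X \<longrightarrow> f x = 0) \<and> (\<forall>a\<in>X. f a = (\<Sum>x\<in>X. M a x * f x))}"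
      by (simp add: Res_def W.rep_space_W)
  qed (auto simp: W.finite_X W.pi_in W.pi_mult W.pi_one W.M_idem W.M_equiv Res_def W.rep_act_W)
qed

lemma subrep_cong:
  assumes "rep_space W = rep_space W'"
    and "\<And>g v. g \<in> carrier G \<Longrightarrow> v \<in> rep_space W \<Longrightarrow> rep_act W g v = rep_act W' g v"
  shows "subrep G U W \<longleftrightarrow> subrep G U W'"
  using assms by (auto simp: subrep_def subset_iff)

text \<open>Meant for \<open>Ind\<close>, which substitutes also at points whose second component
  lies outside \<open>X\<close>, where a permutation representation returns zero. Functions of the
  induced space vanish there, so the two actions agree on the space.\<close>

lemma multiplicity_rep_cong:
  assumes space: "rep_space W = rep_space W'"
    and act: "\<And>g v. g \<in> carrier G \<Longrightarrow> v \<in> rep_space W \<Longrightarrow> rep_act W g v = rep_act W' g v"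
  shows "multiplicity_rep G V W = multiplicity_rep G V W'"
proof -
  have irr: "irreducible_rep G (W\<lparr>rep_space := U\<rparr>) \<longleftrightarrow> irreducible_rep G (W'\<lparr>rep_space := U\<rparr>)"
    if "subrep G U W" for U
  proof -
    have "subrep G U' (W\<lparr>rep_space := U\<rparr>) \<longleftrightarrow> subrep G U' (W'\<lparr>rep_space := U\<rparr>)" for U'
      using that act by (intro subrep_cong) (auto simp: subrep_def)
    then show ?thesis by (simp add: irreducible_rep_def)
  qed
  have iso: "rep_iso G (W\<lparr>rep_space := U\<rparr>) V \<longleftrightarrow> rep_iso G (W'\<lparr>rep_space := U\<rparr>) V"
    if "subrep G U W" for U
  proof -
    have "\<And>g v. g \<in> carrier G \<Longrightarrow> v \<in> U \<Longrightarrow> rep_act W g v = rep_act W' g v"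
      using that act by (auto simp: subrep_def)
    then show ?thesis unfolding rep_iso_def by simp
  qed
  have "irreducible_decomposition G W k U \<longleftrightarrow> irreducible_decomposition G W' k U" for k U
    using irr subrep_cong[OF space act] by (auto simp: irreducible_decomposition_def space)
  moreover have "{i. i < k \<and> rep_iso G (W\<lparr>rep_space := U i\<rparr>) V} =
      {i. i < k \<and> rep_iso G (W'\<lparr>rep_space := U i\<rparr>) V}" if "irreducible_decomposition G W k U" for k U
    using that iso by (auto simp: irreducible_decomposition_def)
  ultimately have "irreducible_decomposition G W k U \<and>
        m = card {i. i < k \<and> rep_iso G (W\<lparr>rep_space := U i\<rparr>) V} \<longleftrightarrow>
      irreducible_decomposition G W' k U \<and>
        m = card {i. i < k \<and> rep_iso G (W'\<lparr>rep_space := U i\<rparr>) V}" for m k U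
    by (cases "irreducible_decomposition G W k U") simp_all
  then show ?thesis by (simp add: multiplicity_rep_def)
qed

text \<open>The matrix for \<open>Ind\<close> is the projection averaging the equivariance condition over \<open>H\<close>.\<close>

definition Ind_matrix :: "('h, 'n) monoid_scheme \<Rightarrow> ('g, 'm) monoid_scheme \<Rightarrow> ('h \<Rightarrow> 'g) \<Rightarrow>
    ('h \<Rightarrow> 'x \<Rightarrow> 'x) \<Rightarrow> ('x \<Rightarrow> 'x \<Rightarrow> complex) \<Rightarrow> 'g \<times> 'x \<Rightarrow> 'g \<times> 'x \<Rightarrow> complex" where
  "Ind_matrix H G \<phi> \<pi> M = (\<lambda>(g, a) (g', x).
     (\<Sum>k\<in>carrier H. if g \<otimes>\<^bsub>G\<^esub> \<phi> k = g' then M (\<pi> k a) x else 0) / of_nat (order H))"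

lemma perm_rep_Ind:
  assumes W: "perm_rep H X \<pi> M W" and G: "finite_group G" and \<phi>: "\<phi> \<in> hom H G"
  shows "perm_rep G (carrier G \<times> X) (\<lambda>g (g', x). (inv\<^bsub>G\<^esub> g \<otimes>\<^bsub>G\<^esub> g', x)) (Ind_matrix H G \<phi> \<pi> M)
    ((Ind H G \<phi> W)\<lparr>rep_act := \<lambda>g f p. if p \<in> carrier G \<times> X
      then f (case p of (g', x) \<Rightarrow> (inv\<^bsub>G\<^esub> g \<otimes>\<^bsub>G\<^esub> g', x)) else 0\<rparr>)"
    (is "perm_rep _ _ _ _ (?W\<lparr>rep_act := ?act\<rparr>)")
proof -
  interpret W: perm_rep H X \<pi> M W by (rule W)
  interpret G: finite_group G by (rule G)
  interpret group_hom H G \<phi> by unfold_locales (rule \<phi>)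
  let ?o = "of_nat (order H) :: complex"
  have ord: "?o \<noteq> 0" using W.finite_carrier W.order_gt_0_iff_finite by simp
  let ?Y = "carrier G \<times> X"
  define P where "P f = (\<lambda>(g, a). if g \<in> carrier G \<and> a \<in> X then
      (\<Sum>k\<in>carrier H. \<Sum>x\<in>X. M (\<pi> k a) x * f (g \<otimes>\<^bsub>G\<^esub> \<phi> k, x)) / ?o else 0)" for f
  have sum_matrix: "(\<Sum>x\<in>?Y. Ind_matrix H G \<phi> \<pi> M p x * f x) = P f p" if pY: "p \<in> ?Y" for p f
  proof -
    obtain g a where p: "p = (g, a)" "g \<in> carrier G" "a \<in> X" using pY by auto
    have "(\<Sum>x\<in>?Y. Ind_matrix H G \<phi> \<pi> M p x * f x) =
        (\<Sum>g'\<in>carrier G. \<Sum>x\<in>X. (\<Sum>k\<in>carrier H. if g \<otimes>\<^bsub>G\<^esub> \<phi> k = g' then M (\<pi> k a) x * f (g', x) else 0) / ?o)"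
      unfolding sum.cartesian_product by (intro sum.cong refl)
        (auto simp: Ind_matrix_def p sum_distrib_right sum_divide_distrib intro!: sum.cong)
    also have "\<dots> = (\<Sum>k\<in>carrier H. \<Sum>x\<in>X. \<Sum>g'\<in>carrier G.
        (if g \<otimes>\<^bsub>G\<^esub> \<phi> k = g' then M (\<pi> k a) x * f (g', x) else 0)) / ?o"
      unfolding sum_divide_distrib[symmetric]
      by (intro arg_cong2[where f="(/)"] refl)
         (subst sum.swap, subst (2) sum.swap, subst sum.swap, simp)
    also have "\<dots> = P f p"
      using p G.finite_carrier by (simp add: P_def)
    finally show ?thesis .
  qed
  have P_in: "P f \<in> rep_space (Ind H G \<phi> W)" for f
  proof -
    have "(\<lambda>x. P f (g, x)) \<in> rep_space W" if g: "g \<in> carrier G" for g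
    proof -
      have "P f (g, a) = (\<Sum>b\<in>X. M a b * P f (g, b))" if a: "a \<in> X" for a
      proof -
        have "(\<Sum>b\<in>X. M a b * P f (g, b)) = (\<Sum>b\<in>X. \<Sum>k\<in>carrier H. \<Sum>x\<in>X.
            M a b * M (\<pi> k b) x * f (g \<otimes>\<^bsub>G\<^esub> \<phi> k, x)) / ?o"
          using g by (simp add: P_def sum_distrib_left sum_divide_distrib mult.assoc)
        also have "\<dots> = (\<Sum>k\<in>carrier H. \<Sum>x\<in>X. \<Sum>b\<in>X.
            M a b * M (\<pi> k b) x * f (g \<otimes>\<^bsub>G\<^esub> \<phi> k, x)) / ?o"
          by (subst sum.swap, subst (2) sum.swap) simp
        also have "\<dots> = (\<Sum>k\<in>carrier H. \<Sum>x\<in>X. M (\<pi> k a) x * f (g \<otimes>\<^bsub>G\<^esub> \<phi> k, x)) / ?o"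
        proof (intro arg_cong2[where f="(/)"] sum.cong refl)
          fix k x assume k: "k \<in> carrier H" and x: "x \<in> X"
          have "(\<Sum>b\<in>X. M a b * M (\<pi> k b) x) = (\<Sum>b\<in>X. M (\<pi> k a) (\<pi> k b) * M (\<pi> k b) x)"
            using a k by (intro sum.cong refl) (simp add: W.M_equiv)
          also have "\<dots> = M (\<pi> k a) x"
            using W.sum_pi[OF k, of "\<lambda>b. M (\<pi> k a) b * M b x"] a k x by (simp add: W.M_idem W.pi_in)
          finally show "(\<Sum>b\<in>X. M a b * M (\<pi> k b) x * f (g \<otimes>\<^bsub>G\<^esub> \<phi> k, x)) = M (\<pi> k a) x * f (g \<otimes>\<^bsub>G\<^esub> \<phi> k, x)"
            by (simp add: sum_distrib_right[symmetric])
        qed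
        finally show ?thesis using g a by (simp add: P_def)
      qed
      then show ?thesis by (auto simp: W.rep_space_W P_def)
    qed
    moreover have "(\<lambda>x. P f (g \<otimes>\<^bsub>G\<^esub> \<phi> h, x)) = rep_act W (inv\<^bsub>H\<^esub> h) (\<lambda>x. P f (g, x))"
      if g: "g \<in> carrier G" and h: "h \<in> carrier H" for g h
    proof
      fix a
      show "P f (g \<otimes>\<^bsub>G\<^esub> \<phi> h, a) = rep_act W (inv\<^bsub>H\<^esub> h) (\<lambda>x. P f (g, x)) a"
      proof (cases "a \<in> X")
        case a: True
        have "(\<Sum>k\<in>carrier H. \<Sum>x\<in>X. M (\<pi> k a) x * f (g \<otimes>\<^bsub>G\<^esub> \<phi> h \<otimes>\<^bsub>G\<^esub> \<phi> k, x)) =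
            (\<Sum>k\<in>carrier H. \<Sum>x\<in>X. M (\<pi> (inv\<^bsub>H\<^esub> h \<otimes>\<^bsub>H\<^esub> (h \<otimes>\<^bsub>H\<^esub> k)) a) x * f (g \<otimes>\<^bsub>G\<^esub> \<phi> (h \<otimes>\<^bsub>H\<^esub> k), x))"
          using g h by (intro sum.cong refl) (simp add: W.m_assoc[symmetric] G.m_assoc)
        also have "\<dots> = (\<Sum>k\<in>carrier H. \<Sum>x\<in>X. M (\<pi> (inv\<^bsub>H\<^esub> h \<otimes>\<^bsub>H\<^esub> k) a) x * f (g \<otimes>\<^bsub>G\<^esub> \<phi> k, x))"
          by (rule W.sum_mult_left[OF h])
        also have "\<dots> = (\<Sum>k\<in>carrier H. \<Sum>x\<in>X. M (\<pi> k (\<pi> (inv\<^bsub>H\<^esub> h) a)) x * f (g \<otimes>\<^bsub>G\<^esub> \<phi> k, x))"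
          using h a by (simp add: W.pi_mult)
        finally show ?thesis using a g h by (simp add: P_def W.rep_act_W W.pi_in)
      qed (use h in \<open>simp add: P_def W.rep_act_W\<close>)
    qed
    ultimately show ?thesis by (simp add: Ind_def) (simp add: P_def)
  qed
  have P_fix: "P f p = f p" if f: "f \<in> rep_space (Ind H G \<phi> W)" and p: "p \<in> ?Y" for f p
  proof -
    obtain g a where ga: "p = (g, a)" "g \<in> carrier G" "a \<in> X" using p by auto
    have "(\<Sum>x\<in>X. M (\<pi> k a) x * f (g \<otimes>\<^bsub>G\<^esub> \<phi> k, x)) = f (g, a)" if k: "k \<in> carrier H" for k
    proof -
      have in_W: "(\<lambda>x. f (g \<otimes>\<^bsub>G\<^esub> \<phi> k, x)) \<in> rep_space W"
        using f ga k by (simp add: Ind_def W.rep_act_in)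
      have "(\<Sum>x\<in>X. M (\<pi> k a) x * f (g \<otimes>\<^bsub>G\<^esub> \<phi> k, x)) = f (g \<otimes>\<^bsub>G\<^esub> \<phi> k, \<pi> k a)"
        using in_W ga k by (simp add: W.rep_space_W W.pi_in)
      also have "\<dots> = rep_act W (inv\<^bsub>H\<^esub> k) (\<lambda>x. f (g, x)) (\<pi> k a)"
        using f ga k by (simp add: Ind_def fun_eq_iff)
      also have "\<dots> = f (g, a)" using ga k by (simp add: W.rep_act_W W.pi_in W.pi_inv_right)
      finally show ?thesis .
    qed
    then show ?thesis using ga ord by (simp add: P_def order_def)
  qed
  have f_supp: "f x = 0" if "f \<in> rep_space (Ind H G \<phi> W)" "x \<notin> ?Y" for f x
    using that by (cases x) (auto simp: Ind_def W.rep_space_W)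
  have space: "f \<in> rep_space (Ind H G \<phi> W) \<longleftrightarrow> (\<forall>x. x \<notin> ?Y \<longrightarrow> f x = 0) \<and>
      (\<forall>a\<in>?Y. f a = (\<Sum>x\<in>?Y. Ind_matrix H G \<phi> \<pi> M a x * f x))" for f
  proof
    assume "f \<in> rep_space (Ind H G \<phi> W)"
    then show "(\<forall>x. x \<notin> ?Y \<longrightarrow> f x = 0) \<and>
      (\<forall>a\<in>?Y. f a = (\<Sum>x\<in>?Y. Ind_matrix H G \<phi> \<pi> M a x * f x))"
      using f_supp P_fix by (simp add: sum_matrix del: mem_Sigma_iff)
  next
    assume f: "(\<forall>x. x \<notin> ?Y \<longrightarrow> f x = 0) \<and>
      (\<forall>a\<in>?Y. f a = (\<Sum>x\<in>?Y. Ind_matrix H G \<phi> \<pi> M a x * f x))"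
    have "f = P f"
    proof
      fix p show "f p = P f p"
      proof (cases "p \<in> ?Y")
        case True then show ?thesis using f sum_matrix[OF True, of f] by metis
      next
        case False then show ?thesis using f by (cases p) (auto simp: P_def)
      qed
    qed
    then show "f \<in> rep_space (Ind H G \<phi> W)" using P_in by metis
  qed
  show ?thesis
  proof
    show "finite ?Y" using G.finite_carrier W.finite_X by simp
    fix p q assume p: "p \<in> ?Y" and q: "q \<in> ?Y"
    \<comment> \<open>The column of the matrix at \<open>q\<close> is the image of a unit vector,
      hence lies in the induced space, on which the matrix acts as the identity. This is
      idempotence.\<close>
    define f where "f = P (\<lambda>x. if x = q then 1 else 0)"
    have f: "f x = Ind_matrix H G \<phi> \<pi> M x q" if "x \<in> ?Y" for x
    proof -
      have "f x = (\<Sum>y\<in>?Y. Ind_matrix H G \<phi> \<pi> M x y * (if y = q then 1 else 0))"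
        unfolding f_def by (rule sum_matrix[OF that, symmetric])
      then show ?thesis using q G.finite_carrier W.finite_X
        by (simp add: if_distrib[of "\<lambda>c. _ * c"] del: mem_Sigma_iff cong: if_cong)
    qed
    have "f p = (\<Sum>x\<in>?Y. Ind_matrix H G \<phi> \<pi> M p x * f x)"
      using P_in[of "\<lambda>x. if x = q then 1 else 0", folded f_def] p unfolding space by blast
    then show "(\<Sum>y\<in>?Y. Ind_matrix H G \<phi> \<pi> M p y * Ind_matrix H G \<phi> \<pi> M y q) = Ind_matrix H G \<phi> \<pi> M p q"
      using f p by (simp del: mem_Sigma_iff)
  next
    fix g p q assume g: "g \<in> carrier G" and "p \<in> ?Y" "q \<in> ?Y"
    then obtain h a k x where pq: "p = (h, a)" "q = (k, x)" "h \<in> carrier G" "k \<in> carrier G" by auto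
    have "inv\<^bsub>G\<^esub> g \<otimes>\<^bsub>G\<^esub> h \<otimes>\<^bsub>G\<^esub> \<phi> l = inv\<^bsub>G\<^esub> g \<otimes>\<^bsub>G\<^esub> k \<longleftrightarrow> h \<otimes>\<^bsub>G\<^esub> \<phi> l = k" if "l \<in> carrier H" for l
      using that g pq by (simp add: G.m_assoc)
    then show "Ind_matrix H G \<phi> \<pi> M ((case p of (g', x) \<Rightarrow> (inv\<^bsub>G\<^esub> g \<otimes>\<^bsub>G\<^esub> g', x)))
        ((case q of (g', x) \<Rightarrow> (inv\<^bsub>G\<^esub> g \<otimes>\<^bsub>G\<^esub> g', x))) = Ind_matrix H G \<phi> \<pi> M p q"
      by (simp add: Ind_matrix_def pq cong: sum.cong)
  next
    show "rep_space (?W\<lparr>rep_act := ?act\<rparr>) = {f. (\<forall>x. x \<notin> ?Y \<longrightarrow> f x = 0) \<and>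
      (\<forall>a\<in>?Y. f a = (\<Sum>x\<in>?Y. Ind_matrix H G \<phi> \<pi> M a x * f x))}"
      using space by auto
  next
    fix g f assume "g \<in> carrier G"
    show "rep_act (?W\<lparr>rep_act := ?act\<rparr>) g f =
        (\<lambda>x. if x \<in> ?Y then f (case x of (g', x) \<Rightarrow> (inv\<^bsub>G\<^esub> g \<otimes>\<^bsub>G\<^esub> g', x)) else 0)"
      by simp
  qed (auto simp: G.inv_mult_group G.m_assoc)
qed

lemma (in finite_group) char_ideal_rep:
  assumes e: "primitive_idempotent e" and g: "g \<in> carrier G"
  shows "perm_rep.char (carrier G) (\<lambda>g x. inv g \<otimes> x) (\<lambda>a x. e (inv x \<otimes> a)) g = ideal_char e g"
  unfolding perm_rep.char_def[OF perm_rep_ideal_rep[OF e]] ideal_char_def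
  using g by (simp add: m_assoc)

section \<open>Inner products with class functions and Frobenius reciprocity\<close>

lemma (in finite_group) ideal_char_conj:
  assumes g: "g \<in> carrier G" and h: "h \<in> carrier G"
  shows "ideal_char e (h \<otimes> g \<otimes> inv h) = ideal_char e g"
proof -
  have "ideal_char e (h \<otimes> g \<otimes> inv h) = (\<Sum>x\<in>carrier G. e (inv (h \<otimes> x) \<otimes> inv (h \<otimes> g \<otimes> inv h) \<otimes> (h \<otimes> x)))"
    unfolding ideal_char_def by (rule sum_mult_left[OF h, symmetric])
  also have "\<dots> = ideal_char e g"
    unfolding ideal_char_def
  proof (rule sum.cong[OF refl])
    fix x assume x: "x \<in> carrier G"
    have "inv h \<otimes> (h \<otimes> y) = y" if "y \<in> carrier G" for y
      using h that by (simp add: m_assoc[symmetric])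
    then have "inv (h \<otimes> x) \<otimes> inv (h \<otimes> g \<otimes> inv h) \<otimes> (h \<otimes> x) = inv x \<otimes> inv g \<otimes> x"
      using g h x by (simp add: inv_mult_group m_assoc)
    then show "e (inv (h \<otimes> x) \<otimes> inv (h \<otimes> g \<otimes> inv h) \<otimes> (h \<otimes> x)) = e (inv x \<otimes> inv g \<otimes> x)"
      using g h x by simp
  qed
  finally show ?thesis .
qed

text \<open>\<open>ideal_char e (inv g)\<close> sums \<open>e\<close> over the conjugates of
  \<open>g\<close>. A class function gives the same weight to all of them, so each conjugation
  contributes the same sum.\<close>

lemma (in finite_group) sum_ideal_char_inv:
  assumes cls: "\<And>g h. g \<in> carrier G \<Longrightarrow> h \<in> carrier G \<Longrightarrow> \<chi> (h \<otimes> g \<otimes> inv h) = \<chi> g"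
  shows "(\<Sum>g\<in>carrier G. ideal_char e (inv g) * \<chi> g) = of_nat (order G) * (\<Sum>g\<in>carrier G. e g * \<chi> g)"
proof -
  have "(\<Sum>g\<in>carrier G. ideal_char e (inv g) * \<chi> g) =
      (\<Sum>x\<in>carrier G. \<Sum>g\<in>carrier G. e (inv x \<otimes> g \<otimes> x) * \<chi> g)"
    by (subst sum.swap) (simp add: ideal_char_def sum_distrib_right)
  also have "\<dots> = (\<Sum>x\<in>carrier G. \<Sum>g\<in>carrier G. e g * \<chi> g)"
  proof (rule sum.cong[OF refl])
    fix x assume x: "x \<in> carrier G"
    have "(\<Sum>g\<in>carrier G. e (inv x \<otimes> g \<otimes> x) * \<chi> g) =
        (\<Sum>g\<in>carrier G. e (inv x \<otimes> (x \<otimes> g) \<otimes> x) * \<chi> (x \<otimes> g))"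
      by (rule sum_mult_left[OF x, symmetric])
    also have "\<dots> = (\<Sum>g\<in>carrier G. e (g \<otimes> x) * \<chi> (x \<otimes> g))"
      using x by (simp add: m_assoc[symmetric])
    also have "\<dots> = (\<Sum>g\<in>carrier G. e (g \<otimes> inv x \<otimes> x) * \<chi> (x \<otimes> (g \<otimes> inv x)))"
      by (rule sum_mult_right[symmetric]) (use x in simp)
    also have "\<dots> = (\<Sum>g\<in>carrier G. e g * \<chi> g)"
      by (rule sum.cong[OF refl], rule arg_cong2[where f="(*)"])
         (use x cls in \<open>simp_all add: m_assoc[of _ "inv x" x] m_assoc[of x _ "inv x", symmetric]\<close>)
    finally show "(\<Sum>g\<in>carrier G. e (inv x \<otimes> g \<otimes> x) * \<chi> g) = (\<Sum>g\<in>carrier G. e g * \<chi> g)" .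
  qed
  also have "\<dots> = of_nat (order G) * (\<Sum>g\<in>carrier G. e g * \<chi> g)"
    by (simp add: order_def)
  finally show ?thesis .
qed

theorem (in finite_group) multiplicity_class_function:
  assumes e: "primitive_idempotent e" and W: "perm_rep G X \<pi> M W"
    and \<chi>: "\<And>g. g \<in> carrier G \<Longrightarrow> perm_rep.char X \<pi> M g = \<chi> g"
    and cls: "\<And>g h. g \<in> carrier G \<Longrightarrow> h \<in> carrier G \<Longrightarrow> \<chi> (h \<otimes> g \<otimes> inv h) = \<chi> g"
  shows "of_nat (order G) * of_nat (multiplicity_rep G (ideal_rep e) W) =
    (\<Sum>g\<in>carrier G. ideal_char e (inv g) * \<chi> g)"
  using \<chi> perm_rep.multiplicity_ideal_rep[OF W e] sum_ideal_char_inv[of \<chi> e, OF cls] by simp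

lemma sum_swap_outer_inner:
  "(\<Sum>g\<in>A. \<Sum>h\<in>B. \<Sum>x\<in>C. \<Sum>k\<in>D. f g h x k) = (\<Sum>k\<in>D. \<Sum>h\<in>B. \<Sum>x\<in>C. \<Sum>g\<in>A. f g h x k)"
proof -
  have "(\<Sum>g\<in>A. \<Sum>h\<in>B. \<Sum>x\<in>C. \<Sum>k\<in>D. f g h x k) = (\<Sum>h\<in>B. \<Sum>g\<in>A. \<Sum>x\<in>C. \<Sum>k\<in>D. f g h x k)"
    by (rule sum.swap)
  also have "\<dots> = (\<Sum>h\<in>B. \<Sum>x\<in>C. \<Sum>g\<in>A. \<Sum>k\<in>D. f g h x k)"
    by (rule sum.cong[OF refl], rule sum.swap)
  also have "\<dots> = (\<Sum>h\<in>B. \<Sum>x\<in>C. \<Sum>k\<in>D. \<Sum>g\<in>A. f g h x k)"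
    by (rule sum.cong[OF refl], rule sum.cong[OF refl], rule sum.swap)
  also have "\<dots> = (\<Sum>h\<in>B. \<Sum>k\<in>D. \<Sum>x\<in>C. \<Sum>g\<in>A. f g h x k)"
    by (rule sum.cong[OF refl], rule sum.swap)
  also have "\<dots> = (\<Sum>k\<in>D. \<Sum>h\<in>B. \<Sum>x\<in>C. \<Sum>g\<in>A. f g h x k)"
    by (rule sum.swap)
  finally show ?thesis .
qed

text \<open>Frobenius reciprocity read off from traces: in the averaging matrix \<open>k\<close>
  contributes to the diagonal at \<open>h\<close> exactly when \<open>g\<close> is the conjugate of
  \<open>\<phi> k\<close> by \<open>h\<close>, and summing \<open>e\<close> over these conjugates
  gives the character of \<open>A e\<close>.\<close>

theorem multiplicity_Ind:
  assumes W: "perm_rep H X \<pi> M W" and G: "finite_group G" and \<phi>: "\<phi> \<in> hom H G"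
    and e: "finite_group.primitive_idempotent G e"
    and \<chi>: "\<And>k. k \<in> carrier H \<Longrightarrow> perm_rep.char X \<pi> M k = \<chi> k"
  shows "of_nat (order H) * of_nat (multiplicity_rep G (finite_group.ideal_rep G e) (Ind H G \<phi> W)) =
    (\<Sum>k\<in>carrier H. finite_group.ideal_char G e (inv\<^bsub>G\<^esub> \<phi> k) * \<chi> k)"
proof -
  interpret W: perm_rep H X \<pi> M W by (rule W)
  interpret G: finite_group G by (rule G)
  interpret group_hom H G \<phi> by unfold_locales (rule \<phi>)
  interpret I: perm_rep G "carrier G \<times> X" "\<lambda>g (g', x). (inv\<^bsub>G\<^esub> g \<otimes>\<^bsub>G\<^esub> g', x)"
    "Ind_matrix H G \<phi> \<pi> M" "(Ind H G \<phi> W)\<lparr>rep_act := \<lambda>g f p. if p \<in> carrier G \<times> X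
      then f (case p of (g', x) \<Rightarrow> (inv\<^bsub>G\<^esub> g \<otimes>\<^bsub>G\<^esub> g', x)) else 0\<rparr>"
    by (rule perm_rep_Ind[OF W G \<phi>])
  let ?o = "of_nat (order H) :: complex"
  have ord: "?o \<noteq> 0" using W.finite_carrier W.order_gt_0_iff_finite by simp
  have "multiplicity_rep G (G.ideal_rep e) (Ind H G \<phi> W) = multiplicity_rep G (G.ideal_rep e)
      ((Ind H G \<phi> W)\<lparr>rep_act := \<lambda>g f p. if p \<in> carrier G \<times> X
        then f (case p of (g', x) \<Rightarrow> (inv\<^bsub>G\<^esub> g \<otimes>\<^bsub>G\<^esub> g', x)) else 0\<rparr>)"
  proof (rule multiplicity_rep_cong)
    fix g f assume g: "g \<in> carrier G" and f: "f \<in> rep_space (Ind H G \<phi> W)"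
    have "f (h, x) = 0" if "h \<in> carrier G" "x \<notin> X" for h x
      using f that by (simp add: Ind_def W.rep_space_W)
    then show "rep_act (Ind H G \<phi> W) g f = rep_act ((Ind H G \<phi> W)\<lparr>rep_act := \<lambda>g f p. if p \<in> carrier G \<times> X
        then f (case p of (g', x) \<Rightarrow> (inv\<^bsub>G\<^esub> g \<otimes>\<^bsub>G\<^esub> g', x)) else 0\<rparr>) g f"
      using g by (auto simp: Ind_def fun_eq_iff)
  qed simp
  then have "?o * of_nat (multiplicity_rep G (G.ideal_rep e) (Ind H G \<phi> W)) =
      ?o * (\<Sum>g\<in>carrier G. e g * I.char g)"
    by (simp add: I.multiplicity_ideal_rep[OF e])
  also have "\<dots> = (\<Sum>g\<in>carrier G. \<Sum>h\<in>carrier G. \<Sum>x\<in>X. \<Sum>k\<in>carrier H.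
      if inv\<^bsub>G\<^esub> g \<otimes>\<^bsub>G\<^esub> h \<otimes>\<^bsub>G\<^esub> \<phi> k = h then e g * M (\<pi> k x) x else 0)"
  proof -
    have "I.char g = (\<Sum>h\<in>carrier G. \<Sum>x\<in>X. \<Sum>k\<in>carrier H.
        if inv\<^bsub>G\<^esub> g \<otimes>\<^bsub>G\<^esub> h \<otimes>\<^bsub>G\<^esub> \<phi> k = h then M (\<pi> k x) x else 0) / ?o" for g
      unfolding I.char_def sum.cartesian_product' by (simp add: Ind_matrix_def sum_divide_distrib)
    then have "?o * (e g * I.char g) = e g * (\<Sum>h\<in>carrier G. \<Sum>x\<in>X. \<Sum>k\<in>carrier H.
        if inv\<^bsub>G\<^esub> g \<otimes>\<^bsub>G\<^esub> h \<otimes>\<^bsub>G\<^esub> \<phi> k = h then M (\<pi> k x) x else 0)" for g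
      using ord by simp
    then show ?thesis by (simp add: sum_distrib_left if_distrib cong: if_cong)
  qed
  also have "\<dots> = (\<Sum>k\<in>carrier H. \<Sum>h\<in>carrier G. \<Sum>x\<in>X. \<Sum>g\<in>carrier G.
      if g = h \<otimes>\<^bsub>G\<^esub> \<phi> k \<otimes>\<^bsub>G\<^esub> inv\<^bsub>G\<^esub> h then e g * M (\<pi> k x) x else 0)"
  proof -
    have eq: "inv\<^bsub>G\<^esub> g \<otimes>\<^bsub>G\<^esub> h \<otimes>\<^bsub>G\<^esub> \<phi> k = h \<longleftrightarrow> g = h \<otimes>\<^bsub>G\<^esub> \<phi> k \<otimes>\<^bsub>G\<^esub> inv\<^bsub>G\<^esub> h"
      if "g \<in> carrier G" "h \<in> carrier G" "k \<in> carrier H" for g h k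
    proof -
      have "inv\<^bsub>G\<^esub> g \<otimes>\<^bsub>G\<^esub> h \<otimes>\<^bsub>G\<^esub> \<phi> k = inv\<^bsub>G\<^esub> g \<otimes>\<^bsub>G\<^esub> (h \<otimes>\<^bsub>G\<^esub> \<phi> k)"
        using that by (intro G.m_assoc) auto
      moreover have "inv\<^bsub>G\<^esub> g \<otimes>\<^bsub>G\<^esub> (h \<otimes>\<^bsub>G\<^esub> \<phi> k) = h \<longleftrightarrow> h \<otimes>\<^bsub>G\<^esub> \<phi> k = g \<otimes>\<^bsub>G\<^esub> h"
        using that by (intro G.inv_solve_left') auto
      moreover have "g = h \<otimes>\<^bsub>G\<^esub> \<phi> k \<otimes>\<^bsub>G\<^esub> inv\<^bsub>G\<^esub> h \<longleftrightarrow> h \<otimes>\<^bsub>G\<^esub> \<phi> k = g \<otimes>\<^bsub>G\<^esub> h"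
        using that by (intro G.inv_solve_right) auto
      ultimately show ?thesis by (simp only:)
    qed
    have "(\<Sum>g\<in>carrier G. \<Sum>h\<in>carrier G. \<Sum>x\<in>X. \<Sum>k\<in>carrier H.
        if inv\<^bsub>G\<^esub> g \<otimes>\<^bsub>G\<^esub> h \<otimes>\<^bsub>G\<^esub> \<phi> k = h then e g * M (\<pi> k x) x else 0) =
      (\<Sum>g\<in>carrier G. \<Sum>h\<in>carrier G. \<Sum>x\<in>X. \<Sum>k\<in>carrier H.
        if g = h \<otimes>\<^bsub>G\<^esub> \<phi> k \<otimes>\<^bsub>G\<^esub> inv\<^bsub>G\<^esub> h then e g * M (\<pi> k x) x else 0)"
      using eq by (intro sum.cong refl if_cong) auto
    also have "\<dots> = (\<Sum>k\<in>carrier H. \<Sum>h\<in>carrier G. \<Sum>x\<in>X. \<Sum>g\<in>carrier G.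
        if g = h \<otimes>\<^bsub>G\<^esub> \<phi> k \<otimes>\<^bsub>G\<^esub> inv\<^bsub>G\<^esub> h then e g * M (\<pi> k x) x else 0)"
      by (rule sum_swap_outer_inner)
    finally show ?thesis .
  qed
  also have "\<dots> = (\<Sum>k\<in>carrier H. (\<Sum>h\<in>carrier G. e (h \<otimes>\<^bsub>G\<^esub> \<phi> k \<otimes>\<^bsub>G\<^esub> inv\<^bsub>G\<^esub> h)) * \<chi> k)"
    using G.finite_carrier \<chi>
    by (intro sum.cong refl) (simp add: W.char_def[symmetric] sum_distrib_left[symmetric] sum_distrib_right)
  also have "\<dots> = (\<Sum>k\<in>carrier H. G.ideal_char e (inv\<^bsub>G\<^esub> \<phi> k) * \<chi> k)"
  proof (intro sum.cong refl arg_cong2[where f="(*)"])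
    fix k assume k: "k \<in> carrier H"
    have "(\<Sum>h\<in>carrier G. e (h \<otimes>\<^bsub>G\<^esub> \<phi> k \<otimes>\<^bsub>G\<^esub> inv\<^bsub>G\<^esub> h)) =
        (\<Sum>h\<in>carrier G. e (inv\<^bsub>G\<^esub> h \<otimes>\<^bsub>G\<^esub> \<phi> k \<otimes>\<^bsub>G\<^esub> inv\<^bsub>G\<^esub> (inv\<^bsub>G\<^esub> h)))"
      by (rule G.sum_inv[symmetric])
    then show "(\<Sum>h\<in>carrier G. e (h \<otimes>\<^bsub>G\<^esub> \<phi> k \<otimes>\<^bsub>G\<^esub> inv\<^bsub>G\<^esub> h)) = G.ideal_char e (inv\<^bsub>G\<^esub> \<phi> k)"
      using k by (simp add: G.ideal_char_def)
  qed
  finally show ?thesis .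
qed

context finite_group
begin

text \<open>\<open>left_translation G h e\<close> is the product of the unit mass at
  \<open>h\<close> with \<open>e\<close>. The right side is therefore the trace of
  \<open>y \<mapsto> z y e\<close> on the whole group algebra, computed on unit masses.\<close>

lemma sum_mult_ideal_char:
  "(\<Sum>g\<in>carrier G. z g * ideal_char e g) = (\<Sum>h\<in>carrier G. conv G z (left_translation G h e) h)"
proof -
  have "(\<Sum>g\<in>carrier G. z g * ideal_char e g) =
      (\<Sum>h\<in>carrier G. \<Sum>g\<in>carrier G. z g * e (inv h \<otimes> inv g \<otimes> h))"
    by (subst sum.swap) (simp add: ideal_char_def sum_distrib_left)
  also have "\<dots> = (\<Sum>h\<in>carrier G. conv G z (left_translation G h e) h)"
    by (simp add: conv_def left_translation_def m_assoc)
  finally show ?thesis .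
qed

text \<open>Multiplication by \<open>z\<close> maps the ideal into the line of \<open>e\<close>, so
  its trace is its eigenvalue on \<open>e\<close>. Expanding one factor of
  \<open>z e = z e e\<close> into translates of \<open>e\<close> expresses this eigenvalue through
  the scalars \<open>l' h\<close>.\<close>

lemma sum_mult_ideal_char_eq:
  assumes e: "primitive_idempotent e"
    and l: "\<And>h. h \<in> carrier G \<Longrightarrow> \<exists>l. conv G z (left_translation G h e) = fscale l e"
    and m: "conv G z e = fscale m e"
  shows "(\<Sum>g\<in>carrier G. z g * ideal_char e g) = m"
proof -
  have ee: "conv G e e = e" and "e \<noteq> 0" using e by (auto simp: primitive_idempotent_def)
  from l obtain l' where l': "\<And>h. h \<in> carrier G \<Longrightarrow> conv G z (left_translation G h e) = fscale (l' h) e"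
    by metis
  have sum_conv: "conv G z (\<Sum>h\<in>I. f h) = (\<Sum>h\<in>I. conv G z (f h))" for I :: "'a set" and f
  proof
    fix g
    have "(\<Sum>k\<in>carrier G. \<Sum>h\<in>I. z k * f h (inv k \<otimes> g)) = (\<Sum>h\<in>I. \<Sum>k\<in>carrier G. z k * f h (inv k \<otimes> g))"
      by (rule sum.swap)
    then show "conv G z (\<Sum>h\<in>I. f h) g = (\<Sum>h\<in>I. conv G z (f h)) g"
      by (simp add: conv_def sum_fun_apply sum_distrib_left)
  qed
  have "fscale m e = conv G z (\<Sum>h\<in>carrier G. fscale (e h) (left_translation G h e))"
    using m ee conv_eq_sum_left_translation[of e e] by simp
  also have "\<dots> = (\<Sum>h\<in>carrier G. fscale (e h * l' h) e)"
    by (simp add: sum_conv conv_fscale_right l' fun_vs.scale_scale)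
  also have "\<dots> = fscale (\<Sum>h\<in>carrier G. e h * l' h) e"
    by (simp add: fun_vs.scale_sum_left)
  finally have eq: "fscale m e = fscale (\<Sum>h\<in>carrier G. e h * l' h) e" .
  obtain x where "e x \<noteq> 0" using \<open>e \<noteq> 0\<close> by (auto simp: fun_eq_iff)
  then have "m = (\<Sum>h\<in>carrier G. e h * l' h)" using fun_cong[OF eq, of x] by simp
  then show ?thesis by (simp add: sum_mult_ideal_char l' mult.commute)
qed

text \<open>Summing over conjugates is a trace on the group algebra. Applied to row and column sums
  it compares the two orders in which they can be multiplied.\<close>

lemma ideal_char_conv_commute:
  assumes g: "g \<in> carrier G"
  shows "ideal_char (conv G x y) g = ideal_char (conv G y x) g"
proof -
  have "ideal_char (conv G x y) g =
      (\<Sum>k\<in>carrier G. \<Sum>h\<in>carrier G. x k * y (inv k \<otimes> (inv h \<otimes> inv g \<otimes> h)))"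
    using g by (subst sum.swap) (simp add: ideal_char_def conv_def)
  also have "\<dots> = (\<Sum>k\<in>carrier G. \<Sum>h\<in>carrier G. x k * y (inv h \<otimes> inv g \<otimes> h \<otimes> inv k))"
  proof (rule sum.cong[OF refl])
    fix k assume k: "k \<in> carrier G"
    have "(\<Sum>h\<in>carrier G. x k * y (inv k \<otimes> (inv h \<otimes> inv g \<otimes> h))) =
        (\<Sum>h\<in>carrier G. x k * y (inv k \<otimes> (inv (h \<otimes> inv k) \<otimes> inv g \<otimes> (h \<otimes> inv k))))"
      by (rule sum_mult_right[symmetric]) (use k in simp)
    also have "\<dots> = (\<Sum>h\<in>carrier G. x k * y (inv h \<otimes> inv g \<otimes> h \<otimes> inv k))"
    proof (rule sum.cong[OF refl])
      fix h assume h: "h \<in> carrier G"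
      have "inv k \<otimes> (k \<otimes> z) = z" if "z \<in> carrier G" for z
        using k that by (simp add: m_assoc[symmetric])
      then have "inv k \<otimes> (inv (h \<otimes> inv k) \<otimes> inv g \<otimes> (h \<otimes> inv k)) = inv h \<otimes> inv g \<otimes> h \<otimes> inv k"
        using g h k by (simp add: inv_mult_group m_assoc)
      then show "x k * y (inv k \<otimes> (inv (h \<otimes> inv k) \<otimes> inv g \<otimes> (h \<otimes> inv k))) =
          x k * y (inv h \<otimes> inv g \<otimes> h \<otimes> inv k)" by simp
    qed
    finally show "(\<Sum>h\<in>carrier G. x k * y (inv k \<otimes> (inv h \<otimes> inv g \<otimes> h))) =
        (\<Sum>h\<in>carrier G. x k * y (inv h \<otimes> inv g \<otimes> h \<otimes> inv k))" .
  qed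
  also have "\<dots> = (\<Sum>h\<in>carrier G. conv G y x (inv h \<otimes> inv g \<otimes> h))"
  proof (subst sum.swap, rule sum.cong[OF refl])
    fix h assume h: "h \<in> carrier G"
    define u where "u = inv h \<otimes> inv g \<otimes> h"
    have u: "u \<in> carrier G" using g h by (simp add: u_def)
    have "conv G y x u = (\<Sum>m\<in>carrier G. y m * x (inv m \<otimes> u))"
      using u by (simp add: conv_def)
    also have "\<dots> = (\<Sum>m\<in>carrier G. y (u \<otimes> m) * x (inv (u \<otimes> m) \<otimes> u))"
      by (rule sum_mult_left[OF u, symmetric])
    also have "\<dots> = (\<Sum>m\<in>carrier G. y (u \<otimes> m) * x (inv m))"
      using u by (intro sum.cong refl) (simp add: inv_mult_group m_assoc)
    also have "\<dots> = (\<Sum>m\<in>carrier G. y (u \<otimes> inv m) * x (inv (inv m)))"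
      by (rule sum_inv[symmetric])
    also have "\<dots> = (\<Sum>k\<in>carrier G. x k * y (u \<otimes> inv k))"
      by (intro sum.cong refl) (simp add: mult.commute)
    finally show "(\<Sum>k\<in>carrier G. x k * y (inv h \<otimes> inv g \<otimes> h \<otimes> inv k)) = conv G y x (inv h \<otimes> inv g \<otimes> h)"
      by (simp add: u_def)
  qed
  also have "\<dots> = ideal_char (conv G y x) g" by (simp add: ideal_char_def)
  finally show ?thesis .
qed

end

section \<open>Young tableaux\<close>

definition psum :: "(nat \<Rightarrow> nat) \<Rightarrow> nat \<Rightarrow> nat" where
  "psum lam i = (\<Sum>j<i. lam j)"

lemma card_filter: "finite A \<Longrightarrow> card {x\<in>A. P x} = (\<Sum>x\<in>A. if P x then 1 else 0)"
  by (simp only: card_eq_sum sum.inter_filter)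

lemma psum_mono: "i \<le> j \<Longrightarrow> psum lam i \<le> psum lam j"
  unfolding psum_def by (rule sum_mono2) auto

lemma psum_Suc: "psum lam (Suc i) = psum lam i + lam i"
  by (simp add: psum_def)

lemma psum_eq_psize:
  assumes "\<forall>i\<ge>N. lam i = 0"
  shows "psum lam N = psize lam"
proof -
  have "{i. lam i \<noteq> 0} \<subseteq> {..<N}" using assms by (auto intro: ccontr simp: not_less)
  then show ?thesis unfolding psum_def psize_def by (intro sum.mono_neutral_right) auto
qed

lemma partition_bounded:
  assumes "is_partition lam"
  obtains N where "\<forall>i\<ge>N. lam i = 0"
proof -
  have "finite {i. lam i \<noteq> 0}" using assms by (simp add: is_partition_def)
  then obtain N where "\<forall>i\<in>{i. lam i \<noteq> 0}. i < N" using finite_nat_set_iff_bounded by blast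
  then show thesis by (intro that[of N]) (auto intro: ccontr)
qed

lemma tab_row_eqI:
  assumes "psum lam i < k" "k \<le> psum lam (Suc i)"
  shows "tab_row lam k = i"
  unfolding tab_row_def
proof (rule Least_equality)
  show "k \<le> (\<Sum>j\<le>i. lam j)" using assms(2) by (simp add: psum_def lessThan_Suc_atMost)
next
  fix y assume "k \<le> (\<Sum>j\<le>y. lam j)"
  then have "k \<le> psum lam (Suc y)" by (simp add: psum_def lessThan_Suc_atMost)
  then show "i \<le> y" using assms(1) psum_mono[of "Suc y" i lam] by (rule_tac ccontr) auto
qed

lemma cell_position:
  assumes "1 \<le> j" "j \<le> lam i"
  shows "tab_row lam (psum lam i + j) = i" "tab_col lam (psum lam i + j) = j"
proof -
  show row: "tab_row lam (psum lam i + j) = i"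
    using assms by (intro tab_row_eqI) (auto simp: psum_Suc)
  show "tab_col lam (psum lam i + j) = j"
    by (simp add: tab_col_def row psum_def[symmetric])
qed

lemma position_cell:
  assumes part: "is_partition lam" and k: "k \<in> {1..psize lam}"
  shows "1 \<le> tab_col lam k" "tab_col lam k \<le> lam (tab_row lam k)"
    "k = psum lam (tab_row lam k) + tab_col lam k"
proof -
  obtain N where N: "\<forall>i\<ge>N. lam i = 0" by (rule partition_bounded[OF part])
  have "k \<le> (\<Sum>j\<le>N. lam j)"
    using psum_eq_psize[of N lam, OF N] psum_mono[of N "Suc N" lam] k
    by (simp add: psum_def lessThan_Suc_atMost)
  then have up: "k \<le> (\<Sum>j\<le>tab_row lam k. lam j)" unfolding tab_row_def by (rule LeastI)
  have low: "psum lam (tab_row lam k) < k"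
  proof (cases "tab_row lam k")
    case (Suc m)
    then have "\<not> k \<le> (\<Sum>j\<le>m. lam j)" unfolding tab_row_def by (intro not_less_Least) simp
    then show ?thesis by (simp add: Suc psum_def lessThan_Suc_atMost)
  qed (use k in \<open>simp add: psum_def\<close>)
  show "1 \<le> tab_col lam k" "k = psum lam (tab_row lam k) + tab_col lam k"
    using low by (simp_all add: tab_col_def psum_def)
  then show "tab_col lam k \<le> lam (tab_row lam k)"
    using up psum_Suc[of lam "tab_row lam k"] by (simp add: psum_def lessThan_Suc_atMost)
qed

definition cells :: "(nat \<Rightarrow> nat) \<Rightarrow> (nat \<times> nat) set" where
  "cells lam = {(i, j). 1 \<le> j \<and> j \<le> lam i}"

lemma bij_betw_cells:
  assumes part: "is_partition lam"
  shows "bij_betw (\<lambda>k. (tab_row lam k, tab_col lam k)) {1..psize lam} (cells lam)"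
proof (rule bij_betw_byWitness[where f'="\<lambda>(i, j). psum lam i + j"])
  show "\<forall>k\<in>{1..psize lam}. (case (tab_row lam k, tab_col lam k) of (i, j) \<Rightarrow> psum lam i + j) = k"
    using position_cell(3)[OF part] by simp
  show "\<forall>x\<in>cells lam. (tab_row lam (case x of (i, j) \<Rightarrow> psum lam i + j),
      tab_col lam (case x of (i, j) \<Rightarrow> psum lam i + j)) = x"
    by (auto simp: cells_def cell_position)
  show "(\<lambda>k. (tab_row lam k, tab_col lam k)) ` {1..psize lam} \<subseteq> cells lam"
    using position_cell[OF part] by (auto simp: cells_def)
  show "(\<lambda>(i, j). psum lam i + j) ` cells lam \<subseteq> {1..psize lam}"
  proof clarify
    fix i j assume "(i, j) \<in> cells lam"
    then have ij: "1 \<le> j" "j \<le> lam i" by (auto simp: cells_def)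
    obtain N where N: "\<forall>i\<ge>N. lam i = 0" by (rule partition_bounded[OF part])
    have "i < N" using N ij by (rule_tac ccontr) auto
    then have "psum lam (Suc i) \<le> psize lam"
      using psum_mono[of "Suc i" N lam] psum_eq_psize[of N lam, OF N] by simp
    then show "psum lam i + j \<in> {1..psize lam}" using ij by (simp add: psum_Suc)
  qed
qed

lemma card_row:
  assumes part: "is_partition lam"
  shows "card {k\<in>{1..psize lam}. tab_row lam k = i} = lam i"
proof -
  have "bij_betw (tab_col lam) {k\<in>{1..psize lam}. tab_row lam k = i} {1..lam i}"
  proof (rule bij_betw_byWitness[where f'="\<lambda>j. psum lam i + j"])
    show "(\<lambda>j. psum lam i + j) ` {1..lam i} \<subseteq> {k \<in> {1..psize lam}. tab_row lam k = i}"
    proof clarify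
      fix j assume j: "j \<in> {1..lam i}"
      then obtain k where k: "k \<in> {1..psize lam}" "tab_row lam k = i" "tab_col lam k = j"
      proof -
        have "(i, j) \<in> (\<lambda>k. (tab_row lam k, tab_col lam k)) ` {1..psize lam}"
          using bij_betw_cells[OF part] j by (simp add: bij_betw_def cells_def)
        then show thesis using that by auto
      qed
      then have "k = psum lam i + j" using position_cell(3)[OF part k(1)] by simp
      then show "psum lam i + j \<in> {1..psize lam} \<and> tab_row lam (psum lam i + j) = i" using k by simp
    qed
  qed (use position_cell[OF part] in \<open>force simp: cell_position\<close>)+
  then show ?thesis using bij_betw_same_card by fastforce
qed

text \<open>
  If the letters of a word \<open>f\<close> are put into the tableau so that no letter repeats in a column
  (\<open>d k\<close> is the column of the position \<open>k\<close>), then the letters below \<open>j\<close> fit into the first \<open>j\<close> rows.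
\<close>

lemma column_strict_word:
  fixes f h :: "nat \<Rightarrow> nat"
  assumes part: "is_partition lam" and h: "bij_betw h {1..psize lam} {1..psize lam}"
  defines "d \<equiv> \<lambda>k. tab_col lam (h k)"
  assumes inj: "\<And>k k'. k \<in> {1..psize lam} \<Longrightarrow> k' \<in> {1..psize lam} \<Longrightarrow> f k = f k' \<Longrightarrow> d k = d k' \<Longrightarrow> k = k'"
  shows "card {k\<in>{1..psize lam}. f k < j} \<le> psum lam j"
    and "(\<And>i. card {k\<in>{1..psize lam}. f k = i} = lam i) \<Longrightarrow> k \<in> {1..psize lam} \<Longrightarrow> d k \<le> lam (f k)"
proof -
  define A where "A = {1..psize lam}"
  define C where "C = {1..lam 0}"
  define B where "B j c = {k\<in>A. f k < j \<and> d k = c}" for j c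
  define T where "T j c = {i\<in>{..<j}. c \<le> lam i}" for j c
  have anti: "i \<le> j \<Longrightarrow> lam j \<le> lam i" for i j using part by (simp add: is_partition_def antimonoD)
  have fin: "finite A" by (simp add: A_def)
  have h_in: "h k \<in> A" if "k \<in> A" for k using h that by (auto simp: bij_betw_def A_def)
  have cell: "1 \<le> d k" "d k \<le> lam (tab_row lam (h k))" if "k \<in> A" for k
    using position_cell[OF part] h_in[OF that] by (auto simp: d_def A_def)
  have d_in: "d k \<in> C" if "k \<in> A" for k
    using cell[OF that] anti[of 0 "tab_row lam (h k)"] by (auto simp: C_def)
  have bound: "card (B j c) \<le> card (T j c)" for j c
  proof (cases "\<forall>i<j. c \<le> lam i")
    case True
    then have "T j c = {..<j}" by (auto simp: T_def)
    moreover have "inj_on f (B j c)"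
      using inj by (auto simp: inj_on_def B_def A_def)
    ultimately show ?thesis
      by (intro card_inj_on_le[of f]) (auto simp: B_def)
  next
    case False
    then obtain i0 where i0: "i0 < j" "lam i0 < c" by (meson not_le)
    have "inj_on (\<lambda>k. tab_row lam (h k)) (B j c)"
    proof (rule inj_onI)
      fix k k' assume k: "k \<in> B j c" "k' \<in> B j c" "tab_row lam (h k) = tab_row lam (h k')"
      then have "tab_col lam (h k) = tab_col lam (h k')" by (simp add: B_def d_def)
      with k have "h k = h k'"
        using bij_betw_cells[OF part] h_in
        by (intro inj_onD[OF bij_betw_imp_inj_on[OF bij_betw_cells[OF part]]]) (auto simp: B_def A_def)
      then show "k = k'" using h k by (auto simp: B_def A_def bij_betw_def dest: inj_onD)
    qed
    moreover have "(\<lambda>k. tab_row lam (h k)) ` B j c \<subseteq> T j c"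
    proof clarify
      fix k assume "k \<in> B j c"
      then have le: "c \<le> lam (tab_row lam (h k))" using cell by (auto simp: B_def)
      have "tab_row lam (h k) < j"
        using le i0 anti[of i0 "tab_row lam (h k)"] by (rule_tac ccontr) auto
      with le show "tab_row lam (h k) \<in> T j c" by (simp add: T_def)
    qed
    ultimately show ?thesis by (intro card_inj_on_le) (auto simp: T_def)
  qed
  have sum_B: "card {k\<in>A. f k < j} = (\<Sum>c\<in>C. card (B j c))" for j
  proof -
    have "{k\<in>A. f k < j} = (\<Union>c\<in>C. B j c)" using d_in by (auto simp: B_def)
    then show ?thesis
      by (simp only:) (intro card_UN_disjoint, auto simp: B_def C_def fin)
  qed
  have sum_T: "(\<Sum>c\<in>C. card (T j c)) = psum lam j" for j
  proof -
    have "(\<Sum>c\<in>C. card (T j c)) = (\<Sum>c\<in>C. \<Sum>i<j. if c \<le> lam i then 1 else 0)"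
      unfolding T_def by (simp only: card_filter[OF finite_lessThan])
    also have "\<dots> = (\<Sum>i<j. card {c\<in>C. c \<le> lam i})"
      unfolding C_def by (subst sum.swap) (simp only: card_filter[OF finite_atLeastAtMost])
    also have "\<dots> = psum lam j"
      unfolding psum_def
    proof (rule sum.cong[OF refl])
      fix i
      have "{c\<in>C. c \<le> lam i} = {1..lam i}" using anti[of 0 i] by (auto simp: C_def)
      then show "card {c\<in>C. c \<le> lam i} = lam i" by simp
    qed
    finally show ?thesis .
  qed
  show "card {k\<in>{1..psize lam}. f k < j} \<le> psum lam j" for j
    using sum_B[of j] sum_T[of j] bound sum_mono[of C "\<lambda>c. card (B j c)" "\<lambda>c. card (T j c)"]
    by (simp add: A_def)
  show "d k \<le> lam (f k)" if content: "\<And>i. card {k\<in>{1..psize lam}. f k = i} = lam i"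
    and k: "k \<in> {1..psize lam}" for k
  proof (rule ccontr)
    assume neg: "\<not> d k \<le> lam (f k)"
    have eq: "card (B j c) = card (T j c)" if "c \<in> C" for j c
    proof -
      have "{k\<in>A. f k < j} = (\<Union>i<j. {k\<in>A. f k = i})" by auto
      moreover have "card (\<Union>i<j. {k\<in>A. f k = i}) = (\<Sum>i<j. card {k\<in>A. f k = i})"
        by (intro card_UN_disjoint) (auto simp: fin)
      ultimately have "(\<Sum>c\<in>C. card (B j c)) = (\<Sum>c\<in>C. card (T j c))"
        using content sum_B[of j] sum_T[of j] by (simp add: A_def psum_def)
      then show ?thesis using bound that
        by (intro sum_mono_inv[of "\<lambda>c. card (B j c)" C "\<lambda>c. card (T j c)"]) (auto simp: C_def)
    qed
    have kA: "k \<in> A" using k by (simp add: A_def)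
    have "T (Suc (f k)) (d k) = T (f k) (d k)"
      using neg by (auto simp: T_def less_Suc_eq)
    then have "card (B (Suc (f k)) (d k)) = card (B (f k) (d k))"
      using eq[OF d_in[OF kA]] by simp
    moreover have "B (f k) (d k) \<subset> B (Suc (f k)) (d k)"
      using kA by (auto simp: B_def)
    then have "card (B (f k) (d k)) < card (B (Suc (f k)) (d k))"
      by (intro psubset_card_mono) (auto simp: B_def fin)
    ultimately show False by simp
  qed
qed

section \<open>Young symmetrizers\<close>

text \<open>Otherwise the simplifier turns \<open>{1..n}\<close> into \<open>{Suc 0..n}\<close>, which breaks rules stated for \<open>{1..n}\<close>.\<close>

declare One_nat_def [simp del]

text \<open>A Young subgroup, the product of the symmetric groups of the fibres of \<open>f\<close>.
  It covers the row and column groups of a tableau as well as the stabilizers of words.\<close>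

definition stab :: "'a set \<Rightarrow> ('a \<Rightarrow> 'b) \<Rightarrow> ('a \<Rightarrow> 'a) set" where
  "stab A f = {s. s permutes A \<and> (\<forall>k\<in>A. f (s k) = f k)}"

lemma finite_stab: "finite A \<Longrightarrow> finite (stab A f)"
  by (rule finite_subset[OF _ finite_permutations[of A]]) (auto simp: stab_def)

lemma id_in_stab: "id \<in> stab A f"
  by (simp add: stab_def permutes_id)

lemma stab_compose: "s \<in> stab A f \<Longrightarrow> t \<in> stab A f \<Longrightarrow> s \<circ> t \<in> stab A f"
  by (auto simp: stab_def permutes_compose permutes_in_image)

lemma stab_inv:
  assumes "s \<in> stab A f" shows "inv' s \<in> stab A f"
proof -
  have s: "s permutes A" using assms by (simp add: stab_def)
  have "f (inv' s k) = f k" if "k \<in> A" for k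
  proof -
    have "inv' s k \<in> A" using permutes_in_image[OF permutes_inv[OF s]] that by simp
    then have "f (s (inv' s k)) = f (inv' s k)" using assms by (simp add: stab_def)
    then show ?thesis using permutes_inverses(1)[OF s] by simp
  qed
  then show ?thesis using permutes_inv[OF s] by (simp add: stab_def)
qed

lemma sum_stab_right:
  assumes t: "t \<in> stab A f"
  shows "(\<Sum>s\<in>stab A f. F (s \<circ> t)) = (\<Sum>s\<in>stab A f. F s)"
proof -
  have tp: "t permutes A" using t by (simp add: stab_def)
  show ?thesis
    by (rule sum.reindex_bij_witness[where i="\<lambda>s. s \<circ> inv' t" and j="\<lambda>s. s \<circ> t"])
       (auto simp: stab_compose stab_inv t comp_assoc permutes_inv_o[OF tp])
qed

lemma inv_comp:
  assumes "p permutes S" "q permutes S"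
  shows "inv' (p \<circ> q) = inv' q \<circ> inv' p"
  using assms by (intro o_inv_distrib) (auto simp: permutes_bij)

definition stab_indicator :: "'a set \<Rightarrow> ('a \<Rightarrow> 'b) \<Rightarrow> ('a \<Rightarrow> 'a) \<Rightarrow> complex" where
  "stab_indicator A f s = (if s \<in> stab A f then 1 else 0)"

lemma sym_group_finite_group: "finite_group (sym_group n)"
  by (intro finite_group.intro finite_group_axioms.intro sym_group_is_group)
     (simp add: sym_group_def finite_permutations)

lemma conv_sym_group:
  assumes "g permutes {1..n}"
  shows "conv (sym_group n) x y g = (\<Sum>h | h permutes {1..n}. x h * y (inv' h \<circ> g))"
proof -
  have "carrier (sym_group n) = {h. h permutes {1..n}}" by (simp add: sym_group_def)
  then show ?thesis
    using assms by (simp add: conv_def sym_group_carrier sym_group_mult)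
qed

locale partition =
  fixes lam :: "nat \<Rightarrow> nat"
  assumes part: "is_partition lam"
begin

abbreviation "n \<equiv> psize lam"
abbreviation "row \<equiv> tab_row lam"
abbreviation "col \<equiv> tab_col lam"

sublocale G: finite_group "sym_group n"
  by (rule sym_group_finite_group)

lemma row_group_eq: "row_group lam = stab {1..n} row"
  by (auto simp: row_group_def stab_def sym_group_carrier)

lemma col_group_eq: "col_group lam = stab {1..n} col"
  by (auto simp: col_group_def stab_def sym_group_carrier)

lemma row_sum_eq: "row_sum lam = stab_indicator {1..n} row"
  by (simp add: fun_eq_iff row_sum_def stab_indicator_def row_group_eq)

lemma signed_col_sum_mult:
  assumes t: "t \<in> stab {1..n} col" and y: "y permutes {1..n}"
  shows "signed_col_sum lam (t \<circ> y) = of_int (sign t) * signed_col_sum lam y"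
proof -
  have tp: "t permutes {1..n}" using t by (simp add: stab_def)
  have "t \<circ> y \<in> stab {1..n} col \<longleftrightarrow> y \<in> stab {1..n} col"
  proof
    assume "t \<circ> y \<in> stab {1..n} col"
    then have "inv' t \<circ> (t \<circ> y) \<in> stab {1..n} col" by (rule stab_compose[OF stab_inv[OF t]])
    moreover have "inv' t \<circ> (t \<circ> y) = y" by (simp add: comp_assoc[symmetric] permutes_inv_o[OF tp])
    ultimately show "y \<in> stab {1..n} col" by simp
  qed (rule stab_compose[OF t])
  moreover have "sign (t \<circ> y) = sign t * sign y"
    using tp y by (intro sign_compose) (auto simp: permutation_permutes)
  ultimately show ?thesis by (simp add: signed_col_sum_def col_group_eq)
qed

text \<open>The value at \<open>y\<close> of the product of the indicator of the stabilizer of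
  \<open>f\<close>, the unit mass at \<open>g\<close> and the signed column sum. A general middle
  factor is a combination of such \<open>g\<close>.\<close>

definition word_kernel :: "(nat \<Rightarrow> nat) \<Rightarrow> (nat \<Rightarrow> nat) \<Rightarrow> (nat \<Rightarrow> nat) \<Rightarrow> complex" where
  "word_kernel f g y = (\<Sum>s\<in>stab {1..n} f. signed_col_sum lam (inv' g \<circ> (inv' s \<circ> y)))"

lemma conv_stab_indicator:
  assumes y: "y permutes {1..n}"
  shows "conv (sym_group n) (stab_indicator {1..n} f) (conv (sym_group n) x (signed_col_sum lam)) y =
    (\<Sum>g | g permutes {1..n}. x g * word_kernel f g y)"
proof -
  have "conv (sym_group n) (stab_indicator {1..n} f) (conv (sym_group n) x (signed_col_sum lam)) y =
      (\<Sum>s | s permutes {1..n}. if s \<in> stab {1..n} f then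
        conv (sym_group n) x (signed_col_sum lam) (inv' s \<circ> y) else 0)"
    unfolding conv_sym_group[OF y] by (intro sum.cong refl) (simp add: stab_indicator_def)
  also have "\<dots> = (\<Sum>s\<in>stab {1..n} f. conv (sym_group n) x (signed_col_sum lam) (inv' s \<circ> y))"
    by (subst sum.inter_filter[symmetric]) (auto simp: finite_permutations stab_def intro!: sum.cong)
  also have "\<dots> = (\<Sum>s\<in>stab {1..n} f. \<Sum>g | g permutes {1..n}. x g * signed_col_sum lam (inv' g \<circ> (inv' s \<circ> y)))"
    using y by (intro sum.cong refl) (simp add: conv_sym_group stab_def permutes_compose permutes_inv)
  also have "\<dots> = (\<Sum>g | g permutes {1..n}. x g * word_kernel f g y)"
    by (subst sum.swap) (simp add: word_kernel_def sum_distrib_left)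
  finally show ?thesis .
qed

lemma young_symmetrizer_apply:
  assumes y: "y permutes {1..n}"
  shows "young_symmetrizer lam y = (\<Sum>s\<in>stab {1..n} row. signed_col_sum lam (inv' s \<circ> y))"
proof -
  have "young_symmetrizer lam y = (\<Sum>s | s permutes {1..n}. if s \<in> stab {1..n} row then
        signed_col_sum lam (inv' s \<circ> y) else 0)"
    unfolding young_symmetrizer_def conv_sym_group[OF y]
    by (intro sum.cong refl) (simp add: row_sum_eq stab_indicator_def)
  also have "\<dots> = (\<Sum>s\<in>stab {1..n} row. signed_col_sum lam (inv' s \<circ> y))"
    by (subst sum.inter_filter[symmetric]) (auto simp: finite_permutations stab_def intro!: sum.cong)
  finally show ?thesis .
qed

text \<open>The transposition of \<open>k\<close> and \<open>k'\<close> fixes the word, and its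
  conjugate by \<open>inv' g\<close> is an odd element of the column group. Translating the sum by
  the transposition therefore changes its sign.\<close>

lemma word_kernel_eq_0:
  assumes g: "g permutes {1..n}" and y: "y permutes {1..n}"
    and k: "k \<in> {1..n}" "k' \<in> {1..n}" "k \<noteq> k'" "f k = f k'" "col (inv' g k) = col (inv' g k')"
  shows "word_kernel f g y = 0"
proof -
  define t where "t = transpose k k'"
  define t' where "t' = transpose (inv' g k) (inv' g k')"
  have tp: "t permutes {1..n}" using k by (simp add: t_def permutes_swap_id)
  have t: "t \<in> stab {1..n} f"
    using tp k by (auto simp: stab_def t_def transpose_def)
  have g_in: "inv' g k \<in> {1..n}" "inv' g k' \<in> {1..n}"
    using permutes_in_image[OF permutes_inv[OF g]] k by simp_all
  then have "t' permutes {1..n}" by (simp add: t'_def permutes_swap_id)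
  then have t': "t' \<in> stab {1..n} col"
    using k by (auto simp: stab_def t'_def transpose_def)
  have "inv' g k \<noteq> inv' g k'" using k(3) permutes_inverses(1)[OF g] by metis
  then have sign: "sign t' = -1" by (simp add: t'_def sign_swap_id)
  have conj: "inv' g \<circ> t = t' \<circ> inv' g"
    unfolding t_def t'_def using bij_is_inj[OF permutes_bij[OF permutes_inv[OF g]]]
    by (simp add: fun_eq_iff transpose_def inj_eq)
  have "word_kernel f g y = (\<Sum>s\<in>stab {1..n} f. signed_col_sum lam (inv' g \<circ> (inv' (s \<circ> t) \<circ> y)))"
    unfolding word_kernel_def by (rule sum_stab_right[OF t, symmetric])
  also have "\<dots> = (\<Sum>s\<in>stab {1..n} f. - signed_col_sum lam (inv' g \<circ> (inv' s \<circ> y)))"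
  proof (rule sum.cong[OF refl])
    fix s assume "s \<in> stab {1..n} f"
    then have s: "s permutes {1..n}" by (simp add: stab_def)
    have "inv' (s \<circ> t) = t \<circ> inv' s"
      using inv_comp[OF s tp] by (simp add: t_def)
    then have "inv' g \<circ> (inv' (s \<circ> t) \<circ> y) = t' \<circ> (inv' g \<circ> (inv' s \<circ> y))"
      using conj by (metis comp_assoc)
    moreover have "inv' g \<circ> (inv' s \<circ> y) permutes {1..n}"
      using g s y by (intro permutes_compose permutes_inv)
    ultimately show "signed_col_sum lam (inv' g \<circ> (inv' (s \<circ> t) \<circ> y)) =
        - signed_col_sum lam (inv' g \<circ> (inv' s \<circ> y))"
      by (simp add: signed_col_sum_mult[OF t'] sign)
  qed
  also have "\<dots> = - word_kernel f g y" by (simp add: word_kernel_def sum_negf)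
  finally show ?thesis by simp
qed

text \<open>The combinatorial lemma behind Young symmetrizers. The row word, spread over columns by
  \<open>inv' g\<close>, repeats no letter in a column, so \<open>column_strict_word\<close> shows
  that the row of \<open>k\<close> reaches the column of \<open>inv' g k\<close>.\<close>

lemma row_col_factorization:
  assumes g: "g permutes {1..n}"
    and inj: "\<And>k k'. k \<in> {1..n} \<Longrightarrow> k' \<in> {1..n} \<Longrightarrow> row k = row k' \<Longrightarrow>
      col (inv' g k) = col (inv' g k') \<Longrightarrow> k = k'"
  obtains p q where "p \<in> stab {1..n} row" "q \<in> stab {1..n} col" "g = p \<circ> q"
proof -
  let ?A = "{1..n}" and ?pos = "\<lambda>k. (row k, col k)"
  note bij = bij_betw_cells[OF part]
  have ginv: "bij_betw (inv' g) ?A ?A" by (rule permutes_imp_bij[OF permutes_inv[OF g]])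
  have le: "col (inv' g k) \<le> lam (row k)" if "k \<in> ?A" for k
    using column_strict_word(2)[OF part ginv, of row k] inj that card_row[OF part] by blast
  \<comment> \<open>\<open>\<sigma>\<close> moves \<open>k\<close> within its own row into the
    column of \<open>inv' g k\<close>. It is injective by hypothesis, it preserves rows, and
    \<open>\<sigma> \<circ> g\<close> preserves columns.\<close>
  define \<sigma> where "\<sigma> k = (if k \<in> ?A then inv_into ?A ?pos (row k, col (inv' g k)) else k)" for k
  have in_cells: "(row k, col (inv' g k)) \<in> ?pos ` ?A" if k: "k \<in> ?A" for k
  proof -
    have "inv' g k \<in> ?A" using ginv k by (auto simp: bij_betw_def)
    then have "1 \<le> col (inv' g k)" by (rule position_cell(1)[OF part])
    then show ?thesis using le[OF k] bij by (simp add: bij_betw_def cells_def)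
  qed
  have \<sigma>: "\<sigma> k \<in> ?A" "row (\<sigma> k) = row k" "col (\<sigma> k) = col (inv' g k)" if k: "k \<in> ?A" for k
    using inv_into_into[OF in_cells[OF k]] f_inv_into_f[OF in_cells[OF k]] k by (simp_all add: \<sigma>_def)
  have "inj_on \<sigma> ?A"
  proof (rule inj_onI)
    fix k k' assume "k \<in> ?A" "k' \<in> ?A" "\<sigma> k = \<sigma> k'"
    then show "k = k'" using inj[of k k'] \<sigma>[of k] \<sigma>[of k'] by simp
  qed
  moreover have "\<sigma> ` ?A \<subseteq> ?A" using \<sigma>(1) by blast
  ultimately have "bij_betw \<sigma> ?A ?A"
    by (simp add: bij_betw_def endo_inj_surj)
  then have \<sigma>p: "\<sigma> permutes ?A" by (rule bij_imp_permutes) (unfold \<sigma>_def, rule if_not_P)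
  have \<sigma>r: "\<sigma> \<in> stab ?A row" using \<sigma>p \<sigma>(2) by (simp add: stab_def)
  have "col ((\<sigma> \<circ> g) k) = col k" if k: "k \<in> ?A" for k
  proof -
    have "g k \<in> ?A" using permutes_in_image[OF g] k by simp
    then show ?thesis using \<sigma>(3)[of "g k"] permutes_inverses(2)[OF g] by simp
  qed
  then have "\<sigma> \<circ> g \<in> stab ?A col" using \<sigma>p g by (simp add: stab_def permutes_compose)
  moreover have "inv' \<sigma> \<in> stab ?A row" by (rule stab_inv[OF \<sigma>r])
  moreover have "g = inv' \<sigma> \<circ> (\<sigma> \<circ> g)" by (simp add: comp_assoc[symmetric] permutes_inv_o[OF \<sigma>p])
  ultimately show thesis using that by blast
qed

lemma row_col_stab_id:
  assumes "s \<in> stab {1..n} row" "s \<in> stab {1..n} col"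
  shows "s = id"
proof
  fix k
  show "s k = id k"
  proof (cases "k \<in> {1..n}")
    case True
    moreover have "s permutes {1..n}" using assms(1) by (simp add: stab_def)
    then have "s k \<in> {1..n}" using True permutes_in_image[of s "{1..n}" k] by blast
    moreover have "(row (s k), col (s k)) = (row k, col k)"
      using assms True by (simp add: stab_def)
    ultimately show ?thesis
      using inj_onD[OF bij_betw_imp_inj_on[OF bij_betw_cells[OF part]], of "s k" k] by simp
  qed (use assms in \<open>auto simp: stab_def permutes_not_in\<close>)
qed

lemma young_symmetrizer_id: "young_symmetrizer lam id = 1"
proof -
  have "young_symmetrizer lam id = (\<Sum>s\<in>stab {1..n} row. if s = id then 1 else 0)"
    unfolding young_symmetrizer_apply[OF permutes_id]
  proof (rule sum.cong[OF refl])
    fix s assume s: "s \<in> stab {1..n} row"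
    then have sp: "s permutes {1..n}" by (simp add: stab_def)
    have "inv' s = id" if "inv' s \<in> stab {1..n} col"
      using row_col_stab_id that stab_inv[OF s] by blast
    moreover have "s = id" if "inv' s = id" using that permutes_inv_inv[OF sp] by (metis inv_id)
    ultimately show "signed_col_sum lam (inv' s \<circ> id) = (if s = id then 1 else 0)"
      by (auto simp: signed_col_sum_def col_group_eq id_in_stab)
  qed
  then show ?thesis by (simp add: finite_stab id_in_stab)
qed

text \<open>Either some pair shares both a row and a column, and the kernel vanishes, or
  \<open>g = p \<circ> q\<close>; then the row sum absorbs \<open>p\<close> and the column sum
  absorbs \<open>q\<close> up to its sign.\<close>

lemma word_kernel_row:
  assumes g: "g permutes {1..n}"
  shows "\<exists>l. \<forall>y. y permutes {1..n} \<longrightarrow> word_kernel row g y = l * young_symmetrizer lam y"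
proof (cases "\<exists>k\<in>{1..n}. \<exists>k'\<in>{1..n}. k \<noteq> k' \<and> row k = row k' \<and> col (inv' g k) = col (inv' g k')")
  case True
  then show ?thesis using word_kernel_eq_0[OF g] by (intro exI[of _ 0]) auto
next
  case False
  then obtain p q where p: "p \<in> stab {1..n} row" and q: "q \<in> stab {1..n} col" and g_eq: "g = p \<circ> q"
    using row_col_factorization[OF g] by blast
  have pp: "p permutes {1..n}" and qp: "q permutes {1..n}" using p q by (auto simp: stab_def)
  have "word_kernel row g y = of_int (sign (inv' q)) * young_symmetrizer lam y" if y: "y permutes {1..n}" for y
  proof -
    have "word_kernel row g y = (\<Sum>s\<in>stab {1..n} row.
        of_int (sign (inv' q)) * signed_col_sum lam (inv' (s \<circ> p) \<circ> y))"
      unfolding word_kernel_def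
    proof (rule sum.cong[OF refl])
      fix s assume "s \<in> stab {1..n} row"
      then have s: "s permutes {1..n}" by (simp add: stab_def)
      have "inv' g \<circ> (inv' s \<circ> y) = inv' q \<circ> (inv' (s \<circ> p) \<circ> y)"
        by (simp add: g_eq inv_comp[OF pp qp] inv_comp[OF s pp] comp_assoc)
      moreover have "inv' (s \<circ> p) \<circ> y permutes {1..n}"
        using s pp y by (intro permutes_compose permutes_inv)
      ultimately show "signed_col_sum lam (inv' g \<circ> (inv' s \<circ> y)) =
          of_int (sign (inv' q)) * signed_col_sum lam (inv' (s \<circ> p) \<circ> y)"
        using signed_col_sum_mult[OF stab_inv[OF q]] by simp
    qed
    also have "\<dots> = of_int (sign (inv' q)) * (\<Sum>s\<in>stab {1..n} row. signed_col_sum lam (inv' s \<circ> y))"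
      using sum_stab_right[OF p, of "\<lambda>s. signed_col_sum lam (inv' s \<circ> y)"]
      by (simp add: sum_distrib_left[symmetric])
    finally show ?thesis using y by (simp add: young_symmetrizer_apply)
  qed
  then show ?thesis by blast
qed

end

section \<open>From the Young symmetrizer to a primitive idempotent\<close>

context partition
begin

abbreviation "\<a> \<equiv> row_sum lam"
abbreviation "\<b> \<equiv> signed_col_sum lam"
abbreviation "\<c> \<equiv> young_symmetrizer lam"
abbreviation "cv \<equiv> conv (sym_group n)"

lemma carrier_eq: "carrier (sym_group n) = {p. p permutes {1..n}}"
  by (simp add: sym_group_def)

lemma group_algebra_eqI:
  assumes "x \<in> group_algebra (sym_group n)" "y \<in> group_algebra (sym_group n)"
    and "\<And>p. p permutes {1..n} \<Longrightarrow> x p = y p"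
  shows "x = y"
proof
  fix p show "x p = y p"
    using assms by (cases "p permutes {1..n}") (auto simp: group_algebra_def carrier_eq)
qed

lemma in_group_algebra:
  "\<a> \<in> group_algebra (sym_group n)" "\<b> \<in> group_algebra (sym_group n)" "\<c> \<in> group_algebra (sym_group n)"
  by (auto simp: group_algebra_def carrier_eq row_sum_def signed_col_sum_def row_group_def
      col_group_def young_symmetrizer_def conv_def)

lemma fscale_in_group_algebra:
  "x \<in> group_algebra (sym_group n) \<Longrightarrow> fscale l x \<in> group_algebra (sym_group n)"
  by (simp add: group_algebra_def)

text \<open>Linear extension of \<open>word_kernel_row\<close>. It makes the Young symmetrizer a
  multiple of its own square root of scalars no more than once: it gives
  \<open>\<c> \<c> = \<nu> \<c>\<close>, primitivity of the idempotent, and rank one of the row sum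
  on the ideal.\<close>

lemma row_conv: "\<exists>l. cv \<a> (cv x \<b>) = fscale l \<c>"
proof -
  have "\<exists>l. \<forall>g. g permutes {1..n} \<longrightarrow> (\<forall>y. y permutes {1..n} \<longrightarrow> word_kernel row g y = l g * \<c> y)"
    using word_kernel_row by metis
  then obtain l where l: "\<And>g y. g permutes {1..n} \<Longrightarrow> y permutes {1..n} \<Longrightarrow> word_kernel row g y = l g * \<c> y"
    by blast
  have "cv \<a> (cv x \<b>) = fscale (\<Sum>g | g permutes {1..n}. x g * l g) \<c>"
  proof (rule group_algebra_eqI)
    fix y assume y: "y permutes {1..n}"
    show "cv \<a> (cv x \<b>) y = fscale (\<Sum>g | g permutes {1..n}. x g * l g) \<c> y"
      unfolding row_sum_eq conv_stab_indicator[OF y] using y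
      by (simp add: l sum_distrib_right mult.assoc)
  qed (simp_all add: G.conv_in_group_algebra fscale_in_group_algebra in_group_algebra)
  then show ?thesis by blast
qed

lemma row_row: "cv \<a> \<a> = fscale (of_nat (card (stab {1..n} row))) \<a>"
proof (rule group_algebra_eqI)
  fix y assume y: "y permutes {1..n}"
  have "inv' s \<circ> y \<in> stab {1..n} row \<longleftrightarrow> y \<in> stab {1..n} row" if s: "s \<in> stab {1..n} row" for s
  proof
    assume "inv' s \<circ> y \<in> stab {1..n} row"
    then have "s \<circ> (inv' s \<circ> y) \<in> stab {1..n} row" by (rule stab_compose[OF s])
    moreover have "s \<circ> (inv' s \<circ> y) = y"
      using s permutes_inv_o(1)[of s "{1..n}"] by (simp add: comp_assoc[symmetric] stab_def)
    ultimately show "y \<in> stab {1..n} row" by simp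
  qed (use stab_compose[OF stab_inv[OF s]] in blast)
  then have "cv \<a> \<a> y = (\<Sum>s | s permutes {1..n}. if s \<in> stab {1..n} row then \<a> y else 0)"
    unfolding conv_sym_group[OF y] by (intro sum.cong refl) (simp add: row_sum_eq stab_indicator_def)
  also have "\<dots> = (\<Sum>s\<in>stab {1..n} row. \<a> y)"
    by (subst sum.inter_filter[symmetric]) (auto simp: finite_permutations stab_def intro!: sum.cong)
  finally show "cv \<a> \<a> y = fscale (of_nat (card (stab {1..n} row))) \<a> y" by simp
qed (simp_all add: G.conv_in_group_algebra fscale_in_group_algebra in_group_algebra)

lemma col_col: "cv \<b> \<b> = fscale (of_nat (card (stab {1..n} col))) \<b>"
proof (rule group_algebra_eqI)
  fix y assume y: "y permutes {1..n}"
  have "cv \<b> \<b> y = (\<Sum>s | s permutes {1..n}. if s \<in> stab {1..n} col then \<b> y else 0)"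
    unfolding conv_sym_group[OF y]
  proof (rule sum.cong[OF refl])
    fix s assume "s \<in> {s. s permutes {1..n}}"
    then have s: "s permutes {1..n}" by simp
    have "sign (inv' s) = sign s" using s by (intro sign_inverse) (auto simp: permutation_permutes)
    then have "\<b> s * \<b> (inv' s \<circ> y) = \<b> y" if "s \<in> stab {1..n} col"
      using that signed_col_sum_mult[OF stab_inv[OF that] y]
      by (simp add: signed_col_sum_def[of lam s] col_group_eq mult.assoc[symmetric] of_int_mult[symmetric] del: of_int_mult)
    then show "\<b> s * \<b> (inv' s \<circ> y) = (if s \<in> stab {1..n} col then \<b> y else 0)"
      by (auto simp: signed_col_sum_def col_group_eq)
  qed
  also have "\<dots> = (\<Sum>s\<in>stab {1..n} col. \<b> y)"
    by (subst sum.inter_filter[symmetric]) (auto simp: finite_permutations stab_def intro!: sum.cong)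
  finally show "cv \<b> \<b> y = fscale (of_nat (card (stab {1..n} col))) \<b> y" by simp
qed (simp_all add: G.conv_in_group_algebra fscale_in_group_algebra in_group_algebra)

lemma stab_inv_iff: "p permutes {1..n} \<Longrightarrow> inv' p \<in> stab {1..n} f \<longleftrightarrow> p \<in> stab {1..n} f"
  using stab_inv[of p] stab_inv[of "inv' p" "{1..n}" f] permutes_inv_inv by metis

lemma row_inv: "p permutes {1..n} \<Longrightarrow> \<a> (inv' p) = \<a> p"
  by (simp add: row_sum_eq stab_indicator_def stab_inv_iff)

lemma col_inv: "p permutes {1..n} \<Longrightarrow> \<b> (inv' p) = \<b> p"
  using sign_inverse[of p]
  by (auto simp: signed_col_sum_def col_group_eq stab_inv_iff permutation_permutes)

lemma cnj_row: "cnj (\<a> p) = \<a> p"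
  by (simp add: row_sum_def)

lemma cnj_col: "cnj (\<b> p) = \<b> p"
  by (simp add: signed_col_sum_def)

lemma star_row: "G.star \<a> = \<a>"
  by (rule group_algebra_eqI)
     (simp_all add: G.star_in_group_algebra in_group_algebra, simp add: G.star_def sym_group_carrier row_inv cnj_row)

lemma star_col: "G.star \<b> = \<b>"
  by (rule group_algebra_eqI)
     (simp_all add: G.star_in_group_algebra in_group_algebra, simp add: G.star_def sym_group_carrier col_inv cnj_col)

lemma cnj_conv: "cnj (cv x y p) = cv (\<lambda>p. cnj (x p)) (\<lambda>p. cnj (y p)) p"
  by (simp add: conv_def)

lemma cnj_young_symmetrizer: "cnj (\<c> p) = \<c> p"
  by (simp add: young_symmetrizer_def cnj_conv cnj_row cnj_col)

lemma young_symmetrizer_inv: "p permutes {1..n} \<Longrightarrow> \<c> (inv' p) = cv \<b> \<a> p"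
proof -
  assume p: "p permutes {1..n}"
  have "G.star \<c> = cv \<b> \<a>" by (simp add: young_symmetrizer_def G.star_conv star_row star_col)
  moreover have "G.star \<c> p = cnj (\<c> (inv' p))" using p by (simp add: G.star_def sym_group_carrier)
  ultimately have "cnj (\<c> (inv' p)) = cv \<b> \<a> p" by simp
  then show ?thesis by (simp add: cnj_young_symmetrizer)
qed

text \<open>Since \<open>\<c>\<close> takes the value 1 at the identity, this is the scalar in
  \<open>\<c> \<c> = \<nu> \<c>\<close>; classically it is the product of the hook lengths.\<close>

definition \<nu> :: complex where "\<nu> = cv \<c> \<c> id"

lemma conv_young_symmetrizer: "cv \<c> \<c> = fscale \<nu> \<c>"
proof -
  obtain l where l: "cv \<c> \<c> = fscale l \<c>"
    using row_conv[of "cv \<b> \<a>"] by (auto simp: young_symmetrizer_def G.conv_assoc)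
  then have "\<nu> = l" by (simp add: \<nu>_def young_symmetrizer_id)
  with l show ?thesis by simp
qed

text \<open>If \<open>\<c> \<c> = 0\<close>, then \<open>w = \<a> \<b> \<a>\<close> is selfadjoint
  and its square is a multiple of \<open>\<c> \<c> \<a>\<close>, so \<open>w = 0\<close> by
  positivity. Then \<open>\<c>\<close> times its adjoint, a multiple of \<open>w\<close>, vanishes
  as well, and positivity contradicts \<open>\<c> id = 1\<close>.\<close>

lemma \<nu>_nz: "\<nu> \<noteq> 0"
proof
  assume "\<nu> = 0"
  then have cc: "cv \<c> \<c> = 0" by (simp add: conv_young_symmetrizer)
  define w where "w = cv \<a> (cv \<b> \<a>)"
  have "G.star w = w" by (simp add: w_def G.star_conv star_row star_col G.conv_assoc)
  moreover have "cv w w = fscale (of_nat (card (stab {1..n} row))) (cv (cv \<c> \<c>) \<a>)"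
  proof -
    have "cv w w = cv \<a> (cv \<b> (cv (cv \<a> \<a>) (cv \<b> \<a>)))" by (simp add: w_def G.conv_assoc)
    also have "\<dots> = fscale (of_nat (card (stab {1..n} row))) (cv \<a> (cv \<b> (cv \<a> (cv \<b> \<a>))))"
      by (simp only: row_row G.conv_fscale_left G.conv_fscale_right)
    finally show ?thesis by (simp add: young_symmetrizer_def G.conv_assoc)
  qed
  ultimately have "w = 0"
    using G.conv_star_eq_0[of w] cc G.conv_in_group_algebra by (simp add: w_def)
  have "cv \<c> (G.star \<c>) = cv \<a> (cv (cv \<b> \<b>) \<a>)"
    by (simp add: young_symmetrizer_def G.star_conv star_row star_col G.conv_assoc)
  also have "\<dots> = fscale (of_nat (card (stab {1..n} col))) w"
    by (simp only: col_col G.conv_fscale_left G.conv_fscale_right w_def)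
  also have "\<dots> = 0" by (simp add: \<open>w = 0\<close>)
  finally have "\<c> = 0" by (rule G.conv_star_eq_0[OF in_group_algebra(3)])
  then show False using young_symmetrizer_id by simp
qed

definition idem :: "(nat \<Rightarrow> nat) \<Rightarrow> complex" where
  "idem = fscale (1 / \<nu>) \<c>"

lemma primitive_idempotent_idem: "G.primitive_idempotent idem"
  unfolding G.primitive_idempotent_def
proof (intro conjI ballI)
  show "idem \<in> group_algebra (sym_group n)"
    by (simp add: idem_def fscale_in_group_algebra in_group_algebra)
  have "idem id \<noteq> 0" using \<nu>_nz by (simp add: idem_def young_symmetrizer_id)
  then show "idem \<noteq> 0" by auto
  show "cv idem idem = idem"
    using \<nu>_nz by (simp add: idem_def G.conv_fscale_left G.conv_fscale_right conv_young_symmetrizer)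
  fix x
  \<comment> \<open>Up to a scalar \<open>idem x idem\<close> has the form
    \<open>\<a> z \<b>\<close> with \<open>z = \<b> x \<a>\<close>, so \<open>row_conv\<close>
    applies.\<close>
  obtain l where l: "cv \<a> (cv (cv \<b> (cv x \<a>)) \<b>) = fscale l \<c>" using row_conv by blast
  have "cv idem (cv x idem) = fscale ((1 / \<nu>) * (1 / \<nu>)) (cv \<a> (cv (cv \<b> (cv x \<a>)) \<b>))"
    by (simp add: idem_def young_symmetrizer_def G.conv_fscale_left G.conv_fscale_right G.conv_assoc)
  also have "\<dots> = fscale (l / \<nu>) idem" by (simp add: l idem_def)
  finally show "\<exists>c. cv idem (cv x idem) = fscale c idem" by blast
qed

lemma Specht_eq_ideal_rep: "Specht lam = G.ideal_rep idem"
proof -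
  have "\<exists>y. cv x \<c> = cv y idem \<and> y \<in> group_algebra (sym_group n)"
    if "x \<in> group_algebra (sym_group n)" for x
    using that \<nu>_nz
    by (intro exI[of _ "fscale \<nu> x"])
       (simp add: idem_def G.conv_fscale_left G.conv_fscale_right fscale_in_group_algebra)
  moreover have "\<exists>y. cv x idem = cv y \<c> \<and> y \<in> group_algebra (sym_group n)"
    if "x \<in> group_algebra (sym_group n)" for x
    using that
    by (intro exI[of _ "fscale (1 / \<nu>) x"])
       (simp add: idem_def G.conv_fscale_left G.conv_fscale_right fscale_in_group_algebra)
  ultimately show ?thesis by (auto simp: Specht_def G.ideal_rep_def)
qed

subsection \<open>The character of a Specht module\<close>

definition \<chi> :: "(nat \<Rightarrow> nat) \<Rightarrow> complex" where
  "\<chi> = G.ideal_char idem"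

lemma \<chi>_conj:
  assumes g: "g permutes {1..n}" and h: "h permutes {1..n}"
  shows "\<chi> (h \<circ> g \<circ> inv' h) = \<chi> g"
  using G.ideal_char_conj[of g h idem] g h by (simp add: \<chi>_def sym_group_carrier sym_group_mult)

lemma idem_conv: "idem = fscale (1 / \<nu>) (cv \<a> \<b>)"
  by (simp add: idem_def young_symmetrizer_def)

lemma ideal_char_fscale: "G.ideal_char (fscale l x) g = l * G.ideal_char x g"
  by (simp add: G.ideal_char_def sum_distrib_left)

text \<open>Inverting the argument turns \<open>\<a> \<b>\<close> into \<open>\<b> \<a>\<close>,
  because both factors are selfadjoint with real values, and the two orders have the same character.
  This removes inverses from the inner products.\<close>

lemma \<chi>_inv:
  assumes g: "g permutes {1..n}"
  shows "\<chi> (inv' g) = \<chi> g"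
proof -
  have gi: "inv' g permutes {1..n}" by (rule permutes_inv[OF g])
  have "G.ideal_char \<c> (inv' g) = G.ideal_char (cv \<b> \<a>) g"
    unfolding G.ideal_char_def
  proof (rule sum.cong[OF refl])
    fix h assume "h \<in> carrier (sym_group n)"
    then have h: "h permutes {1..n}" by (simp add: sym_group_carrier)
    have "inv' (inv' h \<circ> inv' g \<circ> h) = inv' h \<circ> g \<circ> h"
      using inv_comp[OF permutes_compose[OF gi permutes_inv[OF h]] h] inv_comp[OF permutes_inv[OF h] gi]
      by (simp add: permutes_inv_inv[OF g] permutes_inv_inv[OF h] comp_assoc)
    moreover have "inv' h \<circ> inv' g \<circ> h permutes {1..n}"
      using g h by (intro permutes_compose permutes_inv)
    ultimately have "\<c> (inv' h \<circ> g \<circ> h) = cv \<b> \<a> (inv' h \<circ> inv' g \<circ> h)"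
      using young_symmetrizer_inv[of "inv' h \<circ> inv' g \<circ> h"] by simp
    then show "\<c> (inv\<^bsub>sym_group n\<^esub> h \<otimes>\<^bsub>sym_group n\<^esub> inv\<^bsub>sym_group n\<^esub> (inv' g) \<otimes>\<^bsub>sym_group n\<^esub> h) =
        cv \<b> \<a> (inv\<^bsub>sym_group n\<^esub> h \<otimes>\<^bsub>sym_group n\<^esub> inv\<^bsub>sym_group n\<^esub> g \<otimes>\<^bsub>sym_group n\<^esub> h)"
      using g gi h by (simp add: sym_group_carrier sym_group_mult permutes_inv_inv[OF g])
  qed
  also have "\<dots> = G.ideal_char \<c> g"
    using G.ideal_char_conv_commute[of g \<b> \<a>] g by (simp add: sym_group_carrier young_symmetrizer_def)
  finally show ?thesis by (simp add: \<chi>_def idem_def ideal_char_fscale)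
qed

lemma \<chi>_real: "\<chi> g \<in> \<real>"
proof -
  have "cnj \<nu> = \<nu>" by (simp add: \<nu>_def cnj_conv cnj_young_symmetrizer)
  then have "cnj (\<chi> g) = \<chi> g"
    by (simp add: \<chi>_def G.ideal_char_def idem_def cnj_young_symmetrizer)
  then show ?thesis by (simp add: Reals_cnj_iff)
qed

text \<open>Brings the translates of the idempotent into the form \<open>x \<b>\<close>, to which
  \<open>row_conv\<close> and the vanishing of \<open>word_kernel\<close> apply.\<close>

lemma left_translation_idem:
  assumes "h \<in> carrier (sym_group n)"
  shows "left_translation (sym_group n) h idem =
    cv (fscale (1 / \<nu>) (left_translation (sym_group n) h \<a>)) \<b>"
proof -
  have "left_translation (sym_group n) h idem = fscale (1 / \<nu>) (left_translation (sym_group n) h (cv \<a> \<b>))"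
    by (simp add: idem_conv left_translation_def fun_eq_iff)
  then show ?thesis using assms by (simp add: G.conv_fscale_left G.conv_left_translation)
qed

text \<open>The sum is the trace of the stabilizer's indicator on the Specht module. By
  \<open>word_kernel_eq_0\<close> the indicator kills every product ending in the signed column sum,
  hence the whole ideal.\<close>

lemma sum_stab_\<chi>_eq_0:
  fixes f :: "nat \<Rightarrow> nat"
  assumes "\<And>g. g permutes {1..n} \<Longrightarrow> \<exists>k\<in>{1..n}. \<exists>k'\<in>{1..n}. k \<noteq> k' \<and> f k = f k' \<and> col (inv' g k) = col (inv' g k')"
  shows "(\<Sum>s\<in>stab {1..n} f. \<chi> s) = 0"
proof -
  have zero: "cv (stab_indicator {1..n} f) (cv x \<b>) = 0" for x
  proof (rule group_algebra_eqI)
    fix y assume y: "y permutes {1..n}"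
    have "word_kernel f g y = 0" if "g permutes {1..n}" for g
      using assms[OF that] word_kernel_eq_0[OF that y] by blast
    then show "cv (stab_indicator {1..n} f) (cv x \<b>) y = 0 y"
      unfolding conv_stab_indicator[OF y] by simp
  qed (simp_all add: group_algebra_def conv_def)
  have "(\<Sum>g\<in>carrier (sym_group n). stab_indicator {1..n} f g * \<chi> g) = 0"
    unfolding \<chi>_def G.sum_mult_ideal_char
    by (intro sum.neutral ballI) (simp only: left_translation_idem zero zero_fun_apply)
  moreover have "(\<Sum>g\<in>carrier (sym_group n). stab_indicator {1..n} f g * \<chi> g) = (\<Sum>s\<in>stab {1..n} f. \<chi> s)"
    unfolding carrier_eq stab_indicator_def
    by (intro sum.mono_neutral_cong_right) (auto simp: finite_permutations stab_def)
  ultimately show ?thesis by simp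
qed

text \<open>The row sum maps the ideal into the line of \<open>idem\<close> and multiplies
  \<open>idem\<close> by the order of the row group. In other words, the invariants of the row group
  are one-dimensional.\<close>

lemma sum_stab_row_\<chi>: "(\<Sum>s\<in>stab {1..n} row. \<chi> s) = of_nat (card (stab {1..n} row))"
proof -
  have "(\<Sum>g\<in>carrier (sym_group n). \<a> g * \<chi> g) = of_nat (card (stab {1..n} row))"
    unfolding \<chi>_def
  proof (rule G.sum_mult_ideal_char_eq[OF primitive_idempotent_idem])
    fix h assume h: "h \<in> carrier (sym_group n)"
    obtain l where "cv \<a> (left_translation (sym_group n) h idem) = fscale l \<c>"
      unfolding left_translation_idem[OF h] using row_conv by blast
    then have "cv \<a> (left_translation (sym_group n) h idem) = fscale (l * \<nu>) idem"
      using \<nu>_nz by (simp add: idem_def)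
    then show "\<exists>l. cv \<a> (left_translation (sym_group n) h idem) = fscale l idem" by blast
  next
    show "cv \<a> idem = fscale (of_nat (card (stab {1..n} row))) idem"
      by (simp add: idem_conv G.conv_fscale_right G.conv_assoc[symmetric] row_row G.conv_fscale_left mult.commute)
  qed
  moreover have "(\<Sum>g\<in>carrier (sym_group n). \<a> g * \<chi> g) = (\<Sum>s\<in>stab {1..n} row. \<chi> s)"
    unfolding carrier_eq row_sum_eq stab_indicator_def
    by (intro sum.mono_neutral_cong_right) (auto simp: finite_permutations stab_def)
  ultimately show ?thesis by simp
qed

text \<open>Multiplication by \<open>idem\<close> has rank one and eigenvalue 1 on its own ideal.
  Since \<chi> is a class function invariant under inversion, this trace becomes its norm.\<close>

lemma sum_\<chi>_\<chi>: "(\<Sum>g | g permutes {1..n}. \<chi> g * \<chi> g) = of_nat (fact n)"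
proof -
  have one: "(\<Sum>g\<in>carrier (sym_group n). idem g * \<chi> g) = 1"
    unfolding \<chi>_def
  proof (rule G.sum_mult_ideal_char_eq[OF primitive_idempotent_idem])
    note idem = primitive_idempotent_idem[unfolded G.primitive_idempotent_def]
    then show "cv idem idem = fscale 1 idem" by simp
    fix h assume h: "h \<in> carrier (sym_group n)"
    have "left_translation (sym_group n) h idem = cv (left_translation (sym_group n) h idem) idem"
      using idem by (simp add: G.conv_left_translation[OF h])
    then show "\<exists>l. cv idem (left_translation (sym_group n) h idem) = fscale l idem"
      using idem G.left_translation_in_group_algebra[of h idem] by metis
  qed
  have "(\<Sum>g\<in>carrier (sym_group n). G.ideal_char idem (inv\<^bsub>sym_group n\<^esub> g) * \<chi> g) =
      of_nat (order (sym_group n)) * (\<Sum>g\<in>carrier (sym_group n). idem g * \<chi> g)"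
    unfolding \<chi>_def by (rule G.sum_ideal_char_inv) (rule G.ideal_char_conj)
  moreover have "(\<Sum>g\<in>carrier (sym_group n). G.ideal_char idem (inv\<^bsub>sym_group n\<^esub> g) * \<chi> g) =
      (\<Sum>g | g permutes {1..n}. \<chi> g * \<chi> g)"
    unfolding carrier_eq
    by (intro sum.cong refl) (simp add: sym_group_carrier \<chi>_def[symmetric] \<chi>_inv)
  moreover have "order (sym_group n) = fact n"
    by (simp add: order_def carrier_eq card_permutations)
  ultimately show ?thesis using one by simp
qed

end

section \<open>Alternating sums over words\<close>

text \<open>The staircase is taken in the integers because vectors become negative when contents are
  subtracted.\<close>

definition delta :: "nat \<Rightarrow> nat \<Rightarrow> int" where
  "delta N i = int N - 1 - int i"

text \<open>
  \<open>alt N v\<close> is the sign of the permutation sorting \<open>v 0, \<dots>, v (N - 1)\<close> into the staircase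
  \<open>N - 1, \<dots>, 1, 0\<close>, and zero if there is none.
\<close>

definition alt :: "nat \<Rightarrow> (nat \<Rightarrow> int) \<Rightarrow> int" where
  "alt N v = (\<Sum>w | w permutes {..<N}. if \<forall>i<N. v i = delta N (w i) then sign w else 0)"

lemma alt_cong: "(\<And>i. i < N \<Longrightarrow> v i = v' i) \<Longrightarrow> alt N v = alt N v'"
  by (simp add: alt_def)

lemma alt_permute:
  assumes \<tau>: "\<tau> permutes {..<N}"
  shows "alt N (\<lambda>i. v (\<tau> i)) = sign \<tau> * alt N v"
proof -
  have "alt N (\<lambda>i. v (\<tau> i)) = (\<Sum>w | w permutes {..<N}. if \<forall>i<N. v (\<tau> i) = delta N ((w \<circ> \<tau>) i) then sign (w \<circ> \<tau>) else 0)"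
    unfolding alt_def
    by (rule sum_permutations_compose_right[OF \<tau>])
  also have "\<dots> = (\<Sum>w | w permutes {..<N}. sign \<tau> * (if \<forall>i<N. v i = delta N (w i) then sign w else 0))"
  proof (rule sum.cong[OF refl])
    fix w assume "w \<in> {w. w permutes {..<N}}"
    then have w: "w permutes {..<N}" by simp
    have "(\<forall>i\<in>{..<N}. v (\<tau> i) = delta N (w (\<tau> i))) \<longleftrightarrow> (\<forall>i\<in>\<tau> ` {..<N}. v i = delta N (w i))"
      by blast
    then have "(\<forall>i<N. v (\<tau> i) = delta N ((w \<circ> \<tau>) i)) \<longleftrightarrow> (\<forall>i<N. v i = delta N (w i))"
      using permutes_image[OF \<tau>] by (simp add: Ball_def)
    moreover have "sign (w \<circ> \<tau>) = sign \<tau> * sign w"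
      using w \<tau> by (subst sign_compose) (auto simp: permutation_permutes)
    ultimately show "(if \<forall>i<N. v (\<tau> i) = delta N ((w \<circ> \<tau>) i) then sign (w \<circ> \<tau>) else 0) =
        sign \<tau> * (if \<forall>i<N. v i = delta N (w i) then sign w else 0)" by simp
  qed
  finally show ?thesis by (simp add: alt_def sum_distrib_left)
qed

lemma alt_negative: "i < N \<Longrightarrow> v i < 0 \<Longrightarrow> alt N v = 0"
  unfolding alt_def
proof (intro sum.neutral ballI)
  fix w assume "i < N" "v i < 0" "w \<in> {w. w permutes {..<N}}"
  then have "w i < N" using permutes_in_image[of w "{..<N}" i] by simp
  then have "v i \<noteq> delta N (w i)" using \<open>v i < 0\<close> by (simp add: delta_def)
  then show "(if \<forall>i<N. v i = delta N (w i) then sign w else 0) = 0" using \<open>i < N\<close> by auto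
qed

lemma alt_delta: "alt N (delta N) = 1"
proof -
  have "w = id" if "w permutes {..<N}" "\<forall>i<N. delta N i = delta N (w i)" for w
  proof
    fix i show "w i = id i"
      using that permutes_not_in[OF that(1), of i] by (cases "i < N") (auto simp: delta_def)
  qed
  then have "alt N (delta N) = (\<Sum>w | w permutes {..<N}. if w = id then 1 else 0)"
    unfolding alt_def by (intro sum.cong refl) auto
  then show ?thesis by (simp add: finite_permutations permutes_id)
qed

lemma alt_nonzero:
  assumes "alt N v \<noteq> 0"
  obtains w where "w permutes {..<N}" "\<And>i. i < N \<Longrightarrow> v i = delta N (w i)"
proof -
  obtain w where "w permutes {..<N}" "(if \<forall>i<N. v i = delta N (w i) then sign w else 0) \<noteq> 0"
    using assms unfolding alt_def by (elim sum.not_neutral_contains_not_neutral) auto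
  then show thesis using that by (metis (no_types, lifting))
qed

definition comps :: "nat \<Rightarrow> nat \<Rightarrow> (nat \<Rightarrow> nat) set" where
  "comps N p = {x \<in> {..<N} \<rightarrow>\<^sub>E {..p}. (\<Sum>i<N. x i) = p}"

lemma finite_comps: "finite (comps N p)"
  by (rule finite_subset[of _ "{..<N} \<rightarrow>\<^sub>E {..p}"]) (auto simp: comps_def finite_PiE)

lemma comps_iff: "x \<in> comps N p \<longleftrightarrow> x \<in> extensional {..<N} \<and> (\<Sum>i<N. x i) = p"
proof -
  have "x i \<le> (\<Sum>i<N. x i)" if "i < N" for i using that by (intro member_le_sum) auto
  then show ?thesis by (auto simp: comps_def PiE_iff)
qed

text \<open>The pairing of an alternating sum with a permutation character, one letter at a time.\<close>

fun pieri :: "nat \<Rightarrow> nat \<Rightarrow> (nat \<Rightarrow> nat) \<Rightarrow> (nat \<Rightarrow> int) \<Rightarrow> int" where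
  "pieri N 0 a v = alt N v"
| "pieri N (Suc k) a v = (\<Sum>x\<in>comps N (a k). pieri N k a (\<lambda>i. v i - int (x i)))"

lemma pieri_cong: "(\<And>i. i < N \<Longrightarrow> v i = v' i) \<Longrightarrow> pieri N k a v = pieri N k a v'"
proof (induction k arbitrary: v v')
  case 0 show ?case unfolding pieri.simps by (rule alt_cong) (rule 0)
next
  case (Suc k)
  show ?case unfolding pieri.simps by (intro sum.cong refl Suc.IH) (simp add: Suc.prems)
qed

lemma pieri_cong_content: "(\<And>i. i < k \<Longrightarrow> a i = a' i) \<Longrightarrow> pieri N k a v = pieri N k a' v"
  by (induction k arbitrary: v) auto

lemma pieri_permute:
  assumes \<tau>: "\<tau> permutes {..<N}"
  shows "pieri N k a (\<lambda>i. v (\<tau> i)) = sign \<tau> * pieri N k a v"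
proof (induction k arbitrary: v)
  case 0 show ?case by (simp add: alt_permute[OF \<tau>])
next
  case (Suc k)
  have ext: "(\<lambda>i. x (\<sigma> i)) \<in> comps N p" if x: "x \<in> comps N p" and \<sigma>: "\<sigma> permutes {..<N}" for x \<sigma> p
  proof -
    have "x (\<sigma> i) = undefined" if "i \<notin> {..<N}" for i
      using that x permutes_not_in[OF \<sigma> that] by (simp add: comps_iff extensional_def)
    moreover have "(\<Sum>i<N. x (\<sigma> i)) = (\<Sum>i<N. x i)"
      using sum.permute[OF \<sigma>, of x] by (simp add: comp_def)
    ultimately show ?thesis using x by (simp add: comps_iff extensional_def)
  qed
  have "pieri N (Suc k) a (\<lambda>i. v (\<tau> i)) =
      (\<Sum>x\<in>comps N (a k). pieri N k a (\<lambda>i. v (\<tau> i) - int (x (\<tau> i))))"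
    unfolding pieri.simps
    by (rule sum.reindex_bij_witness[where i="\<lambda>x i. x (\<tau> i)" and j="\<lambda>x i. x (inv' \<tau> i)"])
       (auto simp: ext \<tau> permutes_inv permutes_inverses[OF \<tau>])
  also have "\<dots> = (\<Sum>x\<in>comps N (a k). sign \<tau> * pieri N k a (\<lambda>i. v i - int (x i)))"
    by (intro sum.cong refl) (rule Suc.IH)
  finally show ?case by (simp add: sum_distrib_left)
qed

lemma pieri_negative: "i < N \<Longrightarrow> v i < 0 \<Longrightarrow> pieri N k a v = 0"
proof (induction k arbitrary: v)
  case 0 then show ?case by (simp add: alt_negative)
next
  case (Suc k)
  show ?case unfolding pieri.simps
    by (intro sum.neutral ballI Suc.IH) (use Suc.prems in auto)
qed

section \<open>Horizontal strips and Kostka numbers\<close>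

definition strict_dec :: "nat \<Rightarrow> (nat \<Rightarrow> int) \<Rightarrow> bool" where
  "strict_dec N v \<longleftrightarrow> (\<forall>i. Suc i < N \<longrightarrow> v (Suc i) < v i)"

text \<open>For \<open>v = lam + delta\<close> the condition reads
  \<open>lam (i + 1) \<le> lam i - x i\<close>: no removed cell lies above a cell of the next row of
  \<open>lam\<close>, so the removed cells form a horizontal strip. Excess in the last row is caught
  by \<open>pieri_negative\<close>.\<close>

definition horizontal :: "nat \<Rightarrow> (nat \<Rightarrow> int) \<Rightarrow> (nat \<Rightarrow> nat) \<Rightarrow> bool" where
  "horizontal N v x \<longleftrightarrow> (\<forall>i. Suc i < N \<longrightarrow> v (Suc i) < v i - int (x i))"

text \<open>
  The terms that are not horizontal strips cancel: at the first row \<open>i\<close> where the strip condition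
  fails, exchange the remaining entries in the rows \<open>i\<close> and \<open>i + 1\<close>.
\<close>

lemma pieri_horizontal:
  assumes v: "strict_dec N v"
  shows "pieri N (Suc k) a v =
    (\<Sum>x | x \<in> comps N (a k) \<and> horizontal N v x. pieri N k a (\<lambda>i. v i - int (x i)))"
proof -
  define viol where "viol x i \<longleftrightarrow> Suc i < N \<and> v i - int (x i) \<le> v (Suc i)" for x :: "nat \<Rightarrow> nat" and i
  define bad where "bad i = {x \<in> comps N (a k). viol x i \<and> (\<forall>j<i. \<not> viol x j)}" for i
  \<comment> \<open>The values are chosen so that subtracting \<open>\<phi> i x\<close> from
    \<open>v\<close> exchanges the entries \<open>i\<close> and \<open>i + 1\<close> left by
    \<open>x\<close>. On \<open>bad i\<close> both arguments of \<open>nat\<close> are nonnegative: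
    the first because \<open>v\<close> decreases, the second because row \<open>i\<close> is
    violated. Rows before \<open>i\<close> keep their entries in \<open>x\<close>.\<close>
  define \<phi> where "\<phi> i x = x(i := nat (v i - v (Suc i) + int (x (Suc i))),
      Suc i := nat (v (Suc i) - v i + int (x i)))" for i and x :: "nat \<Rightarrow> nat"
  define g where "g x = pieri N k a (\<lambda>i. v i - int (x i))" for x :: "nat \<Rightarrow> nat"
  have g_bad: "(\<Sum>x\<in>bad i. g x) = 0" for i
  proof -
    have iN: "Suc i < N" if "x \<in> bad i" for x using that by (simp add: bad_def viol_def)
    have at_i: "int (\<phi> i x i) = v i - v (Suc i) + int (x (Suc i))"
      and at_Suc: "int (\<phi> i x (Suc i)) = v (Suc i) - v i + int (x i)" if x: "x \<in> bad i" for x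
    proof -
      have "v (Suc i) < v i" using v iN[OF x] by (simp add: strict_dec_def)
      then show "int (\<phi> i x i) = v i - v (Suc i) + int (x (Suc i))" by (simp add: \<phi>_def)
      show "int (\<phi> i x (Suc i)) = v (Suc i) - v i + int (x i)"
        using x by (simp add: \<phi>_def bad_def viol_def)
    qed
    have other: "\<phi> i x j = x j" if "j \<noteq> i" "j \<noteq> Suc i" for x j using that by (simp add: \<phi>_def)
    have \<phi>_bad: "\<phi> i x \<in> bad i" if x: "x \<in> bad i" for x
    proof -
      have eq: "int (\<Sum>j<N. y j) = int (y i) + int (y (Suc i)) + (\<Sum>j\<in>{..<N} - {i, Suc i}. int (y j))"
        for y :: "nat \<Rightarrow> nat"
        using iN[OF x] sum.remove[of "{..<N}" i "\<lambda>j. int (y j)"]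
          sum.remove[of "{..<N} - {i}" "Suc i" "\<lambda>j. int (y j)"]
        by (simp add: Diff_insert2[symmetric])
      have "int (\<Sum>j<N. \<phi> i x j) = int (\<Sum>j<N. x j)"
        unfolding eq at_i[OF x] at_Suc[OF x] by (auto simp: other intro!: sum.cong)
      then have "(\<Sum>j<N. \<phi> i x j) = (\<Sum>j<N. x j)" by (rule of_nat_eq_iff[THEN iffD1])
      moreover have "\<phi> i x \<in> extensional {..<N}"
        using x iN[OF x] by (auto simp: bad_def comps_iff extensional_def \<phi>_def)
      ultimately have "\<phi> i x \<in> comps N (a k)" using x by (simp add: bad_def comps_iff)
      moreover have "viol (\<phi> i x) i"
        using x at_i[OF x] iN[OF x] by (simp add: viol_def)
      moreover have "\<not> viol (\<phi> i x) j" if "j < i" for j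
        using x that other[of j x] by (auto simp: bad_def viol_def)
      ultimately show ?thesis by (simp add: bad_def)
    qed
    have \<phi>\<phi>: "\<phi> i (\<phi> i x) = x" if x: "x \<in> bad i" for x
    proof
      fix j
      have "int (\<phi> i (\<phi> i x) i) = int (x i)" "int (\<phi> i (\<phi> i x) (Suc i)) = int (x (Suc i))"
        using at_i[OF x] at_Suc[OF x] at_i[OF \<phi>_bad[OF x]] at_Suc[OF \<phi>_bad[OF x]] by simp_all
      then show "\<phi> i (\<phi> i x) j = x j" using other by (cases "j = i \<or> j = Suc i") auto
    qed
    have g_\<phi>: "g (\<phi> i x) = - g x" if x: "x \<in> bad i" for x
    proof -
      let ?t = "transpose i (Suc i)"
      have t: "?t permutes {..<N}" using iN[OF x] by (intro permutes_swap_id) auto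
      have "v j - int (\<phi> i x j) = v (?t j) - int (x (?t j))" for j
        using at_i[OF x] at_Suc[OF x] other[of j x] by (auto simp: transpose_def)
      then show ?thesis
        using pieri_permute[OF t, of k a "\<lambda>j. v j - int (x j)"] by (simp add: g_def sign_swap_id)
    qed
    have "(\<Sum>x\<in>bad i. g x) = (\<Sum>x\<in>bad i. g (\<phi> i x))"
      by (rule sum.reindex_bij_witness[where i="\<phi> i" and j="\<phi> i"]) (auto simp: \<phi>\<phi> \<phi>_bad)
    also have "\<dots> = - (\<Sum>x\<in>bad i. g x)" by (simp add: g_\<phi> sum_negf)
    finally show ?thesis by simp
  qed
  have fin: "finite (comps N (a k))" by (rule finite_comps)
  have split: "{x \<in> comps N (a k). \<not> horizontal N v x} = (\<Union>i<N. bad i)"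
  proof (intro equalityI subsetI)
    fix x assume x: "x \<in> {x \<in> comps N (a k). \<not> horizontal N v x}"
    then have "\<exists>i. viol x i" by (auto simp: horizontal_def viol_def not_less)
    then obtain L where L: "viol x L" "\<And>j. j < L \<Longrightarrow> \<not> viol x j"
      using exists_least_iff[of "viol x"] by blast
    then have "x \<in> bad L" using x by (simp add: bad_def)
    moreover have "L < N" using L(1) by (simp add: viol_def)
    ultimately show "x \<in> (\<Union>i<N. bad i)" by blast
  qed (auto simp: bad_def viol_def horizontal_def not_less)
  have "(\<Sum>x | x \<in> comps N (a k) \<and> \<not> horizontal N v x. g x) = (\<Sum>i<N. \<Sum>x\<in>bad i. g x)"
    unfolding split
  proof (rule sum.UNION_disjoint)
    show "\<forall>i\<in>{..<N}. \<forall>j\<in>{..<N}. i \<noteq> j \<longrightarrow> bad i \<inter> bad j = {}"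
      by (auto simp: bad_def) (metis linorder_neqE_nat)
  qed (auto simp: bad_def fin)
  then have zero: "(\<Sum>x | x \<in> comps N (a k) \<and> \<not> horizontal N v x. g x) = 0" by (simp add: g_bad)
  have "pieri N (Suc k) a v = (\<Sum>x\<in>comps N (a k). g x)" by (simp add: g_def)
  also have "\<dots> = (\<Sum>x | x \<in> comps N (a k) \<and> horizontal N v x. g x) +
      (\<Sum>x | x \<in> comps N (a k) \<and> \<not> horizontal N v x. g x)"
    by (subst sum.union_disjoint[symmetric]) (auto simp: fin intro!: sum.cong)
  finally show ?thesis using zero by (simp add: g_def)
qed

lemma strict_dec_horizontal:
  assumes "strict_dec N v" "horizontal N v x"
  shows "strict_dec N (\<lambda>i. v i - int (x i))"
  unfolding strict_dec_def
proof (intro allI impI)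
  fix i assume "Suc i < N"
  then have "v (Suc i) < v i - int (x i)" using assms(2) by (simp add: horizontal_def)
  then show "v (Suc i) - int (x (Suc i)) < v i - int (x i)" by simp
qed

lemma strict_dec_ge_delta:
  assumes v: "strict_dec N v" and nn: "\<And>i. i < N \<Longrightarrow> 0 \<le> v i" and i: "i < N"
  shows "delta N i \<le> v i"
proof -
  have "delta N (N - 1 - j) \<le> v (N - 1 - j)" if "j < N" for j
    using that
  proof (induction j)
    case 0 then show ?case using nn[of "N - 1"] by (simp add: delta_def)
  next
    case (Suc j)
    have eq: "Suc (N - 1 - Suc j) = N - 1 - j" using Suc.prems by simp
    have "v (N - 1 - j) < v (N - 1 - Suc j)"
      using v[unfolded strict_dec_def, rule_format, of "N - 1 - Suc j"] Suc.prems unfolding eq by simp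
    then show ?case using Suc by (simp add: delta_def)
  qed
  from this[of "N - 1 - i"] show ?thesis using i by simp
qed

text \<open>A strictly decreasing nonnegative vector lies entrywise above the staircase; a
  rearrangement of the staircase has the same sum, so the two coincide.\<close>

lemma alt_strict_dec:
  assumes v: "strict_dec N v" and nz: "alt N v \<noteq> 0" and i: "i < N"
  shows "v i = delta N i"
proof -
  obtain w where w: "w permutes {..<N}" "\<And>i. i < N \<Longrightarrow> v i = delta N (w i)"
    using nz by (rule alt_nonzero) blast
  have nn: "0 \<le> v i" if "i < N" for i
    using w(2)[OF that] permutes_in_image[OF w(1), of i] that by (simp add: delta_def)
  have ge: "delta N i \<le> v i" if "i < N" for i by (rule strict_dec_ge_delta[OF v nn that])
  have "(\<Sum>i<N. v i) = (\<Sum>i<N. delta N (w i))" using w(2) by simp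
  also have "\<dots> = (\<Sum>i<N. delta N i)" using sum.permute[OF w(1), of "delta N"] by (simp add: comp_def)
  finally have "(\<Sum>i<N. delta N i) = (\<Sum>i<N. v i)" by simp
  then show ?thesis
    using sum_mono_inv[of "delta N" "{..<N}" v i] ge i by simp
qed

text \<open>By \<open>pieri_horizontal\<close> a nonzero value exhibits a chain of horizontal
  strips, that is, a semistandard tableau of shape \<open>v - delta\<close> and content
  \<open>a\<close>. Its letters below \<open>j\<close> lie in the first \<open>j\<close> rows. The
  length and the size of the shape are carried along for the induction.\<close>

lemma pieri_dominated:
  assumes "strict_dec N v" "pieri N k a v \<noteq> 0" "k \<le> N"
  shows "(\<forall>j\<le>k. int (psum a j) \<le> (\<Sum>i<j. v i - delta N i)) \<and> (\<forall>i. k \<le> i \<and> i < N \<longrightarrow> v i = delta N i) \<and>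
    int (psum a k) = (\<Sum>i<N. v i - delta N i)"
  using assms
proof (induction k arbitrary: v)
  case 0
  then have "v i = delta N i" if "i < N" for i using alt_strict_dec[of N v i] that by simp
  then show ?case by (simp add: psum_def)
next
  case (Suc k)
  obtain x where x: "x \<in> comps N (a k)" "horizontal N v x" and nz: "pieri N k a (\<lambda>i. v i - int (x i)) \<noteq> 0"
    using Suc.prems(2) unfolding pieri_horizontal[OF Suc.prems(1)]
    by (elim sum.not_neutral_contains_not_neutral) auto
  note IH = Suc.IH[OF strict_dec_horizontal[OF Suc.prems(1) x(2)] nz]
  have k: "k \<le> N" using Suc.prems by simp
  have nn: "0 \<le> v i" if "i < N" for i
    using pieri_negative[OF that, of v "Suc k" a] Suc.prems(2) by linarith
  \<comment> \<open>Once the strip is removed at most \<open>k\<close> rows remain, and the strip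
    condition at row \<open>i'\<close> bounds row \<open>i' + 1\<close> by the staircase. Strict
    decrease gives the opposite inequality.\<close>
  have tail: "v i = delta N i" if i: "Suc k \<le> i" "i < N" for i
  proof -
    obtain i' where i': "i = Suc i'" using i by (cases i) auto
    have "v i < v i' - int (x i')" using x(2) i i' by (simp add: horizontal_def)
    moreover have "v i' - int (x i') = delta N i'" using IH k i i' by auto
    ultimately show ?thesis
      using strict_dec_ge_delta[OF Suc.prems(1) nn i(2)] i' by (simp add: delta_def)
  qed
  have total: "int (psum a (Suc k)) = (\<Sum>i<N. v i - delta N i)"
  proof -
    have "int (psum a (Suc k)) = (\<Sum>i<N. v i - int (x i) - delta N i) + int (\<Sum>i<N. x i)"
      using IH k x(1) by (simp add: psum_Suc comps_iff)
    then show ?thesis by (simp add: sum_subtractf)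
  qed
  have "int (psum a j) \<le> (\<Sum>i<j. v i - delta N i)" if j: "j \<le> Suc k" for j
  proof (cases "j = Suc k")
    case True
    have "(\<Sum>i<N. v i - delta N i) = (\<Sum>i<Suc k. v i - delta N i)"
      using Suc.prems(3) tail by (intro sum.mono_neutral_right) auto
    then show ?thesis using total True by simp
  next
    case False
    then have "int (psum a j) \<le> (\<Sum>i<j. v i - int (x i) - delta N i)" using IH k j by auto
    also have "\<dots> \<le> (\<Sum>i<j. v i - delta N i)" by (intro sum_mono) simp
    finally show ?thesis .
  qed
  then show ?case using tail total by blast
qed

text \<open>The Kostka number with equal shape and content is one: the letter \<open>k\<close> must
  fill exactly row \<open>k\<close>.\<close>

lemma pieri_diagonal:
  assumes "k \<le> N" "\<And>i. i < k \<Longrightarrow> v i = int (a i) + delta N i" "\<And>i. k \<le> i \<Longrightarrow> i < N \<Longrightarrow> v i = delta N i"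
    and "strict_dec N v"
  shows "pieri N k a v = 1"
  using assms
proof (induction k arbitrary: v)
  case 0
  then show ?case using alt_cong[of N v "delta N"] by (simp add: alt_delta)
next
  case (Suc k)
  have kN: "k < N" using Suc.prems by simp
  define x0 where "x0 = (\<lambda>i\<in>{..<N}. if i = k then a k else 0)"
  have x0_sum: "x0 \<in> comps N (a k)" using kN by (simp add: comps_iff x0_def)
  have only: "x = x0" if x: "x \<in> comps N (a k)" "horizontal N v x"
    and nz: "pieri N k a (\<lambda>i. v i - int (x i)) \<noteq> 0" for x
  proof -
    \<comment> \<open>The first \<open>k\<close> rows hold just as many cells as there are letters
      below \<open>k\<close>, so a strip taking a cell from them would violate dominance for what
      remains. The rows after \<open>k\<close> are already at the staircase.\<close>
    have dom: "int (psum a j) \<le> (\<Sum>i<j. v i - int (x i) - delta N i)" if "j \<le> k" for j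
      using pieri_dominated[OF strict_dec_horizontal[OF Suc.prems(4) x(2)] nz] kN that by auto
    have "(\<Sum>i<k. v i - int (x i) - delta N i) = int (psum a k) - int (\<Sum>i<k. x i)"
      using Suc.prems(2) by (simp add: psum_def sum_subtractf)
    then have "int (\<Sum>i<k. x i) \<le> 0" using dom[of k] by linarith
    then have "(\<Sum>i<k. x i) = 0" by (simp only: of_nat_le_0_iff)
    then have low: "x i = 0" if "i < k" for i using that by simp
    have high: "x i = 0" if "Suc k \<le> i" "i < N" for i
    proof -
      have "v i - int (x i) = delta N i"
        using pieri_dominated[OF strict_dec_horizontal[OF Suc.prems(4) x(2)] nz] kN that by auto
      then show ?thesis using Suc.prems(3)[OF that] by simp
    qed
    have "x i = 0" if "i < N" "i \<noteq> k" for i using low[of i] high[of i] that by linarith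
    moreover from this have "(\<Sum>i<N. x i) = x k"
      using kN by (subst sum.remove[of _ k]) auto
    ultimately show "x = x0"
      using x(1) by (auto simp: x0_def comps_iff extensional_def fun_eq_iff)
  qed
  have hor: "horizontal N v x0"
    unfolding horizontal_def
  proof (intro allI impI)
    fix i assume i: "Suc i < N"
    show "v (Suc i) < v i - int (x0 i)"
    proof (cases "i = k")
      case True
      then show ?thesis using i Suc.prems(2)[of k] Suc.prems(3)[of "Suc k"] by (simp add: x0_def delta_def)
    next
      case False
      then show ?thesis using i Suc.prems(4) by (simp add: x0_def strict_dec_def)
    qed
  qed
  have "pieri N (Suc k) a v = (\<Sum>x\<in>{x0}. pieri N k a (\<lambda>i. v i - int (x i)))"
    unfolding pieri_horizontal[OF Suc.prems(4)]
  proof (rule sum.mono_neutral_right)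
    show "\<forall>x\<in>{x. x \<in> comps N (a k) \<and> horizontal N v x} - {x0}. pieri N k a (\<lambda>i. v i - int (x i)) = 0"
      using only by blast
  qed (use x0_sum hor in \<open>simp_all add: finite_comps\<close>)
  also have "pieri N k a (\<lambda>i. v i - int (x0 i)) = 1"
  proof (rule Suc.IH)
    show "v i - int (x0 i) = int (a i) + delta N i" if "i < k" for i
      using that kN Suc.prems(2)[of i] by (simp add: x0_def)
    show "v i - int (x0 i) = delta N i" if "k \<le> i" "i < N" for i
      using that Suc.prems(2)[of i] Suc.prems(3)[of i] by (cases "i = k") (simp_all add: x0_def)
  qed (use kN strict_dec_horizontal[OF Suc.prems(4) hor] in simp_all)
  then have "(\<Sum>x\<in>{x0}. pieri N k a (\<lambda>i. v i - int (x i))) = 1" by simp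
  finally show ?case .
qed

section \<open>Invariant words and their alternating sum\<close>

definition words :: "nat \<Rightarrow> 'a set \<Rightarrow> ('a \<Rightarrow> nat) set" where
  "words N A = A \<rightarrow>\<^sub>E {..<N}"

definition inv_words :: "nat \<Rightarrow> 'a set \<Rightarrow> ('a \<Rightarrow> 'a) \<Rightarrow> ('a \<Rightarrow> nat) set" where
  "inv_words N A \<sigma> = {f \<in> words N A. \<forall>k\<in>A. f (\<sigma> k) = f k}"

definition content :: "'a set \<Rightarrow> ('a \<Rightarrow> nat) \<Rightarrow> nat \<Rightarrow> nat" where
  "content A f i = card {k\<in>A. f k = i}"

text \<open>
  For \<open>u i = lam i + N - 1 - i\<close> this is Frobenius' formula for the character of shape \<open>lam\<close>: it is the
  determinantal alternating sum of permutation characters on words with prescribed content.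
\<close>

definition frob :: "nat \<Rightarrow> 'a set \<Rightarrow> (nat \<Rightarrow> int) \<Rightarrow> ('a \<Rightarrow> 'a) \<Rightarrow> int" where
  "frob N A u \<sigma> = (\<Sum>f\<in>inv_words N A \<sigma>. alt N (\<lambda>i. u i - int (content A f i)))"

lemma finite_words: "finite A \<Longrightarrow> finite (words N A)"
  by (simp add: words_def finite_PiE)

lemma sum_content:
  assumes "finite A" "f \<in> words N A"
  shows "(\<Sum>i<N. content A f i) = card A"
proof -
  have "A = (\<Union>i<N. {k\<in>A. f k = i})" using assms(2) by (auto simp: words_def PiE_iff)
  moreover have "card (\<Union>i<N. {k\<in>A. f k = i}) = (\<Sum>i<N. card {k\<in>A. f k = i})"
    using assms(1) by (intro card_UN_disjoint) auto
  ultimately show ?thesis by (simp add: content_def)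
qed

lemma frob_cong: "(\<And>i. i < N \<Longrightarrow> u i = v i) \<Longrightarrow> frob N A u \<sigma> = frob N A v \<sigma>"
  unfolding frob_def by (intro sum.cong refl alt_cong) simp

text \<open>Renaming the letters by \<open>\<tau>\<close> permutes the content of a word, so a
  permutation of the vector can be undone inside the sum over invariant words. What remains is the
  sign from \<open>alt_permute\<close>.\<close>

lemma frob_permute:
  assumes \<tau>: "\<tau> permutes {..<N}" and \<sigma>: "\<sigma> ` A \<subseteq> A"
  shows "frob N A (\<lambda>i. u (\<tau> i)) \<sigma> = sign \<tau> * frob N A u \<sigma>"
proof -
  have tau_in: "\<tau> i < N \<longleftrightarrow> i < N" for i using permutes_in_image[OF \<tau>, of i] by simp
  have tau_inv_in: "inv' \<tau> i < N \<longleftrightarrow> i < N" for i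
    using permutes_in_image[OF permutes_inv[OF \<tau>], of i] by simp
  have content: "content A (\<lambda>k\<in>A. \<tau> (f k)) (\<tau> i) = content A f i" for f i
    unfolding content_def by (rule arg_cong[where f=card]) (auto dest: injD[OF permutes_inj[OF \<tau>]])
  have eq: "alt N (\<lambda>i. u (\<tau> i) - int (content A f i)) =
      sign \<tau> * alt N (\<lambda>i. u i - int (content A (\<lambda>k\<in>A. \<tau> (f k)) i))" for f
    using alt_permute[OF \<tau>, of "\<lambda>i. u i - int (content A (\<lambda>k\<in>A. \<tau> (f k)) i)"] by (simp add: content)
  have "frob N A (\<lambda>i. u (\<tau> i)) \<sigma> =
      (\<Sum>f\<in>inv_words N A \<sigma>. sign \<tau> * alt N (\<lambda>i. u i - int (content A (\<lambda>k\<in>A. \<tau> (f k)) i)))"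
    by (simp add: frob_def eq)
  also have "\<dots> = (\<Sum>f\<in>inv_words N A \<sigma>. sign \<tau> * alt N (\<lambda>i. u i - int (content A f i)))"
  proof (rule sum.reindex_bij_witness[where j="\<lambda>f. \<lambda>k\<in>A. \<tau> (f k)" and i="\<lambda>f. \<lambda>k\<in>A. inv' \<tau> (f k)"])
    fix f assume f: "f \<in> inv_words N A \<sigma>"
    have f_in: "f k < N" if "k \<in> A" for k using f that by (auto simp: inv_words_def words_def)
    have f_ext: "f \<in> extensional A" using f by (auto simp: inv_words_def words_def PiE_iff)
    show "(\<lambda>k\<in>A. inv' \<tau> ((\<lambda>k\<in>A. \<tau> (f k)) k)) = f" "(\<lambda>k\<in>A. \<tau> ((\<lambda>k\<in>A. inv' \<tau> (f k)) k)) = f"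
      using f_ext permutes_inverses[OF \<tau>] by (auto simp: fun_eq_iff extensional_def)
    have f_\<sigma>: "f (\<sigma> k) = f k" "\<sigma> k \<in> A" if "k \<in> A" for k using f that \<sigma> by (auto simp: inv_words_def)
    then show "(\<lambda>k\<in>A. \<tau> (f k)) \<in> inv_words N A \<sigma>" "(\<lambda>k\<in>A. inv' \<tau> (f k)) \<in> inv_words N A \<sigma>"
      using f_in by (auto simp: inv_words_def words_def tau_in tau_inv_in)
  qed simp
  finally show ?thesis by (simp add: frob_def sum_distrib_left)
qed

lemma frob_eq_entries:
  assumes "i < N" "j < N" "i \<noteq> j" "v i = v j" "\<sigma> ` A \<subseteq> A"
  shows "frob N A v \<sigma> = 0"
proof -
  have "(\<lambda>l. v (transpose i j l)) = v" using assms by (auto simp: transpose_def)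
  moreover have "transpose i j permutes {..<N}" using assms by (intro permutes_swap_id) auto
  ultimately show ?thesis
    using frob_permute[of "transpose i j" N \<sigma> A v] assms by (simp add: sign_swap_id)
qed

lemma frob_negative:
  assumes "i < N" "v i < 0"
  shows "frob N A v \<sigma> = 0"
  unfolding frob_def using assms by (intro sum.neutral ballI alt_negative[of i]) auto

text \<open>An invariant word on a disjoint union is a pair of invariant words, and contents add.
  This replaces the branching rule: the pieces are indexed by words on \<open>A1\<close>,
  independently of \<open>u\<close>, but their vectors need not come from partitions.\<close>

lemma frob_split:
  assumes fin: "finite A1" "finite A2" and disj: "A1 \<inter> A2 = {}"
    and \<sigma>1: "\<And>k. k \<in> A1 \<Longrightarrow> \<sigma> k = \<sigma>1 k \<and> \<sigma>1 k \<in> A1" and \<sigma>2: "\<And>k. k \<in> A2 \<Longrightarrow> \<sigma> k = \<sigma>2 k \<and> \<sigma>2 k \<in> A2"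
  shows "frob N (A1 \<union> A2) u \<sigma> = (\<Sum>w\<in>inv_words N A1 \<sigma>1. frob N A2 (\<lambda>i. u i - int (content A1 w i)) \<sigma>2)"
proof -
  have "(\<Sum>w\<in>inv_words N A1 \<sigma>1. frob N A2 (\<lambda>i. u i - int (content A1 w i)) \<sigma>2) =
      (\<Sum>p\<in>inv_words N A1 \<sigma>1 \<times> inv_words N A2 \<sigma>2.
        alt N (\<lambda>i. u i - int (content A1 (fst p) i) - int (content A2 (snd p) i)))"
    by (simp add: frob_def sum.cartesian_product split_def)
  also have "\<dots> = (\<Sum>f\<in>inv_words N (A1 \<union> A2) \<sigma>. alt N (\<lambda>i. u i - int (content (A1 \<union> A2) f i)))"
  proof (rule sum.reindex_bij_witness[where i="\<lambda>f. (restrict f A1, restrict f A2)"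
        and j="\<lambda>p k. if k \<in> A1 then fst p k else snd p k"])
    fix p assume p: "p \<in> inv_words N A1 \<sigma>1 \<times> inv_words N A2 \<sigma>2"
    then obtain f g where fg: "p = (f, g)" "f \<in> A1 \<rightarrow>\<^sub>E {..<N}" "g \<in> A2 \<rightarrow>\<^sub>E {..<N}"
      "\<And>k. k \<in> A1 \<Longrightarrow> f (\<sigma>1 k) = f k" "\<And>k. k \<in> A2 \<Longrightarrow> g (\<sigma>2 k) = g k"
      by (auto simp: inv_words_def words_def)
    let ?h = "\<lambda>k. if k \<in> A1 then fst p k else snd p k"
    have notin: "k \<notin> A1" if "k \<in> A2" for k using that disj by auto
    show "(restrict ?h A1, restrict ?h A2) = p"
      using fg(2,3) notin by (auto simp: fg(1) fun_eq_iff PiE_iff extensional_def)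
    show "?h \<in> inv_words N (A1 \<union> A2) \<sigma>"
      using fg(2-5) notin \<sigma>1 \<sigma>2 by (auto simp: fg(1) inv_words_def words_def PiE_iff extensional_def)
    have "{k \<in> A1 \<union> A2. ?h k = i} = {k\<in>A1. f k = i} \<union> {k\<in>A2. g k = i}" for i
      using notin by (auto simp: fg(1))
    then have "content (A1 \<union> A2) ?h i = content A1 f i + content A2 g i" for i
      unfolding content_def using fin disj by (simp only:) (rule card_Un_disjoint, auto)
    then show "alt N (\<lambda>i. u i - int (content (A1 \<union> A2) ?h i)) =
        alt N (\<lambda>i. u i - int (content A1 (fst p) i) - int (content A2 (snd p) i))"
      by (simp add: fg(1) algebra_simps)
  next
    fix f assume f: "f \<in> inv_words N (A1 \<union> A2) \<sigma>"
    then have f': "f \<in> A1 \<union> A2 \<rightarrow>\<^sub>E {..<N}" "\<And>k. k \<in> A1 \<union> A2 \<Longrightarrow> f (\<sigma> k) = f k"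
      by (auto simp: inv_words_def words_def)
    show "(\<lambda>k. if k \<in> A1 then fst (restrict f A1, restrict f A2) k else snd (restrict f A1, restrict f A2) k) = f"
      using f'(1) by (auto simp: fun_eq_iff PiE_iff extensional_def)
    have "f (\<sigma>1 k) = f k" if "k \<in> A1" for k using f'(2)[of k] \<sigma>1[OF that] that by simp
    moreover have "f (\<sigma>2 k) = f k" if "k \<in> A2" for k using f'(2)[of k] \<sigma>2[OF that] that by simp
    ultimately show "(restrict f A1, restrict f A2) \<in> inv_words N A1 \<sigma>1 \<times> inv_words N A2 \<sigma>2"
      using f'(1) \<sigma>1 \<sigma>2 by (auto simp: inv_words_def words_def PiE_iff)
  qed
  finally show ?thesis by (simp add: frob_def)
qed

text \<open>Relabelling positions; it brings the shifted block of a Young subgroup back to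
  \<open>{1..s}\<close>.\<close>

lemma frob_transport:
  assumes g: "inj_on g A" and \<sigma>: "\<And>k. k \<in> A \<Longrightarrow> \<sigma> k \<in> A" and conj: "\<And>k. k \<in> A \<Longrightarrow> \<tau> (g k) = g (\<sigma> k)"
  shows "frob N (g ` A) u \<tau> = frob N A u \<sigma>"
  unfolding frob_def
proof (rule sum.reindex_bij_witness[where j="\<lambda>f. \<lambda>k\<in>A. f (g k)" and i="\<lambda>f. \<lambda>k\<in>g ` A. f (inv_into A g k)"])
  fix f assume f: "f \<in> inv_words N (g ` A) \<tau>"
  then have f': "\<And>k. k \<in> A \<Longrightarrow> f (g k) < N" "f \<in> extensional (g ` A)" "\<And>k. k \<in> A \<Longrightarrow> f (g (\<sigma> k)) = f (g k)"
    using conj by (auto simp: inv_words_def words_def PiE_iff)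
  show "(\<lambda>k\<in>g ` A. (\<lambda>k\<in>A. f (g k)) (inv_into A g k)) = f"
    using f'(2) by (auto simp: fun_eq_iff extensional_def f_inv_into_f inv_into_into)
  show "(\<lambda>k\<in>A. f (g k)) \<in> inv_words N A \<sigma>"
    using f' \<sigma> by (auto simp: inv_words_def words_def)
  have "content A (\<lambda>k\<in>A. f (g k)) i = content (g ` A) f i" for i
  proof -
    have "{k \<in> g ` A. f k = i} = g ` {k\<in>A. (\<lambda>k\<in>A. f (g k)) k = i}" by auto
    then show ?thesis
      unfolding content_def using card_image[OF inj_on_subset[OF g], of "{k\<in>A. (\<lambda>k\<in>A. f (g k)) k = i}"] by auto
  qed
  then show "alt N (\<lambda>i. u i - int (content A (\<lambda>k\<in>A. f (g k)) i)) = alt N (\<lambda>i. u i - int (content (g ` A) f i))"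
    by simp
next
  fix f assume "f \<in> inv_words N A \<sigma>"
  then have f': "\<And>k. k \<in> A \<Longrightarrow> f k < N" "f \<in> extensional A" "\<And>k. k \<in> A \<Longrightarrow> f (\<sigma> k) = f k"
    by (auto simp: inv_words_def words_def PiE_iff)
  show "(\<lambda>k\<in>A. (\<lambda>k\<in>g ` A. f (inv_into A g k)) (g k)) = f"
    using f'(2) g by (auto simp: fun_eq_iff extensional_def)
  show "(\<lambda>k\<in>g ` A. f (inv_into A g k)) \<in> inv_words N (g ` A) \<tau>"
    using f'(1,3) g \<sigma> by (auto simp: inv_words_def words_def conj inv_into_f_f)
qed

lemma psum_content:
  assumes "finite A"
  shows "psum (content A f) j = card {k\<in>A. f k < j}"
proof -
  have "{k\<in>A. f k < j} = (\<Union>i<j. {k\<in>A. f k = i})" by auto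
  moreover have "card (\<Union>i<j. {k\<in>A. f k = i}) = (\<Sum>i<j. card {k\<in>A. f k = i})"
    using assms by (intro card_UN_disjoint) auto
  ultimately show ?thesis by (simp add: psum_def content_def)
qed

subsection \<open>Sums over stabilizers\<close>

lemma exists_word:
  assumes "finite A" "(\<Sum>i<N. x i) = card A"
  shows "\<exists>f. (\<forall>k\<in>A. f k < N) \<and> (\<forall>i<N. content A f i = x i)"
  using assms
proof (induction N arbitrary: A)
  case 0
  then show ?case by (auto simp: content_def)
next
  case (Suc N)
  then have "x N \<le> card A" by simp
  then obtain B where B: "B \<subseteq> A" "card B = x N" by (meson obtain_subset_with_card_n)
  have fB: "finite B" using B(1) Suc.prems(1) finite_subset by blast
  have "(\<Sum>i<N. x i) = card (A - B)" using Suc.prems B fB by (simp add: card_Diff_subset)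
  then obtain f where f: "\<forall>k\<in>A - B. f k < N" "\<forall>i<N. content (A - B) f i = x i"
    using Suc.IH[of "A - B"] Suc.prems(1) by blast
  define g where "g k = (if k \<in> B then N else f k)" for k
  have "\<forall>k\<in>A. g k < Suc N" using f(1) by (auto simp: g_def less_Suc_eq)
  moreover have "content A g i = x i" if "i < Suc N" for i
  proof (cases "i = N")
    case True
    have "{k\<in>A. g k = N} = B" using B(1) f(1) by (auto simp: g_def)
    then show ?thesis using True B(2) by (simp add: content_def)
  next
    case False
    then have "{k\<in>A. g k = i} = {k\<in>A - B. f k = i}" by (auto simp: g_def)
    then show ?thesis using f(2) that False by (simp add: content_def)
  qed
  ultimately show ?case by blast
qed

lemma same_content_permutes:
  assumes fin: "finite A" and eq: "\<And>i. content A f i = content A g i"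
  obtains p where "p permutes A" "\<And>k. k \<in> A \<Longrightarrow> f k = g (p k)"
proof -
  have "image_mset f (mset_set A) = image_mset g (mset_set A)"
  proof (rule multiset_eqI)
    fix i
    have "count (image_mset h (mset_set A)) i = content A h i" for h :: "'a \<Rightarrow> nat"
      unfolding content_def by (rule count_image_mset_eq_card_vimage[OF fin])
    then show "count (image_mset f (mset_set A)) i = count (image_mset g (mset_set A)) i"
      using eq by simp
  qed
  then show thesis using image_mset_eq_implies_permutes[OF fin] that by metis
qed

lemma content_eq_0: "f \<in> words N A \<Longrightarrow> N \<le> i \<Longrightarrow> content A f i = 0"
  by (auto simp: content_def words_def PiE_iff intro!: card_eq_0_iff[THEN iffD2])

text \<open>Words with one content form a single orbit under permutations of the positions, so their
  stabilizer orders add up to the order of the whole group.\<close>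

lemma sum_card_stab_content:
  assumes fin: "finite A" and x: "(\<Sum>i<N. x i) = card A"
  shows "(\<Sum>f | f \<in> words N A \<and> (\<forall>i<N. content A f i = x i). card (stab A f)) = fact (card A)"
proof -
  define W where "W = {f. f \<in> words N A \<and> (\<forall>i<N. content A f i = x i)}"
  have fin_W: "finite W" by (rule finite_subset[OF _ finite_words[OF fin, of N]]) (auto simp: W_def)
  obtain f0 where f0: "\<forall>k\<in>A. f0 k < N" "\<forall>i<N. content A f0 i = x i"
    using exists_word[OF fin x] by blast
  have f0': "content A f0 i = 0" if "N \<le> i" for i
    using f0(1) that by (auto simp: content_def intro!: card_eq_0_iff[THEN iffD2])
  \<comment> \<open>\<open>F\<close> maps a permutation to the rearranged base word
    \<open>f0\<close>. If \<open>f\<close> is \<open>f0\<close> rearranged by \<open>q\<close>, its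
    fibre is the coset of \<open>stab A f\<close> through \<open>q\<close>.\<close>
  define P where "P = {p. p permutes A}"
  define F where "F p = (\<lambda>k\<in>A. f0 (p k))" for p
  have F_in: "F p \<in> W" if "p \<in> P" for p
  proof -
    have p: "p permutes A" using that by (simp add: P_def)
    have "{k\<in>A. f0 (p k) = i} = inv' p ` {k\<in>A. f0 k = i}" for i
      using permutes_in_image[OF p] permutes_in_image[OF permutes_inv[OF p]] permutes_inverses[OF p]
      by (auto simp: image_iff) metis
    then have "content A (F p) i = content A f0 i" for i
      using card_image[OF inj_on_subset[OF permutes_inj[OF permutes_inv[OF p]]], of "{k\<in>A. f0 k = i}"]
      by (simp add: content_def F_def cong: conj_cong)
    then show ?thesis using f0 permutes_in_image[OF p] by (auto simp: W_def words_def F_def)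
  qed
  have card_fibre: "card {p\<in>P. F p = f} = card (stab A f)" if f: "f \<in> W" for f
  proof -
    have "content A f i = content A f0 i" for i
      using f f0 f0' content_eq_0[of f N A i] by (cases "i < N") (auto simp: W_def)
    then obtain q where q: "q permutes A" "\<And>k. k \<in> A \<Longrightarrow> f k = f0 (q k)"
      using same_content_permutes[OF fin, of f f0] by blast
    have "bij_betw (\<lambda>s. q \<circ> s) (stab A f) {p\<in>P. F p = f}"
    proof (rule bij_betw_byWitness[where f'="\<lambda>p. inv' q \<circ> p"])
      show "\<forall>s\<in>stab A f. inv' q \<circ> (q \<circ> s) = s" "\<forall>p\<in>{p\<in>P. F p = f}. q \<circ> (inv' q \<circ> p) = p"
        using permutes_inv_o[OF q(1)] by (auto simp: comp_assoc[symmetric])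
      show "(\<lambda>s. q \<circ> s) ` stab A f \<subseteq> {p\<in>P. F p = f}"
      proof clarify
        fix s assume s: "s \<in> stab A f"
        then have sp: "s permutes A" by (simp add: stab_def)
        have "F (q \<circ> s) k = f k" for k
        proof (cases "k \<in> A")
          case True
          then have "s k \<in> A" using permutes_in_image[OF sp] by simp
          then show ?thesis using q(2)[of "s k"] s True by (simp add: F_def stab_def)
        next
          case False
          then show ?thesis using f by (auto simp: F_def W_def words_def PiE_iff extensional_def)
        qed
        then show "q \<circ> s \<in> P \<and> F (q \<circ> s) = f" using sp q(1) by (auto simp: P_def permutes_compose)
      qed
      show "(\<lambda>p. inv' q \<circ> p) ` {p\<in>P. F p = f} \<subseteq> stab A f"
      proof clarify
        fix p assume p: "p \<in> P" "f = F p"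
        then have pp: "p permutes A" by (simp add: P_def)
        have "f (inv' q (p k)) = f k" if k: "k \<in> A" for k
        proof -
          have "p k \<in> A" using permutes_in_image[OF pp] k by simp
          then have "inv' q (p k) \<in> A" using permutes_in_image[OF permutes_inv[OF q(1)]] by simp
          then have "f (inv' q (p k)) = f0 (p k)" using q(2) permutes_inverses[OF q(1)] by simp
          then show ?thesis using k p(2) by (simp add: F_def)
        qed
        then show "inv' q \<circ> p \<in> stab A (F p)"
          using pp permutes_inv[OF q(1)] p(2) by (auto simp: stab_def permutes_compose)
      qed
    qed
    then show ?thesis by (simp add: bij_betw_same_card)
  qed
  have "fact (card A) = card P" using card_permutations[OF refl fin] by (simp add: P_def)
  also have "\<dots> = (\<Sum>f\<in>W. \<Sum>p\<in>{p\<in>P. F p = f}. 1)"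
    unfolding card_eq_sum by (rule sum.group[symmetric])
      (use F_in fin_W finite_permutations[OF fin] in \<open>auto simp: P_def\<close>)
  finally show ?thesis by (simp add: card_fibre W_def)
qed

lemma sum_words_swap:
  assumes "finite A"
  shows "(\<Sum>g | g permutes A. \<Sum>f\<in>inv_words N A g. h g f) = (\<Sum>f\<in>words N A. \<Sum>g\<in>stab A f. h g f)"
proof -
  have "(\<Sum>g | g permutes A. \<Sum>f\<in>inv_words N A g. h g f) =
      (\<Sum>g | g permutes A. \<Sum>f\<in>words N A. if \<forall>k\<in>A. f (g k) = f k then h g f else 0)"
    using assms by (simp add: inv_words_def sum.inter_filter finite_words)
  also have "\<dots> = (\<Sum>f\<in>words N A. \<Sum>g | g permutes A. if \<forall>k\<in>A. f (g k) = f k then h g f else 0)"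
    by (rule sum.swap)
  also have "\<dots> = (\<Sum>f\<in>words N A. \<Sum>g\<in>stab A f. h g f)"
    using assms by (auto simp: stab_def sum.inter_filter[symmetric] finite_permutations intro!: sum.cong)
  finally show ?thesis .
qed

text \<open>The stabilizer is a direct product over the letters; the full symmetric group of the
  positions carrying \<open>k\<close> is the factor removed in each step of the induction on
  letters.\<close>

lemma sum_stab_split:
  fixes f :: "'a \<Rightarrow> nat"
  assumes fin: "finite A"
  shows "(\<Sum>g\<in>stab A f. H g) =
    (\<Sum>g1 | g1 permutes {x\<in>A. f x = k}. \<Sum>g2\<in>stab {x\<in>A. f x \<noteq> k} f. H (g1 \<circ> g2))"
proof -
  define A1 A2 where "A1 = {x\<in>A. f x = k}" and "A2 = {x\<in>A. f x \<noteq> k}"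
  have A: "A = A1 \<union> A2" "A1 \<inter> A2 = {}" "finite A1" "finite A2" using fin by (auto simp: A1_def A2_def)
  have "(\<Sum>p\<in>{g1. g1 permutes A1} \<times> stab A2 f. H (fst p \<circ> snd p)) = (\<Sum>g\<in>stab A f. H g)"
  proof (rule sum.reindex_bij_witness[where j="\<lambda>p. fst p \<circ> snd p"
        and i="\<lambda>g. (\<lambda>x. if x \<in> A1 then g x else x, \<lambda>x. if x \<in> A2 then g x else x)"])
    fix p assume "p \<in> {g1. g1 permutes A1} \<times> stab A2 f"
    then obtain g1 g2 where p: "p = (g1, g2)" and g1: "g1 permutes A1" and g2: "g2 \<in> stab A2 f" by auto
    have g2p: "g2 permutes A2" using g2 by (simp add: stab_def)
    have in1: "g1 x \<in> A1 \<longleftrightarrow> x \<in> A1" and in2: "g2 x \<in> A2 \<longleftrightarrow> x \<in> A2" for x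
      using permutes_in_image[OF g1] permutes_in_image[OF g2p] by auto
    have not1: "g1 x = x" if "x \<notin> A1" for x by (rule permutes_not_in[OF g1 that])
    have not2: "g2 x = x" if "x \<notin> A2" for x by (rule permutes_not_in[OF g2p that])
    have "(g1 \<circ> g2) x = (if x \<in> A1 then g1 x else if x \<in> A2 then g2 x else x)" for x
    proof (cases "x \<in> A2")
      case True
      then have "g2 x \<notin> A1" "x \<notin> A1" using in2[of x] A(2) by auto
      then show ?thesis using not1 True by simp
    qed (simp add: not1 not2)
    then have comp: "g1 \<circ> g2 = (\<lambda>x. if x \<in> A1 then g1 x else if x \<in> A2 then g2 x else x)" by blast
    show "(\<lambda>x. if x \<in> A1 then (fst p \<circ> snd p) x else x, \<lambda>x. if x \<in> A2 then (fst p \<circ> snd p) x else x) = p"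
      using A(2) not1 not2 by (auto simp: p comp fun_eq_iff)
    have "g1 \<circ> g2 permutes A"
      using permutes_subset[OF g1, of A] permutes_subset[OF g2p, of A] A(1)
      by (auto intro: permutes_compose)
    moreover have "f ((g1 \<circ> g2) x) = f x" if "x \<in> A" for x
    proof (cases "x \<in> A1")
      case True
      then show ?thesis using in1[of x] by (simp add: comp) (simp add: A1_def)
    next
      case False
      then have "x \<in> A2" using that A(1) by blast
      then show ?thesis using g2 False by (simp add: comp stab_def)
    qed
    ultimately show "fst p \<circ> snd p \<in> stab A f" by (simp add: p stab_def)
    show "H (fst p \<circ> snd p) = H (fst p \<circ> snd p)" ..
  next
    fix g assume g: "g \<in> stab A f"
    then have gp: "g permutes A" and fg: "\<And>x. x \<in> A \<Longrightarrow> f (g x) = f x" by (auto simp: stab_def)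
    have in1: "g x \<in> A1" if "x \<in> A1" for x
      using that fg[of x] permutes_in_image[OF gp, of x] by (auto simp: A1_def)
    have in2: "g x \<in> A2" if "x \<in> A2" for x
      using that fg[of x] permutes_in_image[OF gp, of x] by (auto simp: A2_def)
    have perm: "(\<lambda>x. if x \<in> B then g x else x) permutes B" if B: "finite B" "\<And>x. x \<in> B \<Longrightarrow> g x \<in> B" for B
    proof (rule bij_imp_permutes)
      have "inj_on g B" using permutes_inj[OF gp] inj_on_subset by blast
      then have "bij_betw g B B" using B by (simp add: bij_betw_def endo_inj_surj image_subset_iff)
      then show "bij_betw (\<lambda>x. if x \<in> B then g x else x) B B"
        by (rule bij_betw_cong[THEN iffD1, rotated]) simp
    qed simp
    show "(\<lambda>x. if x \<in> A1 then g x else x, \<lambda>x. if x \<in> A2 then g x else x) \<in> {g1. g1 permutes A1} \<times> stab A2 f"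
      using perm[OF A(3) in1] perm[OF A(4) in2] fg A(1) by (auto simp: stab_def)
    have "((\<lambda>x. if x \<in> A1 then g x else x) \<circ> (\<lambda>x. if x \<in> A2 then g x else x)) x = g x" for x
    proof (cases "x \<in> A2")
      case True
      then show ?thesis using in2[OF True] A(2) by auto
    next
      case False
      then show ?thesis using permutes_not_in[OF gp, of x] A(1) by auto
    qed
    then show "fst (\<lambda>x. if x \<in> A1 then g x else x, \<lambda>x. if x \<in> A2 then g x else x) \<circ>
        snd (\<lambda>x. if x \<in> A1 then g x else x, \<lambda>x. if x \<in> A2 then g x else x) = g"
      by (simp add: fun_eq_iff)
  qed
  then show ?thesis by (simp add: sum.cartesian_product split_def A1_def A2_def)
qed

text \<open>Words are grouped by content; within one group the value of \<open>Q\<close> is constant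
  and the stabilizer orders add up to a factorial.\<close>

lemma sum_words_comps:
  fixes Q :: "(nat \<Rightarrow> nat) \<Rightarrow> int"
  assumes fin: "finite A" and Q: "\<And>x y. (\<And>i. i < N \<Longrightarrow> x i = y i) \<Longrightarrow> Q x = Q y"
  shows "(\<Sum>w\<in>words N A. int (card (stab A w)) * Q (content A w)) =
    fact (card A) * (\<Sum>x\<in>comps N (card A). Q x)"
proof -
  define c where "c w = restrict (content A w) {..<N}" for w
  have c_in: "c w \<in> comps N (card A)" if "w \<in> words N A" for w
    using sum_content[OF fin that] by (simp add: c_def comps_iff)
  have "(\<Sum>w\<in>words N A. int (card (stab A w)) * Q (content A w)) =
      (\<Sum>x\<in>comps N (card A). \<Sum>w | w \<in> words N A \<and> c w = x. int (card (stab A w)) * Q (content A w))"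
    by (rule sum.group[symmetric]) (use c_in in \<open>auto simp: finite_words fin finite_comps\<close>)
  also have "\<dots> = (\<Sum>x\<in>comps N (card A). fact (card A) * Q x)"
  proof (rule sum.cong[OF refl])
    fix x assume x: "x \<in> comps N (card A)"
    have iff: "c w = x \<longleftrightarrow> (\<forall>i<N. content A w i = x i)" for w
      using x by (auto simp: c_def comps_iff fun_eq_iff extensional_def)
    have "(\<Sum>w | w \<in> words N A \<and> c w = x. int (card (stab A w)) * Q (content A w)) =
        (\<Sum>w | w \<in> words N A \<and> c w = x. int (card (stab A w)) * Q x)"
      by (intro sum.cong refl arg_cong2[where f="(*)"] Q) (simp add: iff)
    also have "\<dots> = int (\<Sum>w | w \<in> words N A \<and> (\<forall>i<N. content A w i = x i). card (stab A w)) * Q x"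
      by (simp add: iff sum_distrib_right)
    also have "\<dots> = fact (card A) * Q x"
      using sum_card_stab_content[OF fin, where N=N and x=x] x by (simp only: comps_iff of_nat_fact)
    finally show "(\<Sum>w | w \<in> words N A \<and> c w = x. int (card (stab A w)) * Q (content A w)) =
        fact (card A) * Q x" .
  qed
  finally show ?thesis by (simp add: sum_distrib_left)
qed

text \<open>The positions with the largest letter form the first block of \<open>frob_split\<close>.
  Exchanging group elements and invariant words, then counting orbits, turns the sum over the
  symmetric group of this block into the sum over contents in \<open>pieri\<close>.\<close>

lemma sum_stab_frob:
  assumes "finite A" "\<And>x. x \<in> A \<Longrightarrow> f x < k"
  shows "(\<Sum>g\<in>stab A f. frob N A u g) = int (card (stab A f)) * pieri N k (content A f) u"
  using assms
proof (induction k arbitrary: A u)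
  case 0
  then have A: "A = {}" by auto
  have stab: "stab A f = {id}" by (auto simp: A stab_def permutes_empty)
  have "inv_words N A g = {\<lambda>_. undefined}" for g by (simp add: A inv_words_def words_def)
  then show ?case by (simp add: stab frob_def) (simp add: A content_def)
next
  case (Suc k)
  define A1 A2 where "A1 = {x\<in>A. f x = k}" and "A2 = {x\<in>A. f x \<noteq> k}"
  have A: "A = A1 \<union> A2" "A1 \<inter> A2 = {}" and fin: "finite A1" "finite A2"
    using Suc.prems(1) by (auto simp: A1_def A2_def)
  have lt: "f x < k" if "x \<in> A2" for x
    using Suc.prems(2)[of x] that by (auto simp: A2_def less_Suc_eq)
  have split: "frob N A u (g1 \<circ> g2) = (\<Sum>w\<in>inv_words N A1 g1. frob N A2 (\<lambda>i. u i - int (content A1 w i)) g2)"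
    if g1: "g1 permutes A1" and g2: "g2 permutes A2" for g1 g2
    unfolding A(1)
  proof (rule frob_split[OF fin A(2)])
    fix x assume x: "x \<in> A1"
    then have "g2 x = x" using permutes_not_in[OF g2] A(2) by blast
    then show "(g1 \<circ> g2) x = g1 x \<and> g1 x \<in> A1" using permutes_in_image[OF g1] x by simp
  next
    fix x assume x: "x \<in> A2"
    then have "g2 x \<in> A2" using permutes_in_image[OF g2] by simp
    moreover from this have "g1 (g2 x) = g2 x" using permutes_not_in[OF g1] A(2) by blast
    ultimately show "(g1 \<circ> g2) x = g2 x \<and> g2 x \<in> A2" by simp
  qed
  have "(\<Sum>g\<in>stab A f. frob N A u g) = (\<Sum>g1 | g1 permutes A1. \<Sum>g2\<in>stab A2 f. frob N A u (g1 \<circ> g2))"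
    unfolding A1_def A2_def by (rule sum_stab_split[OF Suc.prems(1)])
  also have "\<dots> = (\<Sum>g1 | g1 permutes A1. \<Sum>g2\<in>stab A2 f. \<Sum>w\<in>inv_words N A1 g1.
      frob N A2 (\<lambda>i. u i - int (content A1 w i)) g2)"
    by (intro sum.cong refl split) (auto simp: stab_def)
  also have "\<dots> = (\<Sum>g1 | g1 permutes A1. \<Sum>w\<in>inv_words N A1 g1.
      int (card (stab A2 f)) * pieri N k (content A2 f) (\<lambda>i. u i - int (content A1 w i)))"
    by (subst sum.swap) (simp add: Suc.IH[OF fin(2) lt])
  also have "\<dots> = int (card (stab A2 f)) * (\<Sum>w\<in>words N A1. int (card (stab A1 w)) *
      pieri N k (content A2 f) (\<lambda>i. u i - int (content A1 w i)))"
    unfolding sum_words_swap[OF fin(1)] by (simp add: sum_distrib_left mult_ac)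
  also have "(\<Sum>w\<in>words N A1. int (card (stab A1 w)) *
      pieri N k (content A2 f) (\<lambda>i. u i - int (content A1 w i))) =
      fact (card A1) * (\<Sum>x\<in>comps N (card A1). pieri N k (content A2 f) (\<lambda>i. u i - int (x i)))"
    by (rule sum_words_comps[OF fin(1)]) (rule pieri_cong, simp)
  also have "card A1 = content A f k" by (simp add: A1_def content_def)
  also have "(\<Sum>x\<in>comps N (content A f k). pieri N k (content A2 f) (\<lambda>i. u i - int (x i))) =
      pieri N (Suc k) (content A f) u"
    unfolding pieri.simps
    by (intro sum.cong refl pieri_cong_content) (auto simp: content_def A2_def intro!: arg_cong[where f=card])
  also have "card (stab A f) = fact (content A f k) * card (stab A2 f)"
  proof -
    have "card (stab A f) = (\<Sum>g1 | g1 permutes A1. \<Sum>g2\<in>stab A2 f. 1)"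
      unfolding card_eq_sum A1_def A2_def by (rule sum_stab_split[OF Suc.prems(1)])
    also have "\<dots> = card {g1. g1 permutes A1} * card (stab A2 f)" by simp
    also have "card {g1. g1 permutes A1} = fact (content A f k)"
      using card_permutations[OF refl fin(1)] by (simp add: A1_def content_def)
    finally show ?thesis .
  qed
  then have "int (card (stab A2 f)) * (fact (content A f k) * pieri N (Suc k) (content A f) u) =
      int (card (stab A f)) * pieri N (Suc k) (content A f) u" by simp
  finally show ?case .
qed

section \<open>Frobenius' character formula\<close>

definition shifted :: "nat \<Rightarrow> (nat \<Rightarrow> nat) \<Rightarrow> nat \<Rightarrow> int" where
  "shifted N lam i = int (lam i) + delta N i"

text \<open>If \<open>w\<close> fixes everything below \<open>i\<close>, injectivity gives
  \<open>i \<le> w i\<close>, and the partial sum up to \<open>i\<close> gives the converse.\<close>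

lemma permutation_sum_le_id:
  fixes w :: "nat \<Rightarrow> nat"
  assumes w: "w permutes {..<N}" and le: "\<And>j. j \<le> N \<Longrightarrow> (\<Sum>i<j. w i) \<le> (\<Sum>i<j. i)" and i: "i < N"
  shows "w i = i"
  using i
proof (induction i rule: less_induct)
  case (less i)
  have eq: "w j = j" if "j < i" for j using less that by auto
  have "\<not> w i < i"
  proof
    assume "w i < i"
    then have "w (w i) = w i" by (rule eq)
    then have "w i = i" using injD[OF permutes_inj[OF w]] by blast
    then show False using \<open>w i < i\<close> by simp
  qed
  moreover have "(\<Sum>j<i. w j) = (\<Sum>j<i. j)" using eq by simp
  ultimately show ?case using le[of "Suc i"] less.prems by simp
qed

context partition
begin

lemma strict_dec_shifted: "strict_dec N (shifted N lam)"
proof -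
  have "lam (Suc i) \<le> lam i" for i using part by (simp add: is_partition_def antimonoD)
  then have "int (lam (Suc i)) < 1 + int (lam i)" for i by (smt (verit) of_nat_mono)
  then show ?thesis by (simp add: strict_dec_def shifted_def delta_def)
qed

text \<open>One computation for both inner products, with \<Phi> the Specht character or the
  alternating sum itself. In the expansion over words a nonzero coefficient belongs to a content
  \<open>lam + w - id\<close> for a permutation \<open>w\<close>; if that content is also dominated
  by \<open>lam\<close>, the partial sums force \<open>w = id\<close>. Words of content
  \<open>lam\<close> contribute their stabilizer orders, in total n!.\<close>

lemma sum_frob_mult:
  fixes \<Phi> :: "(nat \<Rightarrow> nat) \<Rightarrow> complex"
  assumes nondom: "\<And>f j. f \<in> words N {1..n} \<Longrightarrow> j \<le> N \<Longrightarrow> psum lam j < psum (content {1..n} f) j \<Longrightarrow>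
      (\<Sum>s\<in>stab {1..n} f. \<Phi> s) = 0"
    and diag: "\<And>f. f \<in> words N {1..n} \<Longrightarrow> (\<And>i. i < N \<Longrightarrow> content {1..n} f i = lam i) \<Longrightarrow>
      (\<Sum>s\<in>stab {1..n} f. \<Phi> s) = of_nat (card (stab {1..n} f))"
    and N: "\<forall>i\<ge>N. lam i = 0"
  shows "(\<Sum>g | g permutes {1..n}. of_int (frob N {1..n} (shifted N lam) g) * \<Phi> g) = of_nat (fact n)"
proof -
  let ?A = "{1..n}"
  let ?alt = "\<lambda>f. alt N (\<lambda>i. shifted N lam i - int (content ?A f i))"
  have "(\<Sum>g | g permutes ?A. of_int (frob N ?A (shifted N lam) g) * \<Phi> g) =
      (\<Sum>g | g permutes ?A. \<Sum>f\<in>inv_words N ?A g. of_int (?alt f) * \<Phi> g)"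
    by (simp add: frob_def sum_distrib_right)
  also have "\<dots> = (\<Sum>f\<in>words N ?A. of_int (?alt f) * (\<Sum>g\<in>stab ?A f. \<Phi> g))"
    by (subst sum_words_swap) (simp_all add: sum_distrib_left)
  also have "\<dots> = (\<Sum>f\<in>words N ?A. if \<forall>i<N. content ?A f i = lam i then of_nat (card (stab ?A f)) else 0)"
  proof (rule sum.cong[OF refl])
    fix f assume f: "f \<in> words N ?A"
    show "of_int (?alt f) * (\<Sum>g\<in>stab ?A f. \<Phi> g) =
        (if \<forall>i<N. content ?A f i = lam i then of_nat (card (stab ?A f)) else 0)"
    proof (cases "\<forall>i<N. content ?A f i = lam i")
      case True
      then have "?alt f = alt N (delta N)" by (intro alt_cong) (simp add: shifted_def)
      then show ?thesis using True diag[OF f] by (simp add: alt_delta)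
    next
      case False
      have "?alt f = 0 \<or> (\<Sum>g\<in>stab ?A f. \<Phi> g) = 0"
      proof (rule ccontr)
        assume neg: "\<not> (?alt f = 0 \<or> (\<Sum>g\<in>stab ?A f. \<Phi> g) = 0)"
        then obtain w where w: "w permutes {..<N}"
          "\<And>i. i < N \<Longrightarrow> shifted N lam i - int (content ?A f i) = delta N (w i)"
          using alt_nonzero[of N "\<lambda>i. shifted N lam i - int (content ?A f i)"] by metis
        have "(\<Sum>i<j. w i) \<le> (\<Sum>i<j. i)" if j: "j \<le> N" for j
        proof -
          have "psum (content ?A f) j \<le> psum lam j" using nondom[OF f j] neg by force
          then have "(\<Sum>i<j. int (content ?A f i)) \<le> (\<Sum>i<j. int (lam i))"
            by (simp add: psum_def flip: of_nat_sum)
          moreover have "int (content ?A f i) = int (lam i) + int (w i) - int i" if "i < j" for i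
            using w(2)[of i] that j by (simp add: shifted_def delta_def)
          ultimately have "(\<Sum>i<j. int (lam i) + int (w i) - int i) \<le> (\<Sum>i<j. int (lam i))" by simp
          then have "(\<Sum>i<j. int (w i)) \<le> (\<Sum>i<j. int i)" by (simp add: sum.distrib sum_subtractf)
          then show ?thesis by (simp flip: of_nat_sum)
        qed
        then have "w i = i" if "i < N" for i using permutation_sum_le_id[OF w(1)] that by blast
        then have "content ?A f i = lam i" if "i < N" for i
          using w(2)[OF that] that by (simp add: shifted_def)
        then show False using False by blast
      qed
      then show ?thesis using False by auto
    qed
  qed
  also have "\<dots> = of_nat (\<Sum>f | f \<in> words N ?A \<and> (\<forall>i<N. content ?A f i = lam i). card (stab ?A f))"
    unfolding of_nat_sum by (rule sum.inter_filter[symmetric]) (simp add: finite_words)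
  also have "\<dots> = of_nat (fact n)"
    using sum_card_stab_content[where A="?A" and N=N and x=lam] psum_eq_psize[OF N] by (simp add: psum_def)
  finally show ?thesis .
qed

lemma sum_frob_\<chi>:
  assumes N: "\<forall>i\<ge>N. lam i = 0"
  shows "(\<Sum>g | g permutes {1..n}. of_int (frob N {1..n} (shifted N lam) g) * \<chi> g) = of_nat (fact n)"
proof (rule sum_frob_mult[OF _ _ N])
  fix f :: "nat \<Rightarrow> nat" and j assume less: "psum lam j < psum (content {1..n} f) j"
  show "(\<Sum>s\<in>stab {1..n} f. \<chi> s) = 0"
  proof (rule sum_stab_\<chi>_eq_0, rule ccontr)
    fix g assume g: "g permutes {1..n}" and "\<not> (\<exists>k\<in>{1..n}. \<exists>k'\<in>{1..n}. k \<noteq> k' \<and> f k = f k' \<and>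
      col (inv' g k) = col (inv' g k'))"
    \<comment> \<open>A filling without repeated letters in a column would make the content
      dominated by \<open>lam\<close>, so here every filling has a repetition.\<close>
    then have "card {k\<in>{1..n}. f k < j} \<le> psum lam j"
      by (intro column_strict_word(1)[OF part permutes_imp_bij[OF permutes_inv[OF g]]]) blast
    then show False using less by (simp add: psum_content)
  qed
next
  fix f assume f: "f \<in> words N {1..n}" "\<And>i. i < N \<Longrightarrow> content {1..n} f i = lam i"
  have "content {1..n} f i = content {1..n} row i" for i
  proof -
    have "content {1..n} row i = lam i" using card_row[OF part] by (simp add: content_def)
    then show ?thesis using f(2)[of i] content_eq_0[OF f(1), of i] N by (cases "i < N") simp_all
  qed
  \<comment> \<open>A word of content \<open>lam\<close> is the row word rearranged by
    \<open>p\<close>. Conjugation by \<open>p\<close> carries its stabilizer to the row group and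
    leaves the class function \<chi> unchanged.\<close>
  then obtain p where p: "p permutes {1..n}" "\<And>k. k \<in> {1..n} \<Longrightarrow> f k = row (p k)"
    using same_content_permutes[of "{1..n}" f row] by blast
  note pi = permutes_inv[OF p(1)]
  have p_in: "p k \<in> {1..n} \<longleftrightarrow> k \<in> {1..n}" "inv' p k \<in> {1..n} \<longleftrightarrow> k \<in> {1..n}" for k
    by (rule permutes_in_image[OF p(1)], rule permutes_in_image[OF pi])
  have reindex: "(\<Sum>s\<in>stab {1..n} f. h (p \<circ> s \<circ> inv' p)) = (\<Sum>s\<in>stab {1..n} row. h s)"
    for h :: "(nat \<Rightarrow> nat) \<Rightarrow> complex"
  proof (rule sum.reindex_bij_witness[where j="\<lambda>s. p \<circ> s \<circ> inv' p" and i="\<lambda>s. inv' p \<circ> s \<circ> p"])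
    fix s assume s: "s \<in> stab {1..n} f"
    then have sp: "s permutes {1..n}" and fs: "\<And>k. k \<in> {1..n} \<Longrightarrow> f (s k) = f k" by (auto simp: stab_def)
    show "inv' p \<circ> (p \<circ> s \<circ> inv' p) \<circ> p = s" by (simp add: fun_eq_iff permutes_inverses[OF p(1)])
    have "row (p (s (inv' p k))) = row k" if k: "k \<in> {1..n}" for k
    proof -
      have "s (inv' p k) \<in> {1..n}" using permutes_in_image[OF sp] p_in k by blast
      then have "row (p (s (inv' p k))) = f (inv' p k)" using p(2) fs p_in k by metis
      also have "\<dots> = row k" using p(2) p_in k permutes_inverses[OF p(1)] by metis
      finally show ?thesis .
    qed
    then show "p \<circ> s \<circ> inv' p \<in> stab {1..n} row"
      using sp p(1) pi by (simp add: stab_def permutes_compose)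
    show "h (p \<circ> s \<circ> inv' p) = h (p \<circ> s \<circ> inv' p)" ..
  next
    fix s assume s: "s \<in> stab {1..n} row"
    then have sp: "s permutes {1..n}" and fs: "\<And>k. k \<in> {1..n} \<Longrightarrow> row (s k) = row k" by (auto simp: stab_def)
    show "p \<circ> (inv' p \<circ> s \<circ> p) \<circ> inv' p = s" by (simp add: fun_eq_iff permutes_inverses[OF p(1)])
    have "f (inv' p (s (p k))) = f k" if k: "k \<in> {1..n}" for k
    proof -
      have "s (p k) \<in> {1..n}" using permutes_in_image[OF sp] p_in k by blast
      then have "f (inv' p (s (p k))) = row (s (p k))" using p(2) p_in permutes_inverses[OF p(1)] by metis
      also have "\<dots> = f k" using p(2) fs p_in k by metis
      finally show ?thesis .
    qed
    then show "inv' p \<circ> s \<circ> p \<in> stab {1..n} f"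
      using sp p(1) pi by (simp add: stab_def permutes_compose)
  qed
  have "(\<Sum>s\<in>stab {1..n} f. \<chi> s) = (\<Sum>s\<in>stab {1..n} f. \<chi> (p \<circ> s \<circ> inv' p))"
    by (intro sum.cong refl \<chi>_conj[symmetric] p(1)) (simp add: stab_def)
  also have "\<dots> = of_nat (card (stab {1..n} row))" by (simp add: reindex sum_stab_row_\<chi>)
  also have "\<dots> = of_nat (card (stab {1..n} f))" using reindex[of "\<lambda>_. 1"] by simp
  finally show "(\<Sum>s\<in>stab {1..n} f. \<chi> s) = of_nat (card (stab {1..n} f))" .
qed

text \<open>The stabilizer sums are stabilizer orders times Kostka numbers, which vanish unless the
  content is dominated by \<open>lam\<close> and equal one at content \<open>lam\<close>.\<close>

lemma sum_frob_frob:
  assumes N: "\<forall>i\<ge>N. lam i = 0"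
  shows "(\<Sum>g | g permutes {1..n}. of_int (frob N {1..n} (shifted N lam) g) *
    of_int (frob N {1..n} (shifted N lam) g)) = (of_nat (fact n) :: complex)"
proof (rule sum_frob_mult[OF _ _ N])
  have eq: "(\<Sum>s\<in>stab {1..n} f. of_int (frob N {1..n} (shifted N lam) s) :: complex) =
      of_int (int (card (stab {1..n} f)) * pieri N N (content {1..n} f) (shifted N lam))"
    if "f \<in> words N {1..n}" for f
    using that sum_stab_frob[of "{1..n}" f N N "shifted N lam"]
    by (simp add: words_def PiE_iff flip: of_int_sum)
  {
    fix f j assume f: "f \<in> words N {1..n}" "j \<le> N" "psum lam j < psum (content {1..n} f) j"
    have "pieri N N (content {1..n} f) (shifted N lam) = 0"
    proof (rule ccontr)
      assume "pieri N N (content {1..n} f) (shifted N lam) \<noteq> 0"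
      from pieri_dominated[OF strict_dec_shifted this order_refl] f(2)
      have "int (psum (content {1..n} f) j) \<le> (\<Sum>i<j. shifted N lam i - delta N i)" by blast
      also have "\<dots> = int (psum lam j)" by (simp add: shifted_def psum_def)
      finally show False using f(3) by simp
    qed
    then show "(\<Sum>s\<in>stab {1..n} f. of_int (frob N {1..n} (shifted N lam) s) :: complex) = 0"
      using eq[OF f(1)] by simp
  next
    fix f assume f: "f \<in> words N {1..n}" "\<And>i. i < N \<Longrightarrow> content {1..n} f i = lam i"
    have "pieri N N (content {1..n} f) (shifted N lam) = 1"
      by (rule pieri_diagonal) (auto simp: f(2) shifted_def strict_dec_shifted)
    then show "(\<Sum>s\<in>stab {1..n} f. of_int (frob N {1..n} (shifted N lam) s) :: complex) =
        of_nat (card (stab {1..n} f))"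
      using eq[OF f(1)] by simp
  }
qed

theorem \<chi>_eq_frob:
  assumes N: "\<forall>i\<ge>N. lam i = 0" and g: "g permutes {1..n}"
  shows "\<chi> g = of_int (frob N {1..n} (shifted N lam) g)"
proof -
  define F where "F g = real_of_int (frob N {1..n} (shifted N lam) g)" for g :: "nat \<Rightarrow> nat"
  define r where "r g = Re (\<chi> g)" for g
  have r: "\<chi> g = complex_of_real (r g)" for g using \<chi>_real[of g] by (simp add: r_def)
  have F: "(of_int (frob N {1..n} (shifted N lam) g) :: complex) = complex_of_real (F g)" for g
    by (simp add: F_def)
  have "complex_of_real (\<Sum>g | g permutes {1..n}. F g * F g) = complex_of_real (real (fact n))"
    "complex_of_real (\<Sum>g | g permutes {1..n}. F g * r g) = complex_of_real (real (fact n))"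
    "complex_of_real (\<Sum>g | g permutes {1..n}. r g * r g) = complex_of_real (real (fact n))"
    using sum_frob_frob[OF N] sum_frob_\<chi>[OF N] sum_\<chi>_\<chi> unfolding F r of_real_of_nat_eq
    by (simp_all only: of_real_mult of_real_sum)
  then have sums: "(\<Sum>g | g permutes {1..n}. F g * F g) = real (fact n)"
    "(\<Sum>g | g permutes {1..n}. F g * r g) = real (fact n)"
    "(\<Sum>g | g permutes {1..n}. r g * r g) = real (fact n)"
    by (simp_all only: of_real_eq_iff)
  \<comment> \<open>Expanding the square gives n! - 2 n! + n! = 0; as all terms are real squares,
    each vanishes.\<close>
  have "(\<Sum>g | g permutes {1..n}. (F g - r g)\<^sup>2) = (\<Sum>g | g permutes {1..n}. F g * F g - 2 * (F g * r g) + r g * r g)"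
    by (intro sum.cong refl) (simp add: power2_eq_square algebra_simps)
  also have "\<dots> = 0" by (simp add: sum.distrib sum_subtractf sums flip: sum_distrib_left)
  finally have "(F g - r g)\<^sup>2 = 0"
    using g by (subst (asm) sum_nonneg_eq_0_iff) (auto simp: finite_permutations)
  then show ?thesis by (simp add: r F)
qed

end

section \<open>Coefficients as character sums\<close>

text \<open>Hides the finite set, the action and the matrix, so that characters of composed
  constructions can be combined without naming these data.\<close>

definition rep_char :: "('g, 'm) monoid_scheme \<Rightarrow> ('g, 'x) rep \<Rightarrow> ('g \<Rightarrow> complex) \<Rightarrow> bool" where
  "rep_char G W \<chi> \<longleftrightarrow> (\<exists>X \<pi> M. perm_rep G X \<pi> M W \<and> (\<forall>g\<in>carrier G. perm_rep.char X \<pi> M g = \<chi> g))"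

abbreviation irr_char :: "nat \<Rightarrow> (nat \<Rightarrow> nat) \<Rightarrow> (nat \<Rightarrow> nat) \<Rightarrow> int" where
  "irr_char N lam g \<equiv> frob N {1..psize lam} (shifted N lam) g"

lemma rep_char_Specht:
  assumes "is_partition lam" "\<forall>i\<ge>N. lam i = 0"
  shows "rep_char (sym_group (psize lam)) (Specht lam) (\<lambda>g. of_int (irr_char N lam g))"
proof -
  interpret partition lam by unfold_locales (rule assms(1))
  show ?thesis
    unfolding rep_char_def Specht_eq_ideal_rep
  proof (intro exI conjI ballI)
    show "perm_rep (sym_group n) (carrier (sym_group n)) (\<lambda>g x. inv\<^bsub>sym_group n\<^esub> g \<otimes>\<^bsub>sym_group n\<^esub> x)
        (\<lambda>a x. idem (inv\<^bsub>sym_group n\<^esub> x \<otimes>\<^bsub>sym_group n\<^esub> a)) (G.ideal_rep idem)"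
      by (rule G.perm_rep_ideal_rep[OF primitive_idempotent_idem])
    fix g assume g: "g \<in> carrier (sym_group n)"
    then have "g permutes {1..n}" by (simp add: sym_group_carrier)
    then show "perm_rep.char (carrier (sym_group n)) (\<lambda>g x. inv\<^bsub>sym_group n\<^esub> g \<otimes>\<^bsub>sym_group n\<^esub> x)
        (\<lambda>a x. idem (inv\<^bsub>sym_group n\<^esub> x \<otimes>\<^bsub>sym_group n\<^esub> a)) g = of_int (irr_char N lam g)"
      unfolding G.char_ideal_rep[OF primitive_idempotent_idem g] \<chi>_def[symmetric]
      by (rule \<chi>_eq_frob[OF assms(2)])
  qed
qed

lemma rep_char_Tensor:
  assumes "rep_char G V \<chi>" "rep_char H W \<psi>"
  shows "rep_char (G \<times>\<times> H) (Tensor V W) (\<lambda>(g, h). \<chi> g * \<psi> h)"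
proof -
  from assms obtain X \<pi> M Y \<rho> N where V: "perm_rep G X \<pi> M V" "\<forall>g\<in>carrier G. perm_rep.char X \<pi> M g = \<chi> g"
    and W: "perm_rep H Y \<rho> N W" "\<forall>g\<in>carrier H. perm_rep.char Y \<rho> N g = \<psi> g"
    unfolding rep_char_def by blast
  show ?thesis
    unfolding rep_char_def
    using perm_rep_Tensor[OF V(1) W(1)] char_Tensor[OF V(1) W(1)] V(2) W(2)
    by (intro exI conjI ballI) auto
qed

lemma rep_char_Res:
  assumes "rep_char G W \<chi>" "finite_group H" and \<phi>: "\<phi> \<in> hom H G"
  shows "rep_char H (Res \<phi> W) (\<lambda>h. \<chi> (\<phi> h))"
proof -
  from assms(1) obtain X \<pi> M where W: "perm_rep G X \<pi> M W" "\<forall>g\<in>carrier G. perm_rep.char X \<pi> M g = \<chi> g"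
    unfolding rep_char_def by blast
  note R = perm_rep_Res[OF W(1) assms(2) \<phi>]
  have "perm_rep.char X (\<lambda>h. \<pi> (\<phi> h)) M h = \<chi> (\<phi> h)" if "h \<in> carrier H" for h
    using W(2) hom_in_carrier[OF \<phi> that] unfolding perm_rep.char_def[OF R] perm_rep.char_def[OF W(1)] by blast
  then show ?thesis using R unfolding rep_char_def by blast
qed

lemma irr_char_conj:
  assumes "is_partition lam" "\<forall>i\<ge>N. lam i = 0" "g permutes {1..psize lam}" "h permutes {1..psize lam}"
  shows "irr_char N lam (h \<circ> g \<circ> inv' h) = irr_char N lam g"
proof -
  interpret partition lam by unfold_locales (rule assms(1))
  have "h \<circ> g \<circ> inv' h permutes {1..n}" using assms by (intro permutes_compose permutes_inv)
  then have "(of_int (irr_char N lam (h \<circ> g \<circ> inv' h)) :: complex) = of_int (irr_char N lam g)"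
    using \<chi>_eq_frob[OF assms(2)] assms(3,4) \<chi>_conj by metis
  then show ?thesis by (simp only: of_int_eq_iff)
qed

lemma multiplicity_Specht:
  assumes part: "is_partition lam" and N: "\<forall>i\<ge>N. lam i = 0" and W: "rep_char (sym_group (psize lam)) W \<psi>"
    and cls: "\<And>g h. g permutes {1..psize lam} \<Longrightarrow> h permutes {1..psize lam} \<Longrightarrow> \<psi> (h \<circ> g \<circ> inv' h) = \<psi> g"
  shows "fact (psize lam) * of_nat (multiplicity_rep (sym_group (psize lam)) (Specht lam) W) =
    (\<Sum>g | g permutes {1..psize lam}. of_int (irr_char N lam g) * \<psi> g)"
proof -
  interpret partition lam by unfold_locales (rule part)
  from W obtain X \<pi> M where W: "perm_rep (sym_group n) X \<pi> M W"
    "\<And>g. g \<in> carrier (sym_group n) \<Longrightarrow> perm_rep.char X \<pi> M g = \<psi> g"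
    unfolding rep_char_def by blast
  have "of_nat (order (sym_group n)) * of_nat (multiplicity_rep (sym_group n) (Specht lam) W) =
      (\<Sum>g\<in>carrier (sym_group n). \<chi> (inv\<^bsub>sym_group n\<^esub> g) * \<psi> g)"
    unfolding Specht_eq_ideal_rep \<chi>_def
    by (rule G.multiplicity_class_function[OF primitive_idempotent_idem W])
       (simp_all add: sym_group_carrier sym_group_mult cls)
  also have "\<dots> = (\<Sum>g | g permutes {1..n}. of_int (irr_char N lam g) * \<psi> g)"
    unfolding carrier_eq
    by (intro sum.cong refl) (simp add: sym_group_carrier \<chi>_inv \<chi>_eq_frob[OF N])
  finally show ?thesis by (simp add: order_def carrier_eq card_permutations)
qed

lemma multiplicity_Specht_Ind:
  assumes part: "is_partition lam" and N: "\<forall>i\<ge>N. lam i = 0" and W: "rep_char H W \<psi>"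
    and \<phi>: "\<phi> \<in> hom H (sym_group (psize lam))"
  shows "of_nat (order H) * of_nat (multiplicity_rep (sym_group (psize lam)) (Specht lam)
      (Ind H (sym_group (psize lam)) \<phi> W)) =
    (\<Sum>k\<in>carrier H. of_int (irr_char N lam (\<phi> k)) * \<psi> k)"
proof -
  interpret partition lam by unfold_locales (rule part)
  from W obtain X \<pi> M where W: "perm_rep H X \<pi> M W"
    "\<And>g. g \<in> carrier H \<Longrightarrow> perm_rep.char X \<pi> M g = \<psi> g"
    unfolding rep_char_def by blast
  have "of_nat (order H) * of_nat (multiplicity_rep (sym_group n) (Specht lam) (Ind H (sym_group n) \<phi> W)) =
      (\<Sum>k\<in>carrier H. \<chi> (inv\<^bsub>sym_group n\<^esub> \<phi> k) * \<psi> k)"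
    unfolding Specht_eq_ideal_rep \<chi>_def
    by (rule multiplicity_Ind[OF W(1) sym_group_finite_group \<phi>
          primitive_idempotent_idem W(2)])
  also have "\<dots> = (\<Sum>k\<in>carrier H. of_int (irr_char N lam (\<phi> k)) * \<psi> k)"
  proof (rule sum.cong[OF refl])
    fix k assume "k \<in> carrier H"
    then have "\<phi> k \<in> carrier (sym_group n)" by (rule hom_in_carrier[OF \<phi>])
    then show "\<chi> (inv\<^bsub>sym_group n\<^esub> \<phi> k) * \<psi> k = of_int (irr_char N lam (\<phi> k)) * \<psi> k"
      by (simp add: sym_group_carrier \<chi>_inv \<chi>_eq_frob[OF N])
  qed
  finally show ?thesis .
qed

text \<open>At shifted partitions of \<open>q\<close> this is q! times a Kronecker coefficient. Left
  unnormalised, it is an integer for every choice of integer vectors.\<close>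

definition kron_sum :: "nat \<Rightarrow> nat \<Rightarrow> (nat \<Rightarrow> int) \<Rightarrow> (nat \<Rightarrow> int) \<Rightarrow> (nat \<Rightarrow> int) \<Rightarrow> int" where
  "kron_sum N q x y z = (\<Sum>b | b permutes {1..q}. frob N {1..q} x b * (frob N {1..q} y b * frob N {1..q} z b))"

theorem kronecker_eq_kron_sum:
  assumes part: "is_partition lam" "is_partition \<mu>" "is_partition \<nu>"
    and N: "\<forall>i\<ge>N. lam i = 0" "\<forall>i\<ge>N. \<mu> i = 0" "\<forall>i\<ge>N. \<nu> i = 0"
    and size: "psize lam = q" "psize \<mu> = q" "psize \<nu> = q"
  shows "fact q * int (kronecker lam \<mu> \<nu>) =
    kron_sum N q (shifted N lam) (shifted N \<mu>) (shifted N \<nu>)"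
proof -
  let ?\<psi> = "\<lambda>g. of_int (irr_char N \<mu> g) * of_int (irr_char N \<nu> g) :: complex"
  have "(\<lambda>\<sigma>. (\<sigma>, \<sigma>)) \<in> hom (sym_group q) (sym_group q \<times>\<times> sym_group q)"
    by (auto simp: hom_def)
  then have "rep_char (sym_group q) (Res (\<lambda>\<sigma>. (\<sigma>, \<sigma>)) (Tensor (Specht \<mu>) (Specht \<nu>))) ?\<psi>"
    using rep_char_Res[OF rep_char_Tensor[OF rep_char_Specht[OF part(2) N(2)] rep_char_Specht[OF part(3) N(3)]]
        sym_group_finite_group, of "\<lambda>\<sigma>. (\<sigma>, \<sigma>)" q] size by simp
  then have "fact q * of_nat (kronecker lam \<mu> \<nu>) =
      (\<Sum>g | g permutes {1..q}. of_int (irr_char N lam g) * ?\<psi> g)"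
    unfolding kronecker_def size(1)[symmetric]
    by (rule multiplicity_Specht[OF part(1) N(1)])
       (use irr_char_conj[OF part(2) N(2)] irr_char_conj[OF part(3) N(3)] size in simp)
  then have "(of_int (fact q * int (kronecker lam \<mu> \<nu>)) :: complex) =
      of_int (kron_sum N q (shifted N lam) (shifted N \<mu>) (shifted N \<nu>))"
    by (simp add: kron_sum_def size)
  then show ?thesis by (simp only: of_int_eq_iff)
qed

section \<open>Characters on Young subgroups\<close>

lemma permutes_le_iff: "\<sigma> permutes {1..p} \<Longrightarrow> \<sigma> i \<le> p \<longleftrightarrow> i \<le> p"
  using permutes_in_image[of \<sigma> "{1..p}" i] permutes_not_in[of \<sigma> "{1..p}" i]
  by (cases "i \<in> {1..p}") simp_all

text \<open>Letters start at 1, but the index type contains 0. Positivity of the image keeps the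
  shifted block of \<open>young_embed\<close> strictly above \<open>p\<close>, so composition does
  not mix the two branches.\<close>

lemma permutes_pos_iff: "\<tau> permutes {1..s} \<Longrightarrow> 1 \<le> \<tau> i \<longleftrightarrow> 1 \<le> i"
  using permutes_in_image[of \<tau> "{1..s}" i] permutes_not_in[of \<tau> "{1..s}" i]
  by (cases "i \<in> {1..s}") simp_all

lemma young_embed_compose:
  assumes "\<sigma>' permutes {1..p}" "\<tau>' permutes {1..s}"
  shows "young_embed p (\<sigma> \<circ> \<sigma>') (\<tau> \<circ> \<tau>') = young_embed p \<sigma> \<tau> \<circ> young_embed p \<sigma>' \<tau>'"
proof
  fix i
  show "young_embed p (\<sigma> \<circ> \<sigma>') (\<tau> \<circ> \<tau>') i = (young_embed p \<sigma> \<tau> \<circ> young_embed p \<sigma>' \<tau>') i"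
  proof (cases "i \<le> p")
    case True
    then show ?thesis using permutes_le_iff[OF assms(1), of i] by (simp add: young_embed_def)
  next
    case False
    then have "1 \<le> \<tau>' (i - p)" using permutes_pos_iff[OF assms(2), of "i - p"] by simp
    then show ?thesis using False by (simp add: young_embed_def)
  qed
qed

lemma young_embed_id: "young_embed p id id = id"
  by (auto simp: young_embed_def)

lemma young_embed_permutes:
  assumes \<sigma>: "\<sigma> permutes {1..p}" and \<tau>: "\<tau> permutes {1..s}"
  shows "young_embed p \<sigma> \<tau> permutes {1..p + s}"
  unfolding permutes_def
proof (intro conjI)
  have "young_embed p \<sigma> \<tau> \<circ> young_embed p (inv' \<sigma>) (inv' \<tau>) = id"
    "young_embed p (inv' \<sigma>) (inv' \<tau>) \<circ> young_embed p \<sigma> \<tau> = id"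
    using young_embed_compose[OF permutes_inv[OF \<sigma>] permutes_inv[OF \<tau>], of \<sigma> \<tau>]
      young_embed_compose[OF \<sigma> \<tau>, of "inv' \<sigma>" "inv' \<tau>"]
    by (simp_all add: permutes_inv_o[OF \<sigma>] permutes_inv_o[OF \<tau>] young_embed_id)
  then have "bij (young_embed p \<sigma> \<tau>)" by (rule o_bij[rotated])
  then show "\<forall>y. \<exists>!x. young_embed p \<sigma> \<tau> x = y" unfolding bij_iff .
  show "\<forall>i. i \<notin> {1..p + s} \<longrightarrow> young_embed p \<sigma> \<tau> i = i"
  proof (intro allI impI)
    fix i assume i: "i \<notin> {1..p + s}"
    show "young_embed p \<sigma> \<tau> i = i"
    proof (cases "i \<le> p")
      case True
      then have "i \<notin> {1..p}" using i by simp
      then show ?thesis using True permutes_not_in[OF \<sigma>] by (simp add: young_embed_def)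
    next
      case False
      then have "i - p \<notin> {1..s}" using i by auto
      then show ?thesis using False permutes_not_in[OF \<tau>] by (simp add: young_embed_def)
    qed
  qed
qed

lemma frob_young_embed:
  assumes \<sigma>: "\<sigma> permutes {1..p}" and \<tau>: "\<tau> permutes {1..s}"
  shows "frob N {1..p + s} u (young_embed p \<sigma> \<tau>) =
    (\<Sum>w\<in>inv_words N {1..p} \<sigma>. frob N {1..s} (\<lambda>i. u i - int (content {1..p} w i)) \<tau>)"
proof -
  let ?\<tau> = "\<lambda>k. \<tau> (k - p) + p"
  have set: "{1..p + s} = {1..p} \<union> (\<lambda>k. k + p) ` {1..s}"
    unfolding image_add_atLeastAtMost' by auto
  have "frob N {1..p + s} u (young_embed p \<sigma> \<tau>) =
      (\<Sum>w\<in>inv_words N {1..p} \<sigma>. frob N ((\<lambda>k. k + p) ` {1..s}) (\<lambda>i. u i - int (content {1..p} w i)) ?\<tau>)"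
    unfolding set
  proof (rule frob_split)
    fix k assume "k \<in> {1..p}"
    then show "young_embed p \<sigma> \<tau> k = \<sigma> k \<and> \<sigma> k \<in> {1..p}"
      using permutes_in_image[OF \<sigma>, of k] by (simp add: young_embed_def)
  next
    fix k assume "k \<in> (\<lambda>k. k + p) ` {1..s}"
    then obtain j where j: "k = j + p" "j \<in> {1..s}" by blast
    then have "\<tau> j \<in> {1..s}" using permutes_in_image[OF \<tau>] by simp
    then show "young_embed p \<sigma> \<tau> k = ?\<tau> k \<and> ?\<tau> k \<in> (\<lambda>k. k + p) ` {1..s}"
      using j by (simp add: young_embed_def)
  qed auto
  also have "\<dots> = (\<Sum>w\<in>inv_words N {1..p} \<sigma>. frob N {1..s} (\<lambda>i. u i - int (content {1..p} w i)) \<tau>)"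
  proof (rule sum.cong[OF refl], rule frob_transport)
    fix k assume "k \<in> {1..s}"
    then show "\<tau> k \<in> {1..s}" using permutes_in_image[OF \<tau>] by simp
  qed (auto simp: inj_on_def)
  finally show ?thesis .
qed

text \<open>The two contents are subtracted in either order, so the second block can be split off
  instead of the first. Together both forms isolate the middle factor of a product of three
  groups.\<close>

lemma frob_young_embed':
  assumes \<sigma>: "\<sigma> permutes {1..p}" and \<tau>: "\<tau> permutes {1..s}"
  shows "frob N {1..p + s} u (young_embed p \<sigma> \<tau>) =
    (\<Sum>w\<in>inv_words N {1..s} \<tau>. frob N {1..p} (\<lambda>i. u i - int (content {1..s} w i)) \<sigma>)"
  unfolding frob_young_embed[OF assms] unfolding frob_def
  by (subst sum.swap) (simp add: algebra_simps)

text \<open>Frobenius reciprocity for the induction in the definition of the product. The inducing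
  group has order p! q! r!, and its middle component \<open>b\<close> enters all three
  characters.\<close>

theorem heisenberg_coeff_eq_sum:
  assumes part: "is_partition lam" "is_partition \<mu>" "is_partition \<nu>"
    and N: "\<forall>i\<ge>N. lam i = 0" "\<forall>i\<ge>N. \<mu> i = 0" "\<forall>i\<ge>N. \<nu> i = 0"
    and size: "psize lam = p + q + r" "psize \<mu> = p + q" "psize \<nu> = q + r"
  shows "fact p * fact q * fact r * int (heisenberg_coeff lam \<mu> \<nu>) =
    (\<Sum>a | a permutes {1..p}. \<Sum>b | b permutes {1..q}. \<Sum>c | c permutes {1..r}.
      irr_char N lam (young_embed p a (young_embed q b c)) *
      (irr_char N \<mu> (young_embed p a b) * irr_char N \<nu> (young_embed q b c)))"
proof -
  let ?H = "sym_group p \<times>\<times> sym_group q \<times>\<times> sym_group r"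
  let ?\<phi> = "\<lambda>(a, b, c). young_embed p a (young_embed q b c)"
  let ?\<psi> = "\<lambda>(a, b, c). (young_embed p a b, young_embed q b c)"
  have carr: "carrier (sym_group n) = {g. g permutes {1..n}}" for n by (simp add: sym_group_def)
  have pqr: "psize lam - psize \<nu> = p" "psize \<mu> + psize \<nu> - psize lam = q" "psize lam - psize \<mu> = r"
    "max (psize \<mu>) (psize \<nu>) \<le> psize lam" "psize lam \<le> psize \<mu> + psize \<nu>"
    using size by auto
  have Heis: "Heisenberg (psize \<mu>) (psize \<nu>) (Specht \<mu>) (Specht \<nu>) (psize lam) =
      Ind ?H (sym_group (psize lam)) ?\<phi> (Res ?\<psi> (Tensor (Specht \<mu>) (Specht \<nu>)))"
    using pqr by (simp add: Heisenberg_def Let_def)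
  have H: "finite_group ?H"
    using finite_group.finite_carrier[OF sym_group_finite_group]
    by (intro finite_group.intro finite_group_axioms.intro DirProd_group sym_group_is_group) simp
  have emb_pq: "young_embed p a b permutes {1..psize \<mu>}" if "a permutes {1..p}" "b permutes {1..q}" for a b
    using young_embed_permutes[OF that] size by simp
  have emb_qr: "young_embed q b c permutes {1..psize \<nu>}" if "b permutes {1..q}" "c permutes {1..r}" for b c
    using young_embed_permutes[OF that] size by simp
  have emb_pqr: "young_embed p a (young_embed q b c) permutes {1..psize lam}"
    if "a permutes {1..p}" "b permutes {1..q}" "c permutes {1..r}" for a b c
    using young_embed_permutes[OF that(1) young_embed_permutes[OF that(2,3)]] size by (simp add: add.assoc)
  have \<phi>: "?\<phi> \<in> hom ?H (sym_group (psize lam))"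
    by (auto simp: hom_def carr sym_group_mult emb_pqr young_embed_compose young_embed_permutes
        intro!: emb_pqr)
       (metis young_embed_compose young_embed_permutes)
  have \<psi>: "?\<psi> \<in> hom ?H (sym_group (psize \<mu>) \<times>\<times> sym_group (psize \<nu>))"
    by (auto simp: hom_def carr sym_group_mult emb_pq emb_qr young_embed_compose)
  have "rep_char ?H (Res ?\<psi> (Tensor (Specht \<mu>) (Specht \<nu>)))
      (\<lambda>k. (\<lambda>(g, h). of_int (irr_char N \<mu> g) * of_int (irr_char N \<nu> h)) (?\<psi> k))"
    by (rule rep_char_Res[OF rep_char_Tensor[OF rep_char_Specht[OF part(2) N(2)] rep_char_Specht[OF part(3) N(3)]] H \<psi>])
  from multiplicity_Specht_Ind[OF part(1) N(1) this \<phi>]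
  have "(of_nat (order ?H) :: complex) * of_nat (heisenberg_coeff lam \<mu> \<nu>) =
      (\<Sum>k\<in>carrier ?H. of_int (irr_char N lam (?\<phi> k)) *
        (\<lambda>(g, h). of_int (irr_char N \<mu> g) * of_int (irr_char N \<nu> h)) (?\<psi> k))"
    by (simp only: heisenberg_coeff_def Heis)
  also have "\<dots> = (\<Sum>a | a permutes {1..p}. \<Sum>b | b permutes {1..q}. \<Sum>c | c permutes {1..r}.
      of_int (irr_char N lam (young_embed p a (young_embed q b c)) *
      (irr_char N \<mu> (young_embed p a b) * irr_char N \<nu> (young_embed q b c))))"
    by (simp add: carr sum.cartesian_product')
  finally have "(of_int (fact p * fact q * fact r * int (heisenberg_coeff lam \<mu> \<nu>)) :: complex) =
    of_int (\<Sum>a | a permutes {1..p}. \<Sum>b | b permutes {1..q}. \<Sum>c | c permutes {1..r}.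
      irr_char N lam (young_embed p a (young_embed q b c)) *
      (irr_char N \<mu> (young_embed p a b) * irr_char N \<nu> (young_embed q b c)))"
    by (simp add: order_def card_cartesian_product carr card_permutations mult.assoc)
  then show ?thesis by (simp only: of_int_eq_iff)
qed

section \<open>Stability\<close>

lemma add_multiple_add: "add_multiple (add_multiple lam m \<alpha>) n \<alpha> = add_multiple lam (m + n) \<alpha>"
  by (simp add: add_multiple_def fun_eq_iff algebra_simps)

lemma add_multiple_partition:
  assumes "is_partition lam" "is_partition \<alpha>"
  shows "is_partition (add_multiple lam n \<alpha>)"
  unfolding is_partition_def
proof
  show "antimono (add_multiple lam n \<alpha>)"
    using assms by (auto simp: is_partition_def add_multiple_def antimono_def intro!: add_mono)
  have "{i. add_multiple lam n \<alpha> i \<noteq> 0} \<subseteq> {i. lam i \<noteq> 0} \<union> {i. \<alpha> i \<noteq> 0}"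
    by (auto simp: add_multiple_def)
  then show "finite {i. add_multiple lam n \<alpha> i \<noteq> 0}"
    using assms by (auto simp: is_partition_def intro: finite_subset)
qed

lemma add_multiple_eq_0:
  "\<forall>i\<ge>N. lam i = 0 \<Longrightarrow> \<forall>i\<ge>N. \<alpha> i = 0 \<Longrightarrow> \<forall>i\<ge>N. add_multiple lam n \<alpha> i = 0"
  by (simp add: add_multiple_def)

lemma partitions_bounded:
  assumes "finite S" "\<forall>lam\<in>S. is_partition lam"
  shows "\<exists>N. \<forall>lam\<in>S. \<forall>i\<ge>N. lam i = 0"
  using assms
proof (induction S)
  case (insert lam S)
  then obtain N where N: "\<forall>lam\<in>S. \<forall>i\<ge>N. lam i = 0" by blast
  obtain N' where N': "\<forall>i\<ge>N'. lam i = 0" using partition_bounded[of lam] insert.prems by blast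
  have "\<forall>l\<in>insert lam S. \<forall>i\<ge>N + N'. l i = 0" using N N' by auto
  then show ?case by blast
qed simp

lemma psize_add_multiple:
  assumes "is_partition lam" "is_partition \<alpha>"
  shows "psize (add_multiple lam n \<alpha>) = psize lam + n * psize \<alpha>"
proof -
  obtain N where N: "\<forall>i\<ge>N. lam i = 0" "\<forall>i\<ge>N. \<alpha> i = 0"
    using partitions_bounded[of "{lam, \<alpha>}"] assms by auto
  show ?thesis
    unfolding psize_def psum_eq_psize[OF N(1), symmetric, unfolded psize_def] psum_eq_psize[OF N(2), symmetric, unfolded psize_def]
      psum_eq_psize[OF add_multiple_eq_0[OF N], symmetric, unfolded psize_def]
    by (simp add: psum_def add_multiple_def sum.distrib sum_distrib_left)
qed

lemma shifted_add_multiple: "shifted N (add_multiple lam n \<alpha>) i = shifted N lam i + int n * int (\<alpha> i)"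
  by (simp add: shifted_def add_multiple_def)

lemma sorting_permutation:
  fixes u :: "nat \<Rightarrow> int"
  obtains \<tau> where "\<tau> permutes {..<N}" "\<And>i j. i \<le> j \<Longrightarrow> j < N \<Longrightarrow> u (\<tau> j) \<le> u (\<tau> i)"
proof -
  define xs where "xs = map u [0..<N]"
  define ys where "ys = rev (sort xs)"
  have len: "length xs = N" "length ys = N" by (simp_all add: xs_def ys_def)
  have "mset ys = mset xs" by (simp add: ys_def)
  then obtain \<tau> where \<tau>: "\<tau> permutes {..<length xs}" "permute_list \<tau> xs = ys"
    by (rule mset_eq_permutation)
  have \<tau>p: "\<tau> permutes {..<N}" using \<tau>(1) len by simp
  have nth: "ys ! i = u (\<tau> i)" if "i < N" for i
  proof -
    have "\<tau> i < N" using permutes_in_image[OF \<tau>p, of i] that by simp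
    then show ?thesis using that len \<tau> by (simp add: permute_list_nth xs_def flip: \<tau>(2))
  qed
  have "u (\<tau> j) \<le> u (\<tau> i)" if "i \<le> j" "j < N" for i j
  proof -
    have "sorted (rev ys)" by (simp add: ys_def)
    then have "ys ! j \<le> ys ! i" using that len by (intro sorted_rev_nth_mono) auto
    then show ?thesis using that nth by simp
  qed
  with \<tau>p show thesis by (rule that)
qed

text \<open>Both sequences are decreasing arrangements of one multiset. This shows that sorting
  \<open>x + n \<alpha>\<close> leaves \<open>\<alpha>\<close> fixed.\<close>

lemma antimono_rearrangement_eq:
  fixes \<alpha> :: "nat \<Rightarrow> nat"
  assumes \<tau>: "\<tau> permutes {..<N}" and \<alpha>: "\<And>i j. i \<le> j \<Longrightarrow> j < N \<Longrightarrow> \<alpha> j \<le> \<alpha> i"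
    and \<alpha>\<tau>: "\<And>i j. i \<le> j \<Longrightarrow> j < N \<Longrightarrow> \<alpha> (\<tau> j) \<le> \<alpha> (\<tau> i)" and i: "i < N"
  shows "\<alpha> (\<tau> i) = \<alpha> i"
proof -
  let ?xs = "map (\<lambda>i. \<alpha> (\<tau> i)) [0..<N]" and ?ys = "map \<alpha> [0..<N]"
  have "mset ?xs = image_mset \<alpha> (image_mset \<tau> (mset_set {..<N}))"
    by (simp add: image_mset.compositionality comp_def atLeast0LessThan)
  also have "\<dots> = mset ?ys" using permutes_image_mset[OF \<tau>] by (simp add: atLeast0LessThan)
  finally have "mset (rev ?xs) = mset (rev ?ys)" by simp
  moreover have "sorted (rev ?xs)" "sorted (rev ?ys)"
    using \<alpha> \<alpha>\<tau> by (auto simp: sorted_rev_iff_nth_mono)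
  ultimately have "rev ?xs = rev ?ys" using properties_for_sort by metis
  then have "?xs = ?ys" by (simp only: rev_is_rev_conv)
  then show ?thesis using i by simp
qed

text \<open>
  For large \<open>n\<close> only entries of \<open>x + n \<alpha>\<close> with equal \<open>\<alpha>\<close> can be out of order, so one permutation,
  which fixes \<open>\<alpha>\<close>, straightens all these vectors at once.
\<close>

lemma straighten:
  assumes \<alpha>: "is_partition \<alpha>" and N: "\<forall>i\<ge>N. \<alpha> i = 0"
  obtains n0 where "\<And>(A :: 'a set) \<sigma> n. n0 \<le> n \<Longrightarrow> \<sigma> ` A \<subseteq> A \<Longrightarrow> frob (Suc N) A (\<lambda>i. x i + int n * int (\<alpha> i)) \<sigma> = 0"
  | n0 lam s where "is_partition lam" "\<forall>i\<ge>Suc N. lam i = 0"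
    "(\<Sum>i<Suc N. shifted (Suc N) lam i) = (\<Sum>i<Suc N. x i + int n0 * int (\<alpha> i))"
    "\<And>(A :: 'a set) \<sigma> n. \<sigma> ` A \<subseteq> A \<Longrightarrow> frob (Suc N) A (\<lambda>i. x i + int (n0 + n) * int (\<alpha> i)) \<sigma> =
      s * frob (Suc N) A (shifted (Suc N) (add_multiple lam n \<alpha>)) \<sigma>"
proof -
  define B where "B = (\<Sum>i<Suc N. \<bar>x i\<bar>)"
  have xB: "\<bar>x i\<bar> \<le> B" if "i < Suc N" for i unfolding B_def using that by (intro member_le_sum) auto
  have "0 \<le> B" using xB[of 0] by simp
  \<comment> \<open>Entries of \<open>x\<close> differ by at most \<open>2 * B\<close>, so from
    \<open>n0\<close> on a gap of one in \<open>\<alpha>\<close> outweighs every difference in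
    \<open>x\<close>.\<close>
  define n0 where "n0 = nat (2 * B + 1)"
  define u where "u n i = x i + int n * int (\<alpha> i)" for n i
  have sep: "u n0 j < u n0 i" if "i < Suc N" "j < Suc N" "\<alpha> j < \<alpha> i" for i j
  proof -
    have "int n0 * 1 \<le> int n0 * (int (\<alpha> i) - int (\<alpha> j))" using that by (intro mult_left_mono) auto
    then have "int n0 \<le> int n0 * int (\<alpha> i) - int n0 * int (\<alpha> j)" by (simp add: right_diff_distrib)
    then show ?thesis using xB[OF that(1)] xB[OF that(2)] \<open>0 \<le> B\<close> by (simp add: u_def n0_def)
  qed
  obtain \<tau> where \<tau>: "\<tau> permutes {..<Suc N}" "\<And>i j. i \<le> j \<Longrightarrow> j < Suc N \<Longrightarrow> u n0 (\<tau> j) \<le> u n0 (\<tau> i)"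
    by (rule sorting_permutation[of "Suc N" "u n0"]) blast
  have \<tau>_in: "\<tau> i < Suc N" if "i < Suc N" for i using permutes_in_image[OF \<tau>(1), of i] that by simp
  have anti: "\<alpha> j \<le> \<alpha> i" if "i \<le> j" for i j using \<alpha> that by (simp add: is_partition_def antimonoD)
  have \<alpha>\<tau>: "\<alpha> (\<tau> i) = \<alpha> i" if "i < Suc N" for i
  proof (rule antimono_rearrangement_eq[OF \<tau>(1) anti _ that])
    fix i j assume ij: "i \<le> j" "j < Suc N"
    then show "\<alpha> (\<tau> j) \<le> \<alpha> (\<tau> i)"
      using sep[of "\<tau> j" "\<tau> i"] \<tau>(2)[OF ij] \<tau>_in[of i] \<tau>_in[of j] by force
  qed
  define v where "v i = u n0 (\<tau> i)" for i
  have u_\<tau>: "u (n0 + n) (\<tau> i) = v i + int n * int (\<alpha> i)" if "i < Suc N" for n i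
    using \<alpha>\<tau>[OF that] by (simp add: u_def v_def algebra_simps)
  have frob_\<tau>: "frob (Suc N) A (u n) \<sigma> = sign \<tau> * frob (Suc N) A (\<lambda>i. u n (\<tau> i)) \<sigma>"
    if "\<sigma> ` A \<subseteq> A" for A :: "'a set" and \<sigma> n
    by (simp add: frob_permute[OF \<tau>(1) that, of "u n"] mult.assoc[symmetric] sign_idempotent)
  \<comment> \<open>A sorted vector with two equal entries or a negative last entry has vanishing
    alternating sum; otherwise it is a shifted partition. Equal entries at \<open>n0\<close> have
    equal \<open>\<alpha>\<close> by \<open>sep\<close>, so they stay equal for all
    \<open>n\<close>.\<close>
  consider (eq) i where "Suc i < Suc N" "v (Suc i) = v i" | (neg) "v N < 0"
    | (part) "strict_dec (Suc N) v" "0 \<le> v N"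
  proof (cases "strict_dec (Suc N) v")
    case False
    then obtain i where i: "Suc i < Suc N" "v i \<le> v (Suc i)" by (auto simp: strict_dec_def not_less)
    then have "v (Suc i) = v i" using \<tau>(2)[of i "Suc i"] by (simp add: v_def)
    then show thesis using eq i(1) by blast
  qed (use neg part in linarith)
  then show thesis
  proof cases
    case eq
    have ne: "\<tau> (Suc i) \<noteq> \<tau> i" using injD[OF permutes_inj[OF \<tau>(1)], of "Suc i" i] by auto
    have "\<alpha> (\<tau> (Suc i)) = \<alpha> (\<tau> i)"
      using sep[of "\<tau> (Suc i)" "\<tau> i"] sep[of "\<tau> i" "\<tau> (Suc i)"] eq \<tau>_in[of i] \<tau>_in[of "Suc i"]
      by (metis v_def Suc_lessD less_irrefl linorder_neqE_nat)
    then have "u n (\<tau> (Suc i)) = u n (\<tau> i)" for n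
      using eq(2) by (simp add: v_def u_def)
    then have "frob (Suc N) A (u n) \<sigma> = 0" if "\<sigma> ` A \<subseteq> A" for A :: "'a set" and \<sigma> n
      using frob_eq_entries[OF \<tau>_in[OF eq(1)] \<tau>_in[of i] ne _ that, of "u n"] eq(1) by simp
    then show thesis unfolding u_def by (intro that(1)[of 0])
  next
    case neg
    \<comment> \<open>The additional coordinate has \<open>\<alpha> N = 0\<close>, and
      \<open>\<tau>\<close> preserves \<open>\<alpha>\<close>; hence this smallest entry does not
      change with \<open>n\<close>.\<close>
    have "u n (\<tau> N) < 0" for n using neg \<alpha>\<tau>[of N] N by (simp add: v_def u_def)
    then have "frob (Suc N) A (u n) \<sigma> = 0" for A :: "'a set" and \<sigma> n
      using frob_negative[OF \<tau>_in[OF lessI], of "u n"] \<open>u n (\<tau> N) < 0\<close> by blast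
    then show thesis unfolding u_def by (intro that(1)[of 0])
  next
    case part
    have nn: "0 \<le> v i" if "i < Suc N" for i using \<tau>(2)[of i N] that part(2) by (simp add: v_def)
    \<comment> \<open>Undoes the staircase shift. The subtraction is exact since a strictly
      decreasing nonnegative vector lies above the staircase.\<close>
    define lam where "lam i = (if i < Suc N then nat (v i - delta (Suc N) i) else 0)" for i
    have lam: "int (lam i) = v i - delta (Suc N) i" if "i < Suc N" for i
      using strict_dec_ge_delta[OF part(1) nn that] that by (simp add: lam_def)
    have "lam (Suc i) \<le> lam i" for i
    proof (cases "Suc i < Suc N")
      case True
      then have "v (Suc i) < v i" using part(1) by (simp add: strict_dec_def)
      then have "int (lam (Suc i)) \<le> int (lam i)" using True by (simp add: lam delta_def)
      then show ?thesis by simp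
    qed (simp add: lam_def)
    then have "is_partition lam"
      unfolding is_partition_def
      by (auto simp: antimono_iff_le_Suc lam_def intro!: finite_subset[of _ "{..<Suc N}"])
    moreover have "\<forall>i\<ge>Suc N. lam i = 0" by (simp add: lam_def)
    moreover have shifted: "shifted (Suc N) lam i = v i" if "i < Suc N" for i
      using lam[OF that] by (simp add: shifted_def)
    then have "(\<Sum>i<Suc N. shifted (Suc N) lam i) = (\<Sum>i<Suc N. u n0 (\<tau> i))" by (simp add: v_def)
    then have "(\<Sum>i<Suc N. shifted (Suc N) lam i) = (\<Sum>i<Suc N. x i + int n0 * int (\<alpha> i))"
      using sum.permute[OF \<tau>(1), of "u n0"] by (simp add: comp_def u_def)
    moreover have "frob (Suc N) A (\<lambda>i. x i + int (n0 + n) * int (\<alpha> i)) \<sigma> =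
        sign \<tau> * frob (Suc N) A (shifted (Suc N) (add_multiple lam n \<alpha>)) \<sigma>"
      if "\<sigma> ` A \<subseteq> A" for A :: "'a set" and \<sigma> n
    proof -
      have "frob (Suc N) A (\<lambda>i. u (n0 + n) (\<tau> i)) \<sigma> =
          frob (Suc N) A (shifted (Suc N) (add_multiple lam n \<alpha>)) \<sigma>"
        by (rule frob_cong) (simp add: u_\<tau> shifted_add_multiple shifted)
      then have "frob (Suc N) A (u (n0 + n)) \<sigma> =
          sign \<tau> * frob (Suc N) A (shifted (Suc N) (add_multiple lam n \<alpha>)) \<sigma>"
        by (simp only: frob_\<tau>[OF that, of "n0 + n"])
      then show ?thesis unfolding u_def .
    qed
    ultimately show thesis by (rule that(2))
  qed
qed

section \<open>Eventually constant sequences\<close>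

lemma eventually_constant_eventually_eq:
  assumes "eventually_constant f" "\<forall>\<^sub>F n in sequentially. g n = f n"
  shows "eventually_constant g"
proof -
  from assms(1) obtain c where "\<forall>\<^sub>F n in sequentially. f n = c"
    unfolding eventually_constant_def by blast
  with assms(2) have "\<forall>\<^sub>F n in sequentially. g n = c" by eventually_elim simp
  then show ?thesis unfolding eventually_constant_def by blast
qed

lemma eventually_constant_compose:
  assumes "eventually_constant f"
  shows "eventually_constant (\<lambda>n. F (f n))"
proof -
  from assms obtain c where "\<forall>\<^sub>F n in sequentially. f n = c"
    unfolding eventually_constant_def by blast
  then have "\<forall>\<^sub>F n in sequentially. F (f n) = F c" by eventually_elim simp
  then show ?thesis unfolding eventually_constant_def by blast
qed

lemma eventually_constant_const: "eventually_constant (\<lambda>n. c)"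
  by (auto simp: eventually_constant_def)

lemma eventually_constant_add:
  assumes "eventually_constant f" "eventually_constant g"
  shows "eventually_constant (\<lambda>n. f n + g n)"
proof -
  from assms obtain c d where "\<forall>\<^sub>F n in sequentially. f n = c" "\<forall>\<^sub>F n in sequentially. g n = d"
    unfolding eventually_constant_def by blast
  then have "\<forall>\<^sub>F n in sequentially. f n + g n = c + d" by eventually_elim simp
  then show ?thesis unfolding eventually_constant_def by blast
qed

lemma eventually_constant_sum:
  assumes "\<And>i. i \<in> I \<Longrightarrow> eventually_constant (f i)"
  shows "eventually_constant (\<lambda>n. \<Sum>i\<in>I. f i n)"
  using assms
  by (induction I rule: infinite_finite_induct)
     (auto simp: eventually_constant_const intro: eventually_constant_add)

lemma eventually_constant_shift:
  assumes "eventually_constant (\<lambda>n. f (m + n))"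
  shows "eventually_constant f"
proof -
  from assms obtain c k where c: "\<And>n. k \<le> n \<Longrightarrow> f (m + n) = c"
    unfolding eventually_constant_def eventually_sequentially by blast
  have "f n = c" if "m + k \<le> n" for n
    using c[of "n - m"] that by simp
  then show ?thesis unfolding eventually_constant_def eventually_sequentially by blast
qed

text \<open>Straightening turns the three vectors into signs times shifted partitions. Since the
  entries of each vector add up to \<open>q\<close> plus the staircase, these partitions have equal
  sizes, as K-stability requires. The growing factorial normalises the sum over permutations to a
  Kronecker coefficient.\<close>

lemma eventually_constant_kron_sum:
  assumes stable: "K_stable \<alpha> \<beta> \<gamma>" and N: "\<forall>i\<ge>N. \<alpha> i = 0" "\<forall>i\<ge>N. \<beta> i = 0" "\<forall>i\<ge>N. \<gamma> i = 0"
    and size: "(\<Sum>i<Suc N. x i) = int q + (\<Sum>i<Suc N. delta (Suc N) i)"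
      "(\<Sum>i<Suc N. y i) = int q + (\<Sum>i<Suc N. delta (Suc N) i)"
      "(\<Sum>i<Suc N. z i) = int q + (\<Sum>i<Suc N. delta (Suc N) i)"
  shows "eventually_constant (\<lambda>n. real_of_int (kron_sum (Suc N) (q + n * psize \<alpha>)
    (\<lambda>i. x i + int n * int (\<alpha> i)) (\<lambda>i. y i + int n * int (\<beta> i)) (\<lambda>i. z i + int n * int (\<gamma> i))) /
      fact (q + n * psize \<alpha>))"
    (is "eventually_constant ?f")
proof -
  have part: "is_partition \<alpha>" "is_partition \<beta>" "is_partition \<gamma>"
    and sizes: "psize \<beta> = psize \<alpha>" "psize \<gamma> = psize \<alpha>"
    using stable by (auto simp: K_stable_def K_triple_def)
  have image: "b ` {1..m} \<subseteq> {1..m}" if "b permutes {1..m}" for b :: "nat \<Rightarrow> nat" and m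
    using permutes_image[OF that] by simp
  have zero: "eventually_constant ?f"
    if vanish: "\<And>n b. n0 \<le> n \<Longrightarrow> b permutes {1..q + n * psize \<alpha>} \<Longrightarrow>
      frob (Suc N) {1..q + n * psize \<alpha>} (\<lambda>i. x i + int n * int (\<alpha> i)) b = 0 \<or>
      frob (Suc N) {1..q + n * psize \<alpha>} (\<lambda>i. y i + int n * int (\<beta> i)) b = 0 \<or>
      frob (Suc N) {1..q + n * psize \<alpha>} (\<lambda>i. z i + int n * int (\<gamma> i)) b = 0" for n0
  proof (rule eventually_constant_eventually_eq[OF eventually_constant_const])
    have "?f n = 0" if "n0 \<le> n" for n
      unfolding kron_sum_def using vanish[OF that] by (subst sum.neutral) auto
    then show "\<forall>\<^sub>F n in sequentially. ?f n = 0" by (auto simp: eventually_sequentially)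
  qed
  from part(1) N(1) show ?thesis
  proof (cases rule: straighten[where x=x and 'a=nat])
    case (1 n0)
    then show ?thesis using zero[of n0] image by blast
  next
    case x: (2 n1 lam s1)
    from part(2) N(2) show ?thesis
    proof (cases rule: straighten[where x=y and 'a=nat])
      case (1 n0)
      then show ?thesis using zero[of n0] image by blast
    next
      case y: (2 n2 \<mu> s2)
      from part(3) N(3) show ?thesis
      proof (cases rule: straighten[where x=z and 'a=nat])
        case (1 n0)
        then show ?thesis using zero[of n0] image by blast
      next
        case z: (2 n3 \<nu> s3)
        \<comment> \<open>The three vectors are straightened from different starting points. Adding
          the other two thresholds to each partition moves them to the common start
          \<open>m\<close>.\<close>
        define m where "m = n1 + n2 + n3"
        define L where "L = add_multiple lam (n2 + n3) \<alpha>"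
        define L' where "L' = add_multiple \<mu> (n1 + n3) \<beta>"
        define L'' where "L'' = add_multiple \<nu> (n1 + n2) \<gamma>"
        \<comment> \<open>Straightening preserves the sum of the entries, and removing the staircase
          leaves the size.\<close>
        have psize: "psize (add_multiple \<kappa> k \<delta>) = q + (j + k) * psize \<alpha>"
          if "is_partition \<kappa>" "\<forall>i\<ge>Suc N. \<kappa> i = 0" "is_partition \<delta>" "\<forall>i\<ge>N. \<delta> i = 0" "psize \<delta> = psize \<alpha>"
            "(\<Sum>i<Suc N. shifted (Suc N) \<kappa> i) = (\<Sum>i<Suc N. w i + int j * int (\<delta> i))"
            "(\<Sum>i<Suc N. w i) = int q + (\<Sum>i<Suc N. delta (Suc N) i)" for \<kappa> \<delta> w j k
        proof -
          have "int (psum \<kappa> (Suc N)) = int q + int j * int (psum \<delta> (Suc N))"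
            using that(6,7) by (simp only: psum_def shifted_def sum.distrib sum_distrib_left of_nat_sum)
          moreover have "psum \<kappa> (Suc N) = psize \<kappa>" "psum \<delta> (Suc N) = psize \<alpha>"
            using psum_eq_psize[of "Suc N" \<kappa>] psum_eq_psize[of "Suc N" \<delta>] that by auto
          ultimately have "int (psize \<kappa>) = int (q + j * psize \<alpha>)" by simp
          then have "psize \<kappa> = q + j * psize \<alpha>" by (simp only: of_nat_eq_iff)
          then show ?thesis using psize_add_multiple[OF that(1,3)] that(5) by (simp add: algebra_simps)
        qed
        have parts: "is_partition L" "is_partition L'" "is_partition L''"
          using x y z part by (simp_all add: L_def L'_def L''_def add_multiple_partition)
        have psizes: "psize L = q + m * psize \<alpha>" "psize L' = q + m * psize \<alpha>" "psize L'' = q + m * psize \<alpha>"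
          using psize[OF x(1,2) part(1) N(1) refl x(3) size(1), of "n2 + n3"]
            psize[OF y(1,2) part(2) N(2) sizes(1) y(3) size(2), of "n1 + n3"]
            psize[OF z(1,2) part(3) N(3) sizes(2) z(3) size(3), of "n1 + n2"]
          by (simp_all add: L_def L'_def L''_def m_def ac_simps)
        have "eventually_constant (\<lambda>n. kronecker (add_multiple L n \<alpha>) (add_multiple L' n \<beta>) (add_multiple L'' n \<gamma>))"
          using stable parts psizes by (simp add: K_stable_def)
        then have ec: "eventually_constant (\<lambda>n. real_of_int (s1 * s2 * s3) *
            real (kronecker (add_multiple L n \<alpha>) (add_multiple L' n \<beta>) (add_multiple L'' n \<gamma>)))"
          by (rule eventually_constant_compose)
        have eq: "?f (m + n) = real_of_int (s1 * s2 * s3) *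
            real (kronecker (add_multiple L n \<alpha>) (add_multiple L' n \<beta>) (add_multiple L'' n \<gamma>))" for n
        proof -
          let ?q = "q + (m + n) * psize \<alpha>"
          have eqs: "frob (Suc N) {1..?q} (\<lambda>i. x i + int (m + n) * int (\<alpha> i)) b =
                s1 * frob (Suc N) {1..?q} (shifted (Suc N) (add_multiple L n \<alpha>)) b"
              "frob (Suc N) {1..?q} (\<lambda>i. y i + int (m + n) * int (\<beta> i)) b =
                s2 * frob (Suc N) {1..?q} (shifted (Suc N) (add_multiple L' n \<beta>)) b"
              "frob (Suc N) {1..?q} (\<lambda>i. z i + int (m + n) * int (\<gamma> i)) b =
                s3 * frob (Suc N) {1..?q} (shifted (Suc N) (add_multiple L'' n \<gamma>)) b"
            if "b permutes {1..?q}" for b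
            using x(4)[OF image[OF that], of "n2 + n3 + n"] y(4)[OF image[OF that], of "n1 + n3 + n"]
              z(4)[OF image[OF that], of "n1 + n2 + n"]
            by (simp_all only: L_def L'_def L''_def add_multiple_add m_def ac_simps)
          have "kron_sum (Suc N) ?q (\<lambda>i. x i + int (m + n) * int (\<alpha> i)) (\<lambda>i. y i + int (m + n) * int (\<beta> i))
              (\<lambda>i. z i + int (m + n) * int (\<gamma> i)) =
            (\<Sum>b | b permutes {1..?q}. s1 * s2 * s3 *
              (frob (Suc N) {1..?q} (shifted (Suc N) (add_multiple L n \<alpha>)) b *
              (frob (Suc N) {1..?q} (shifted (Suc N) (add_multiple L' n \<beta>)) b *
               frob (Suc N) {1..?q} (shifted (Suc N) (add_multiple L'' n \<gamma>)) b)))"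
            unfolding kron_sum_def
          proof (rule sum.cong[OF refl], unfold mem_Collect_eq)
            fix b assume b: "b permutes {1..?q}"
            show "frob (Suc N) {1..?q} (\<lambda>i. x i + int (m + n) * int (\<alpha> i)) b *
                (frob (Suc N) {1..?q} (\<lambda>i. y i + int (m + n) * int (\<beta> i)) b *
                 frob (Suc N) {1..?q} (\<lambda>i. z i + int (m + n) * int (\<gamma> i)) b) =
              s1 * s2 * s3 *
              (frob (Suc N) {1..?q} (shifted (Suc N) (add_multiple L n \<alpha>)) b *
              (frob (Suc N) {1..?q} (shifted (Suc N) (add_multiple L' n \<beta>)) b *
               frob (Suc N) {1..?q} (shifted (Suc N) (add_multiple L'' n \<gamma>)) b))"
              unfolding eqs[OF b] by (simp only: ac_simps)
          qed
          also have "\<dots> = s1 * s2 * s3 * kron_sum (Suc N) ?q (shifted (Suc N) (add_multiple L n \<alpha>))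
              (shifted (Suc N) (add_multiple L' n \<beta>)) (shifted (Suc N) (add_multiple L'' n \<gamma>))"
            by (simp add: kron_sum_def sum_distrib_left)
          also have "\<dots> = s1 * s2 * s3 *
              (fact ?q * int (kronecker (add_multiple L n \<alpha>) (add_multiple L' n \<beta>) (add_multiple L'' n \<gamma>)))"
          proof (rule arg_cong2[where f="(*)", OF refl], rule kronecker_eq_kron_sum[symmetric])
            have ge: "\<forall>i\<ge>Suc N. \<delta> i = 0" if "\<forall>i\<ge>N. \<delta> i = 0" for \<delta> :: "nat \<Rightarrow> nat" using that by auto
            show "\<forall>i\<ge>Suc N. add_multiple L n \<alpha> i = 0" "\<forall>i\<ge>Suc N. add_multiple L' n \<beta> i = 0"
              "\<forall>i\<ge>Suc N. add_multiple L'' n \<gamma> i = 0"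
              using x(2) y(2) z(2) N by (simp_all add: L_def L'_def L''_def add_multiple_def)
            show "psize (add_multiple L n \<alpha>) = ?q" "psize (add_multiple L' n \<beta>) = ?q"
              "psize (add_multiple L'' n \<gamma>) = ?q"
              using parts part psizes sizes by (simp_all add: psize_add_multiple algebra_simps)
          qed (use parts part in \<open>simp_all add: add_multiple_partition\<close>)
          finally show ?thesis by simp
        qed
        show ?thesis
          by (rule eventually_constant_shift[where f="?f" and m=m], unfold eq, rule ec)
      qed
    qed
  qed
qed

lemma sum_shifted:
  assumes "\<forall>i\<ge>N. lam i = 0"
  shows "(\<Sum>i<N. shifted N lam i) = int (psize lam) + (\<Sum>i<N. delta N i)"
  using psum_eq_psize[OF assms] by (simp add: shifted_def sum.distrib psum_def flip: of_nat_sum)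

lemma sum_content_inv_words:
  assumes "finite A" "w \<in> inv_words N A \<sigma>"
  shows "(\<Sum>i<N. int (content A w i)) = int (card A)"
  using sum_content[of A w N] assms by (simp add: inv_words_def flip: of_nat_sum)

text \<open>
  Restricting the three characters to \<open>S p \<times> S q \<times> S r\<close> and pairing over \<open>S q\<close> first expresses the
  Heisenberg coefficient through averages of three Frobenius characters of \<open>S q\<close>; the outer sums do
  not depend on \<open>q\<close>.
\<close>

lemma heisenberg_coeff_eq_kron_sums:
  assumes part: "is_partition lam" "is_partition \<mu>" "is_partition \<nu>"
    and N: "\<forall>i\<ge>N. lam i = 0" "\<forall>i\<ge>N. \<mu> i = 0" "\<forall>i\<ge>N. \<nu> i = 0"
    and size: "psize lam = p + q + r" "psize \<mu> = p + q" "psize \<nu> = q + r"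
  shows "fact p * fact q * fact r * int (heisenberg_coeff lam \<mu> \<nu>) =
    (\<Sum>a | a permutes {1..p}. \<Sum>c | c permutes {1..r}.
     \<Sum>w1\<in>inv_words N {1..p} a. \<Sum>w2\<in>inv_words N {1..r} c. \<Sum>w3\<in>inv_words N {1..p} a. \<Sum>w4\<in>inv_words N {1..r} c.
      kron_sum N q (\<lambda>i. shifted N lam i - int (content {1..p} w1 i) - int (content {1..r} w2 i))
        (\<lambda>i. shifted N \<mu> i - int (content {1..p} w3 i)) (\<lambda>i. shifted N \<nu> i - int (content {1..r} w4 i)))"
proof -
  define F where "F w1 w2 b = frob N {1..q} (\<lambda>i. shifted N lam i - int (content {1..p} w1 i) - int (content {1..r} w2 i)) b"
    for w1 w2 b
  define F' where "F' w b = frob N {1..q} (\<lambda>i. shifted N \<mu> i - int (content {1..p} w i)) b" for w b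
  define F'' where "F'' w b = frob N {1..q} (\<lambda>i. shifted N \<nu> i - int (content {1..r} w i)) b" for w b
  have "fact p * fact q * fact r * int (heisenberg_coeff lam \<mu> \<nu>) =
    (\<Sum>a | a permutes {1..p}. \<Sum>b | b permutes {1..q}. \<Sum>c | c permutes {1..r}.
      (\<Sum>w1\<in>inv_words N {1..p} a. \<Sum>w2\<in>inv_words N {1..r} c. F w1 w2 b) *
      ((\<Sum>w3\<in>inv_words N {1..p} a. F' w3 b) * (\<Sum>w4\<in>inv_words N {1..r} c. F'' w4 b)))"
    unfolding heisenberg_coeff_eq_sum[OF part N size]
  proof (rule sum.cong[OF refl], rule sum.cong[OF refl], rule sum.cong[OF refl], unfold mem_Collect_eq)
    fix a b c assume abc: "a permutes {1..p}" "b permutes {1..q}" "c permutes {1..r}"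
    \<comment> \<open>The first \<open>p\<close> letters are split off, then the last
      \<open>r\<close>, so that only the middle block is left for \<open>b\<close>.\<close>
    have "irr_char N lam (young_embed p a (young_embed q b c)) =
        (\<Sum>w1\<in>inv_words N {1..p} a. \<Sum>w2\<in>inv_words N {1..r} c. F w1 w2 b)"
      unfolding size add.assoc frob_young_embed[OF abc(1) young_embed_permutes[OF abc(2,3)]]
        frob_young_embed'[OF abc(2,3)] F_def ..
    moreover have "irr_char N \<mu> (young_embed p a b) = (\<Sum>w3\<in>inv_words N {1..p} a. F' w3 b)"
      unfolding size frob_young_embed[OF abc(1,2)] F'_def ..
    moreover have "irr_char N \<nu> (young_embed q b c) = (\<Sum>w4\<in>inv_words N {1..r} c. F'' w4 b)"
      unfolding size frob_young_embed'[OF abc(2,3)] F''_def ..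
    ultimately show "irr_char N lam (young_embed p a (young_embed q b c)) *
        (irr_char N \<mu> (young_embed p a b) * irr_char N \<nu> (young_embed q b c)) =
      (\<Sum>w1\<in>inv_words N {1..p} a. \<Sum>w2\<in>inv_words N {1..r} c. F w1 w2 b) *
      ((\<Sum>w3\<in>inv_words N {1..p} a. F' w3 b) * (\<Sum>w4\<in>inv_words N {1..r} c. F'' w4 b))" by simp
  qed
  also have "\<dots> = (\<Sum>a | a permutes {1..p}. \<Sum>c | c permutes {1..r}. \<Sum>b | b permutes {1..q}.
      \<Sum>w1\<in>inv_words N {1..p} a. \<Sum>w2\<in>inv_words N {1..r} c. \<Sum>w3\<in>inv_words N {1..p} a. \<Sum>w4\<in>inv_words N {1..r} c.
        F w1 w2 b * (F' w3 b * F'' w4 b))"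
    by (rule sum.cong[OF refl], rule trans[OF sum.swap], simp only: sum_distrib_right, simp only: sum_distrib_left)
  also have "\<dots> = (\<Sum>a | a permutes {1..p}. \<Sum>c | c permutes {1..r}.
      \<Sum>w1\<in>inv_words N {1..p} a. \<Sum>w2\<in>inv_words N {1..r} c. \<Sum>w3\<in>inv_words N {1..p} a. \<Sum>w4\<in>inv_words N {1..r} c.
        \<Sum>b | b permutes {1..q}. F w1 w2 b * (F' w3 b * F'' w4 b))"
    by (simp only: sum.swap[where A="{b. b permutes {1..q}}"])
  finally show ?thesis by (simp only: kron_sum_def F_def F'_def F''_def)
qed

text \<open>Equal sizes mean \<open>p = r = 0\<close>: the inducing group is a diagonal copy of the
  full symmetric group, and induction does nothing. This provides the positivity in
  \<open>H_triple\<close>.\<close>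

lemma heisenberg_coeff_eq_kronecker:
  assumes part: "is_partition \<alpha>" "is_partition \<beta>" "is_partition \<gamma>"
    and size: "psize \<alpha> = n" "psize \<beta> = n" "psize \<gamma> = n"
  shows "heisenberg_coeff \<alpha> \<beta> \<gamma> = kronecker \<alpha> \<beta> \<gamma>"
proof -
  obtain N where N: "\<forall>i\<ge>N. \<alpha> i = 0" "\<forall>i\<ge>N. \<beta> i = 0" "\<forall>i\<ge>N. \<gamma> i = 0"
    using partitions_bounded[of "{\<alpha>, \<beta>, \<gamma>}"] part by auto
  have [simp]: "{p. p permutes {1..0::nat}} = {id}" by (auto simp: permutes_empty)
  have [simp]: "young_embed n b id = b" "young_embed 0 id b = b" if "b permutes {1..n}" for b
    using that permutes_not_in[OF that] by (auto simp: young_embed_def fun_eq_iff)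
  have "fact n * int (heisenberg_coeff \<alpha> \<beta> \<gamma>) =
    (\<Sum>b | b permutes {1..n}. irr_char N \<alpha> b * (irr_char N \<beta> b * irr_char N \<gamma> b))"
    using heisenberg_coeff_eq_sum[OF part N, of 0 n 0] size by simp
  also have "\<dots> = fact n * int (kronecker \<alpha> \<beta> \<gamma>)"
    using kronecker_eq_kron_sum[OF part N size] size by (simp add: kron_sum_def)
  finally show ?thesis by simp
qed

theorem theorem3p4:
  fixes \<alpha> \<beta> \<gamma> :: "nat \<Rightarrow> nat"
  assumes "K_stable \<alpha> \<beta> \<gamma>"
  shows "H_stable \<alpha> \<beta> \<gamma>"
proof -
  have part: "is_partition \<alpha>" "is_partition \<beta>" "is_partition \<gamma>"
    and sizes: "psize \<beta> = psize \<alpha>" "psize \<gamma> = psize \<alpha>" and pos: "0 < kronecker \<alpha> \<beta> \<gamma>"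
    using assms by (auto simp: K_stable_def K_triple_def)
  have "H_triple \<alpha> \<beta> \<gamma>"
    using part sizes pos heisenberg_coeff_eq_kronecker[OF part refl sizes] by (simp add: H_triple_def)
  moreover have "eventually_constant (\<lambda>n. heisenberg_coeff
      (add_multiple lam n \<alpha>) (add_multiple \<mu> n \<beta>) (add_multiple \<nu> n \<gamma>))"
    if P: "is_partition lam" "is_partition \<mu>" "is_partition \<nu>"
      and le: "max (psize \<mu>) (psize \<nu>) \<le> psize lam" "psize lam \<le> psize \<mu> + psize \<nu>" for lam \<mu> \<nu>
  proof -
    define p where "p = psize lam - psize \<nu>"
    define q where "q = psize \<mu> + psize \<nu> - psize lam"
    define r where "r = psize lam - psize \<mu>"
    have size: "psize lam = p + q + r" "psize \<mu> = p + q" "psize \<nu> = q + r"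
      using le by (auto simp: p_def q_def r_def)
    \<comment> \<open>One bound for all six partitions. The characters use \<open>Suc N\<close>
      letters, so that \<alpha>, \<beta>, \<gamma> vanish at the last one.\<close>
    obtain N where "\<forall>\<kappa>\<in>{\<alpha>, \<beta>, \<gamma>, lam, \<mu>, \<nu>}. \<forall>i\<ge>N. \<kappa> i = 0"
      using partitions_bounded[of "{\<alpha>, \<beta>, \<gamma>, lam, \<mu>, \<nu>}"] part P by auto
    then have N: "\<forall>i\<ge>N. \<alpha> i = 0" "\<forall>i\<ge>N. \<beta> i = 0" "\<forall>i\<ge>N. \<gamma> i = 0"
      and NP: "\<forall>i\<ge>Suc N. lam i = 0" "\<forall>i\<ge>Suc N. \<mu> i = 0" "\<forall>i\<ge>Suc N. \<nu> i = 0" by auto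
    define x where "x w1 w2 i = shifted (Suc N) lam i - int (content {1..p} w1 i) - int (content {1..r} w2 i)" for w1 w2 i
    define y where "y w i = shifted (Suc N) \<mu> i - int (content {1..p} w i)" for w i
    define z where "z w i = shifted (Suc N) \<nu> i - int (content {1..r} w i)" for w i
    \<comment> \<open>The denominator is the factor depending on \<open>n\<close> in the formula for
      the Heisenberg coefficient; after dividing by it only the constant
      \<open>fact p * fact r\<close> remains.\<close>
    define K where "K w1 w2 w3 w4 n = real_of_int (kron_sum (Suc N) (q + n * psize \<alpha>)
      (\<lambda>i. x w1 w2 i + int n * int (\<alpha> i)) (\<lambda>i. y w3 i + int n * int (\<beta> i)) (\<lambda>i. z w4 i + int n * int (\<gamma> i))) /
      fact (q + n * psize \<alpha>)" for w1 w2 w3 w4 n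
    have K: "eventually_constant (K w1 w2 w3 w4)"
      if "w1 \<in> inv_words (Suc N) {1..p} a" "w2 \<in> inv_words (Suc N) {1..r} c"
        "w3 \<in> inv_words (Suc N) {1..p} a" "w4 \<in> inv_words (Suc N) {1..r} c" for w1 w2 w3 w4 a c
      unfolding K_def
    proof (rule eventually_constant_kron_sum[OF assms N])
      have content: "(\<Sum>i<Suc N. int (content {1..p} w i)) = int p" if "w \<in> inv_words (Suc N) {1..p} g" for w g p
        using sum_content_inv_words[OF _ that] by simp
      show "(\<Sum>i<Suc N. x w1 w2 i) = int q + (\<Sum>i<Suc N. delta (Suc N) i)"
        "(\<Sum>i<Suc N. y w3 i) = int q + (\<Sum>i<Suc N. delta (Suc N) i)"
        "(\<Sum>i<Suc N. z w4 i) = int q + (\<Sum>i<Suc N. delta (Suc N) i)"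
        unfolding x_def y_def z_def sum_subtractf sum_shifted[OF NP(1)] sum_shifted[OF NP(2)] sum_shifted[OF NP(3)]
          content[OF that(1)] content[OF that(2)] content[OF that(3)] content[OF that(4)] size by simp_all
    qed
    have eq: "real (heisenberg_coeff (add_multiple lam n \<alpha>) (add_multiple \<mu> n \<beta>) (add_multiple \<nu> n \<gamma>)) =
      (\<Sum>a | a permutes {1..p}. \<Sum>c | c permutes {1..r}.
       \<Sum>w1\<in>inv_words (Suc N) {1..p} a. \<Sum>w2\<in>inv_words (Suc N) {1..r} c.
       \<Sum>w3\<in>inv_words (Suc N) {1..p} a. \<Sum>w4\<in>inv_words (Suc N) {1..r} c. K w1 w2 w3 w4 n) / (fact p * fact r)"
      (is "real ?h = ?S / _") for n
    proof -
      let ?q = "q + n * psize \<alpha>"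
      have ge: "\<forall>i\<ge>Suc N. \<delta> i = 0" if "\<forall>i\<ge>N. \<delta> i = 0" for \<delta> :: "nat \<Rightarrow> nat" using that by auto
      \<comment> \<open>All three sizes grow by the same amount, so \<open>p\<close> and
        \<open>r\<close> persist and the outer sums range over sets independent of
        \<open>n\<close>.\<close>
      have psizes: "psize (add_multiple lam n \<alpha>) = p + ?q + r" "psize (add_multiple \<mu> n \<beta>) = p + ?q"
        "psize (add_multiple \<nu> n \<gamma>) = ?q + r"
        using P part size sizes by (simp_all add: psize_add_multiple)
      have x_eq: "(\<lambda>i. shifted (Suc N) (add_multiple lam n \<alpha>) i - int (content {1..p} w1 i) - int (content {1..r} w2 i)) =
          (\<lambda>i. x w1 w2 i + int n * int (\<alpha> i))" for w1 w2
        by (simp add: x_def shifted_add_multiple fun_eq_iff)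
      have y_eq: "(\<lambda>i. shifted (Suc N) (add_multiple \<mu> n \<beta>) i - int (content {1..p} w i)) =
          (\<lambda>i. y w i + int n * int (\<beta> i))" for w
        by (simp add: y_def shifted_add_multiple fun_eq_iff)
      have z_eq: "(\<lambda>i. shifted (Suc N) (add_multiple \<nu> n \<gamma>) i - int (content {1..r} w i)) =
          (\<lambda>i. z w i + int n * int (\<gamma> i))" for w
        by (simp add: z_def shifted_add_multiple fun_eq_iff)
      have K_fact: "K w1 w2 w3 w4 n * fact ?q = real_of_int (kron_sum (Suc N) ?q
          (\<lambda>i. x w1 w2 i + int n * int (\<alpha> i)) (\<lambda>i. y w3 i + int n * int (\<beta> i)) (\<lambda>i. z w4 i + int n * int (\<gamma> i)))"
        for w1 w2 w3 w4 by (simp add: K_def)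
      have "real_of_int (fact p * fact ?q * fact r * int ?h) = ?S * fact ?q"
        unfolding heisenberg_coeff_eq_kron_sums[OF add_multiple_partition[OF P(1) part(1)]
            add_multiple_partition[OF P(2) part(2)] add_multiple_partition[OF P(3) part(3)]
            add_multiple_eq_0[OF NP(1) ge[OF N(1)]] add_multiple_eq_0[OF NP(2) ge[OF N(2)]]
            add_multiple_eq_0[OF NP(3) ge[OF N(3)]] psizes] x_eq y_eq z_eq
        by (simp only: of_int_sum sum_distrib_right K_fact)
      then have "real ?h * (fact p * fact r) = ?S"
        by (simp add: mult_ac)
      then show ?thesis by (simp add: field_simps)
    qed
    have "eventually_constant (\<lambda>n. (\<Sum>a | a permutes {1..p}. \<Sum>c | c permutes {1..r}.
       \<Sum>w1\<in>inv_words (Suc N) {1..p} a. \<Sum>w2\<in>inv_words (Suc N) {1..r} c.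
       \<Sum>w3\<in>inv_words (Suc N) {1..p} a. \<Sum>w4\<in>inv_words (Suc N) {1..r} c. K w1 w2 w3 w4 n))"
      by (intro eventually_constant_sum K)
    then have "eventually_constant (\<lambda>n. (\<Sum>a | a permutes {1..p}. \<Sum>c | c permutes {1..r}.
       \<Sum>w1\<in>inv_words (Suc N) {1..p} a. \<Sum>w2\<in>inv_words (Suc N) {1..r} c.
       \<Sum>w3\<in>inv_words (Suc N) {1..p} a. \<Sum>w4\<in>inv_words (Suc N) {1..r} c. K w1 w2 w3 w4 n) / (fact p * fact r))"
      by (rule eventually_constant_compose)
    \<comment> \<open>The division forced a passage to the reals; floor and \<open>nat\<close>
      recover the natural number.\<close>
    then have "eventually_constant (\<lambda>n. nat \<lfloor>real (heisenberg_coeff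
        (add_multiple lam n \<alpha>) (add_multiple \<mu> n \<beta>) (add_multiple \<nu> n \<gamma>))\<rfloor>)"
      unfolding eq[symmetric] by (rule eventually_constant_compose)
    then show ?thesis by simp
  qed
  ultimately show ?thesis by (simp add: H_stable_def)
qed

end
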